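(* Let $l,n\ge1$, let $r\in\mathbb{Z}_{>0}$, let $r_0,\ldots,r_{l-1}$ be integers, and put $m_i=r_i/r$ and ${\bf m}=(m_0,\ldots,m_{l-1})\in\mathbb{Q}^l$. For every $\boldsymbol{\lambda}=(\lambda^0,\ldots,\lambda^{l-1})\in\Pi^l_n$, the ${\bf a}$-value of $\boldsymbol{\lambda}$ is $${\bf a}^{({\bf m},r)}(\boldsymbol{\lambda})=r\left(n(\bar{\boldsymbol{\lambda}})-\sum_{0\le s\le l-1}\ \sum_{(i,j)\in[\lambda^s]}\ \sum_{0\le t\le l-1,\ t\neq s}\min\left(h_{i,j}^{\lambda^s,\lambda^t}+m_s-m_t,\,0\right)\right).$$
   Context: Partitions. A partition $\lambda=(\lambda_1,\lambda_2,\ldots)$ is a weakly decreasing sequence of non-negative integers with finite sum $|\lambda|$; its nodes are $[\lambda]=\{(i,j): i\ge1,\ 1\le j\le\lambda_i\}$; its conjugate is $\lambda'_k=\#\{i\ge 1:\lambda_i\ge k\}$; $n(\lambda)=\sum_{i\ge1}(i-1)\lambda_i$. For partitions $\lambda,\mu$ and $(i,j)\in[\lambda]$, the generalised hook length is $h_{i,j}^{\lambda,\mu}=\lambda_i-i+\mu'_j-j+1$. An $l$-partition of $n$ is an $l$-tuple $\boldsymbol{\lambda}=(\lambda^0,\ldots,\lambda^{l-1})$ of partitions with $\sum_s|\lambda^s|=n$; $\Pi^l_n$ is the set of these. $\bar{\boldsymbol{\lambda}}$ is the partition of $n$ obtained by arranging all the parts $\lambda^s_i$ ($0\le s\le l-1$,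 $i\ge1$) in decreasing order. Ariki-Koike algebra. For a field $F$ and nonzero $x,Q_0,\ldots,Q_{l-1}\in F$, the Ariki-Koike algebra with parameters $(Q_0,\ldots,Q_{l-1};x)$ is the unital associative $F$-algebra with generators $T_0,\ldots,T_{n-1}$ and relations $(T_0-Q_0)\cdots(T_0-Q_{l-1})=0$; $(T_i-x)(T_i+1)=0$ for $1\le i\le n-1$; $T_0T_1T_0T_1=T_1T_0T_1T_0$; $T_iT_{i+1}T_i=T_{i+1}T_iT_{i+1}$ for $1\le i\le n-2$; $T_iT_j=T_jT_i$ for $0\le i<j\le n-1$, $j-i>1$. When it is split semisimple, its simple modules are, up to isomorphism, the $V^{\boldsymbol{\lambda}}$ ($\boldsymbol{\lambda}\in\Pi^l_n$) of Ariki and Koike: $V^{\boldsymbol{\lambda}}$ has a basis $(v_T)$ indexed by the standard $\boldsymbol{\lambda}$-tableaux $T$ (fillings of the nodes of $\lambda^0,\ldots,\lambda^{l-1}$ by $1,\ldots,n$, increasing along rows and columns in each component). If $k$ occupies the node $(i,j)$ of component $s$ of $T$, put $c_k=x^{j-i}Q_s$. Then $T_0v_T=Q_sv_T$, where $s$ is the component containing $1$; for $1\le k\le n-1$, $T_kv_T=xv_T$ (resp. $-v_T$) if $k,k+1$ lie in the same row (resp. column) of the same component, and otherwise $T_kv_T=a\,v_T+(1+a)v_{s_kT}$, where $s_kT$ is $T$ with $k,k+1$ exchanged and $a=(x-1)c_{k+1}/(c_{k+1}-c_k)$. Its character is $\chi^{\boldsymbol{\lambda}}$. Schur elements. Let $L_k=x^{1-k}T_{k-1}\cdots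 T_1T_0T_1\cdots T_{k-1}$ for $1\le k\le n$, and for $w\in\mathfrak{S}_n$ let $T_w$ be the product of the $T_i$ ($1\le i\le n-1$) along a reduced expression of $w$. The elements $L_1^{c_1}\cdots L_n^{c_n}T_w$ ($0\le c_k<l$, $w\in\mathfrak{S}_n$) form an $F$-basis, and $\tau$ is the linear form which is $1$ on the basis element $1$ and $0$ on all others. The Schur elements $s_{\boldsymbol{\lambda}}\in F$ are defined by $\tau=\sum_{\boldsymbol{\lambda}\in\Pi^l_n}\frac{1}{s_{\boldsymbol{\lambda}}}\chi^{\boldsymbol{\lambda}}$. ${\bf a}$-values. Let $\eta_l=\exp(2\sqrt{-1}\pi/l)$, $K=\mathbb{Q}(\eta_l)$ and let $u$ be an indeterminate. The cyclotomic Ariki-Koike algebra $K(u)\mathcal{H}_n^{{\bf m},r}$ is the Ariki-Koike algebra over $F=K(u)$ with $x=u^r$ and $Q_j=\eta_l^ju^{r_j}$ for $0\le j\le l-1$; it is split semisimple. The ${\bf a}$-value ${\bf a}^{({\bf m},r)}(\boldsymbol{\lambda})$ is the negative of the valuation in $u$ (order of vanishing at $u=0$, i.e. the lowest exponent of $u$ occurring, for a Laurent polynomial) of the Schur element of $V^{\boldsymbol{\lambda}}$ for this algebra. *)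

theory Defs
  imports
    Complex_Main
    "HOL-Library.FuncSet"
    "HOL-Library.Multiset"
    "HOL-Combinatorics.Permutations"
    "HOL-Computational_Algebra.Polynomial"
    "HOL-Computational_Algebra.Fraction_Field"
    "HOL-Algebra.QuotRing"
    "HOL-Algebra.Generated_Fields"
    "HOL-Algebra.Algebraic_Closure_Type"
begin

section \<open>Partitions and multipartitions\<close>

text \<open>Parts are indexed from 1; position 0 carries the dummy value 0, so that equal partitions
  are equal functions.\<close>

definition is_partition :: "(nat \<Rightarrow> nat) \<Rightarrow> bool" where
  "is_partition p \<longleftrightarrow> p 0 = 0 \<and> (\<forall>i\<ge>1. p (Suc i) \<le> p i) \<and> finite {i. p i \<noteq> 0}"

definition psize :: "(nat \<Rightarrow> nat) \<Rightarrow> nat" where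
  "psize p = (\<Sum>i\<in>{i. i \<ge> 1 \<and> p i \<noteq> 0}. p i)"

definition nodes :: "(nat \<Rightarrow> nat) \<Rightarrow> (nat \<times> nat) set" where
  "nodes p = {(i, j). 1 \<le> i \<and> 1 \<le> j \<and> j \<le> p i}"

definition conjugate :: "(nat \<Rightarrow> nat) \<Rightarrow> nat \<Rightarrow> nat" where
  "conjugate p k = card {i. i \<ge> 1 \<and> p i \<ge> k}"

definition n_stat :: "(nat \<Rightarrow> nat) \<Rightarrow> nat" where
  "n_stat p = (\<Sum>i\<in>{i. i \<ge> 1 \<and> p i \<noteq> 0}. (i - 1) * p i)"

definition gen_hook :: "(nat \<Rightarrow> nat) \<Rightarrow> (nat \<Rightarrow> nat) \<Rightarrow> nat \<Rightarrow> nat \<Rightarrow> int" where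
  "gen_hook p q i j = int (p i) - int i + int (conjugate q j) - int j + 1"

definition multipartitions :: "nat \<Rightarrow> nat \<Rightarrow> (nat \<Rightarrow> nat) list set" where
  "multipartitions l n =
     {lam. length lam = l \<and> (\<forall>s<l. is_partition (lam ! s)) \<and> (\<Sum>s<l. psize (lam ! s)) = n}"

text \<open>The nonzero parts of all components in decreasing order, followed by zeros.\<close>

definition merged_parts :: "(nat \<Rightarrow> nat) list \<Rightarrow> nat list" where
  "merged_parts lam = rev (sorted_list_of_multiset
     (image_mset (\<lambda>(s, i). (lam ! s) i)
        (mset_set {(s, i). s < length lam \<and> i \<ge> 1 \<and> (lam ! s) i \<noteq> 0})))"

definition merged_partition :: "(nat \<Rightarrow> nat) list \<Rightarrow> nat \<Rightarrow> nat" where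
  "merged_partition lam i =
     (if 1 \<le> i \<and> i \<le> length (merged_parts lam) then merged_parts lam ! (i - 1) else 0)"


section \<open>Standard tableaux\<close>

text \<open>A node of a multipartition is a triple (component, row, column). A tableau is extended by
  0 outside the nodes; exchanging the entries \<open>k\<close> and \<open>k + 1\<close> with \<open>k \<ge> 1\<close> preserves this.\<close>

type_synonym tableau = "nat \<times> nat \<times> nat \<Rightarrow> nat"

definition mnodes :: "(nat \<Rightarrow> nat) list \<Rightarrow> (nat \<times> nat \<times> nat) set" where
  "mnodes lam = {(s, i, j). s < length lam \<and> (i, j) \<in> nodes (lam ! s)}"

definition std_tableaux :: "(nat \<Rightarrow> nat) list \<Rightarrow> tableau set" where
  "std_tableaux lam = {T.
     (\<forall>N. N \<notin> mnodes lam \<longrightarrow> T N = 0) \<and>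
     bij_betw T (mnodes lam) {1..card (mnodes lam)} \<and>
     (\<forall>s i j. (s, i, j) \<in> mnodes lam \<and> (s, i, Suc j) \<in> mnodes lam \<longrightarrow>
        T (s, i, j) < T (s, i, Suc j)) \<and>
     (\<forall>s i j. (s, i, j) \<in> mnodes lam \<and> (s, Suc i, j) \<in> mnodes lam \<longrightarrow>
        T (s, i, j) < T (s, Suc i, j))}"

definition node_of :: "(nat \<Rightarrow> nat) list \<Rightarrow> tableau \<Rightarrow> nat \<Rightarrow> nat \<times> nat \<times> nat" where
  "node_of lam T k = inv_into (mnodes lam) T k"

definition comp_of :: "(nat \<Rightarrow> nat) list \<Rightarrow> tableau \<Rightarrow> nat \<Rightarrow> nat" where
  "comp_of lam T k = fst (node_of lam T k)"

definition row_of :: "(nat \<Rightarrow> nat) list \<Rightarrow> tableau \<Rightarrow> nat \<Rightarrow> nat" where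
  "row_of lam T k = fst (snd (node_of lam T k))"

definition col_of :: "(nat \<Rightarrow> nat) list \<Rightarrow> tableau \<Rightarrow> nat \<Rightarrow> nat" where
  "col_of lam T k = snd (snd (node_of lam T k))"

definition swap_entries :: "nat \<Rightarrow> tableau \<Rightarrow> tableau" where
  "swap_entries k T = (\<lambda>N. transpose k (Suc k) (T N))"


section \<open>Free algebras\<close>

text \<open>The free unital associative algebra on generators \<open>0, \<dots>, n - 1\<close> over a subfield \<open>F\<close> of the
  ambient field: finitely supported functions on words, with concatenation product.\<close>

definition free_algebra :: "'a::field set \<Rightarrow> nat \<Rightarrow> (nat list \<Rightarrow> 'a) ring" where
  "free_algebra F n =
     \<lparr>carrier = {f. finite {w. f w \<noteq> 0} \<and> (\<forall>w. f w \<in> F) \<and> (\<forall>w. f w \<noteq> 0 \<longrightarrow> set w \<subseteq> {..<n})},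
      monoid.mult = (\<lambda>f g w. \<Sum>k\<le>length w. f (take k w) * g (drop k w)),
      one = (\<lambda>w. if w = [] then 1 else 0),
      zero = (\<lambda>w. 0),
      add = (\<lambda>f g w. f w + g w)\<rparr>"

definition word_elt :: "nat list \<Rightarrow> nat list \<Rightarrow> 'a::field" where
  "word_elt v = (\<lambda>w. if w = v then 1 else 0)"

definition scalar_elt :: "'a::field \<Rightarrow> nat list \<Rightarrow> 'a" where
  "scalar_elt c = (\<lambda>w. if w = [] then c else 0)"

definition list_prod :: "('b, 'c) monoid_scheme \<Rightarrow> 'b list \<Rightarrow> 'b" where
  "list_prod G xs = foldr (monoid.mult G) xs (monoid.one G)"


section \<open>Reduced expressions in the symmetric group\<close>

definition word_perm :: "nat list \<Rightarrow> nat \<Rightarrow> nat" where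
  "word_perm ks = foldr (\<lambda>k p. transpose k (Suc k) \<circ> p) ks id"

definition reduced_expr :: "nat \<Rightarrow> (nat \<Rightarrow> nat) \<Rightarrow> nat list \<Rightarrow> bool" where
  "reduced_expr n w ks \<longleftrightarrow> set ks \<subseteq> {1..<n} \<and> word_perm ks = w \<and>
     (\<forall>ks'. set ks' \<subseteq> {1..<n} \<and> word_perm ks' = w \<longrightarrow> length ks \<le> length ks')"


section \<open>Ariki-Koike algebras\<close>

context
  fixes F :: "'a::field set" and l n :: nat and x :: 'a and Q :: "nat \<Rightarrow> 'a"
begin

definition ak_relations :: "(nat list \<Rightarrow> 'a) set" where
  "ak_relations = (let R = free_algebra F n in
     {list_prod R (map (\<lambda>j. word_elt [0] \<ominus>\<^bsub>R\<^esub> scalar_elt (Q j)) [0..<l])} \<union>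
     {(word_elt [i] \<ominus>\<^bsub>R\<^esub> scalar_elt x) \<otimes>\<^bsub>R\<^esub> (word_elt [i] \<oplus>\<^bsub>R\<^esub> \<one>\<^bsub>R\<^esub>) | i. 1 \<le> i \<and> i < n} \<union>
     (if n \<ge> 2 then {word_elt [0, 1, 0, 1] \<ominus>\<^bsub>R\<^esub> word_elt [1, 0, 1, 0]} else {}) \<union>
     {word_elt [i, i + 1, i] \<ominus>\<^bsub>R\<^esub> word_elt [i + 1, i, i + 1] | i. 1 \<le> i \<and> i + 1 < n} \<union>
     {word_elt [i, j] \<ominus>\<^bsub>R\<^esub> word_elt [j, i] | i j. i + 1 < j \<and> j < n})"

definition ak_ideal :: "(nat list \<Rightarrow> 'a) set" where
  "ak_ideal = Idl\<^bsub>free_algebra F n\<^esub> ak_relations"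

definition ak_algebra :: "(nat list \<Rightarrow> 'a) set ring" where
  "ak_algebra = free_algebra F n Quot ak_ideal"

definition ak_class :: "(nat list \<Rightarrow> 'a) \<Rightarrow> (nat list \<Rightarrow> 'a) set" where
  "ak_class f = ak_ideal +>\<^bsub>free_algebra F n\<^esub> f"

definition jucys_murphy :: "nat \<Rightarrow> (nat list \<Rightarrow> 'a) set" where
  "jucys_murphy k =
     ak_class (scalar_elt (x powi (1 - int k))) \<otimes>\<^bsub>ak_algebra\<^esub>
     ak_class (word_elt (rev [1..<k] @ [0] @ [1..<k]))"

text \<open>By the braid relations the choice of the reduced expression is immaterial.\<close>

definition T_perm :: "(nat \<Rightarrow> nat) \<Rightarrow> (nat list \<Rightarrow> 'a) set" where
  "T_perm w = ak_class (word_elt (SOME ks. reduced_expr n w ks))"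

definition ak_basis_elt :: "(nat \<Rightarrow> nat) \<Rightarrow> (nat \<Rightarrow> nat) \<Rightarrow> (nat list \<Rightarrow> 'a) set" where
  "ak_basis_elt c w =
     list_prod ak_algebra (map (\<lambda>k. jucys_murphy k [^]\<^bsub>ak_algebra\<^esub> c k) [1..<Suc n])
       \<otimes>\<^bsub>ak_algebra\<^esub> T_perm w"

definition ak_linear_form :: "((nat list \<Rightarrow> 'a) set \<Rightarrow> 'a) \<Rightarrow> bool" where
  "ak_linear_form f \<longleftrightarrow>
     f \<in> carrier ak_algebra \<rightarrow>\<^sub>E F \<and>
     (\<forall>a\<in>carrier ak_algebra. \<forall>b\<in>carrier ak_algebra. f (a \<oplus>\<^bsub>ak_algebra\<^esub> b) = f a + f b) \<and>
     (\<forall>c\<in>F. \<forall>a\<in>carrier ak_algebra. f (ak_class (scalar_elt c) \<otimes>\<^bsub>ak_algebra\<^esub> a) = c * f a)"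

definition ak_tau :: "(nat list \<Rightarrow> 'a) set \<Rightarrow> 'a" where
  "ak_tau = (THE f. ak_linear_form f \<and>
     (\<forall>c w. (\<forall>k\<in>{1..n}. c k < l) \<and> w permutes {1..n} \<longrightarrow>
        f (ak_basis_elt c w) = (if (\<forall>k\<in>{1..n}. c k = 0) \<and> w = id then 1 else 0)))"

text \<open>The modules of Ariki and Koike: vectors are coefficient functions on the standard tableaux.\<close>

definition content :: "(nat \<Rightarrow> nat) list \<Rightarrow> tableau \<Rightarrow> nat \<Rightarrow> 'a" where
  "content lam T k = x powi (int (col_of lam T k) - int (row_of lam T k)) * Q (comp_of lam T k)"

definition basis_vec :: "tableau \<Rightarrow> tableau \<Rightarrow> 'a" where
  "basis_vec T = (\<lambda>S. if S = T then 1 else 0)"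

text \<open>\<open>gen_image lam k T\<close> is the image of the basis vector of \<open>T\<close> under the generator \<open>k\<close>.\<close>

definition gen_image :: "(nat \<Rightarrow> nat) list \<Rightarrow> nat \<Rightarrow> tableau \<Rightarrow> tableau \<Rightarrow> 'a" where
  "gen_image lam k T =
     (if k = 0 then (\<lambda>S. Q (comp_of lam T 1) * basis_vec T S)
      else if comp_of lam T k = comp_of lam T (k + 1) \<and> row_of lam T k = row_of lam T (k + 1)
        then (\<lambda>S. x * basis_vec T S)
      else if comp_of lam T k = comp_of lam T (k + 1) \<and> col_of lam T k = col_of lam T (k + 1)
        then (\<lambda>S. - basis_vec T S)
      else (let a = (x - 1) * content lam T (k + 1) / (content lam T (k + 1) - content lam T k)
        in (\<lambda>S. a * basis_vec T S + (1 + a) * basis_vec (swap_entries k T) S)))"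

definition gen_act :: "(nat \<Rightarrow> nat) list \<Rightarrow> nat \<Rightarrow> (tableau \<Rightarrow> 'a) \<Rightarrow> tableau \<Rightarrow> 'a" where
  "gen_act lam k v = (\<lambda>S. \<Sum>T\<in>std_tableaux lam. v T * gen_image lam k T S)"

definition free_act ::
  "(nat \<Rightarrow> nat) list \<Rightarrow> (nat list \<Rightarrow> 'a) \<Rightarrow> (tableau \<Rightarrow> 'a) \<Rightarrow> tableau \<Rightarrow> 'a" where
  "free_act lam f v = (\<lambda>S. \<Sum>w\<in>{w. f w \<noteq> 0}. f w * foldr (gen_act lam) w v S)"

definition free_character :: "(nat \<Rightarrow> nat) list \<Rightarrow> (nat list \<Rightarrow> 'a) \<Rightarrow> 'a" where
  "free_character lam f = (\<Sum>T\<in>std_tableaux lam. free_act lam f (basis_vec T) T)"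

text \<open>The trace of any representative: the defining relations hold on the module, so the trace
  is constant on the cosets.\<close>

definition ak_character :: "(nat \<Rightarrow> nat) list \<Rightarrow> (nat list \<Rightarrow> 'a) set \<Rightarrow> 'a" where
  "ak_character lam h = the_elem (free_character lam ` h)"

definition schur_element :: "(nat \<Rightarrow> nat) list \<Rightarrow> 'a" where
  "schur_element = (THE s. s \<in> multipartitions l n \<rightarrow>\<^sub>E F - {0} \<and>
     (\<forall>h\<in>carrier ak_algebra.
        ak_tau h = (\<Sum>lam\<in>multipartitions l n. 1 / s lam * ak_character lam h)))"

end


section \<open>Cyclotomic specialisation and a-values\<close>

definition eta :: "nat \<Rightarrow> complex" where
  "eta l = exp (2 * \<i> * complex_of_real pi / of_nat l)"

definition cyclotomic_field :: "nat \<Rightarrow> complex set" where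
  "cyclotomic_field l = generate_field ring_of_type_algebra {eta l}"

definition const_fract :: "complex \<Rightarrow> complex poly fract" where
  "const_fract c = Fract [:c:] 1"

definition u_fract :: "complex poly fract" where
  "u_fract = Fract [:0, 1:] 1"

text \<open>\<open>K(u)\<close> as a subfield of \<open>\<complex>(u)\<close>.\<close>

definition cyclotomic_rat_funs :: "nat \<Rightarrow> complex poly fract set" where
  "cyclotomic_rat_funs l =
     generate_field ring_of_type_algebra (const_fract ` cyclotomic_field l \<union> {u_fract})"

text \<open>Order of vanishing at \<open>u = 0\<close> of a nonzero rational function.\<close>

definition u_valuation :: "complex poly fract \<Rightarrow> int" where
  "u_valuation f = (THE v. \<exists>p q. p \<noteq> 0 \<and> q \<noteq> 0 \<and> f = Fract p q \<and>
     v = int (Polynomial.order 0 p) - int (Polynomial.order 0 q))"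

text \<open>The arguments \<open>r\<close> and \<open>rs\<close> stand for the integers \<open>r\<close> and \<open>r\<^sub>0, \<dots>, r\<^bsub>l-1\<^esub>\<close>, that is,
  for the pair of \<open>m\<^sub>j = r\<^sub>j / r\<close> and \<open>r\<close>.\<close>

definition cyclotomic_schur_element ::
  "nat \<Rightarrow> nat \<Rightarrow> int \<Rightarrow> (nat \<Rightarrow> int) \<Rightarrow> (nat \<Rightarrow> nat) list \<Rightarrow> complex poly fract" where
  "cyclotomic_schur_element l n r rs =
     schur_element (cyclotomic_rat_funs l) l n (u_fract powi r)
       (\<lambda>j. const_fract (eta l ^ j) * u_fract powi rs j)"

definition a_value :: "nat \<Rightarrow> nat \<Rightarrow> int \<Rightarrow> (nat \<Rightarrow> int) \<Rightarrow> (nat \<Rightarrow> nat) list \<Rightarrow> int" where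
  "a_value l n r rs lam = - u_valuation (cyclotomic_schur_element l n r rs lam)"

end

theory Submission
  imports Defs
begin

text \<open>
  A linear form on the algebra is the same as a function on words in the generators which is killed by
  all two-sided translates of the defining relations. Such a function is determined by its values on
  the elements \<open>L\<^sup>c T\<^sub>w\<close>, because the functions vanishing on all of them are closed under left
  translation by a generator. Hence \<open>\<tau>\<close> can be identified by evaluating a candidate on these elements,
  and the candidate is the sum of the characters weighted by the inverses of the hook products
  \<open>s(D) = \<plusminus> x\<^bsup>-N\<^esup> (x-1)\<^bsup>-n\<^esup> \<Prod> (x\<^bsup>h\<^esup> Q\<^sub>s / Q\<^sub>t - 1)\<close>.

  On the seminormal basis \<open>L\<^sub>k\<close> is diagonal with the residue of the \<open>k\<close>-th node as eigenvalue. Adding a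
  node \<open>A\<close> to \<open>D\<close> multiplies \<open>s(D)\<close> by a constant times \<open>c\<^sub>A \<Prod> (c\<^sub>A - c\<^sub>A\<^sub>') / \<Prod> (c\<^sub>A - c\<^sub>B)\<close>, where \<open>A'\<close> runs over
  the other addable and \<open>B\<close> over the removable nodes of \<open>D\<close>. Splitting off the last node of a tableau,
  the vanishing of the candidate on \<open>L\<^sup>c T\<^sub>w \<noteq> 1\<close> therefore reduces to Lagrange interpolation at the residues
  of the addable nodes. Polynomials in the \<open>L\<^sub>k\<close> separate the characters, so the hook products are
  the Schur elements, and the valuation of each factor is a minimum with 0.
\<close>

section \<open>Diagrams\<close>

text \<open>Both \<open>ak_tau\<close> and \<open>schur_element\<close> are definite descriptions,
  so each needs existence and uniqueness. Uniqueness of \<open>ak_tau\<close> is the dual form of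
  spanning by the elements L^c T_w; existence comes from exhibiting a functional with the prescribed
  values. The interpolation closes because a diagram has exactly l more addable than removable
  nodes. The numerator is the product over the removable nodes times a power of c_A, and its degree
  stays within the Lagrange bound precisely because the exponents in L^c are less than l. For
  exponent 0 the factor c_A in the denominator survives and acts as one further interpolation point
  0; its term, moved to the other side, is the value 1. A generator of top index occurring once
  contributes (x - 1) c_A / (c_A - c_B), where B is the last node before A; this pole cancels
  against a factor of the numerator, and the sum is 0. The argument needs the top letter to occur
  once, and therefore reduced words are replaced by braid-equivalent ones in which the largest
  letter is single.\<close>

definition diagram :: "nat \<Rightarrow> (nat \<times> nat \<times> nat) set \<Rightarrow> bool" where
  "diagram l D \<longleftrightarrow> finite D \<and> (\<forall>(s, i, j)\<in>D. s < l \<and> 1 \<le> i \<and> 1 \<le> j \<and>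
     (1 < i \<longrightarrow> (s, i - 1, j) \<in> D) \<and> (1 < j \<longrightarrow> (s, i, j - 1) \<in> D))"

definition row_len :: "(nat \<times> nat \<times> nat) set \<Rightarrow> nat \<Rightarrow> nat \<Rightarrow> nat" where
  "row_len D s i = card {j. (s, i, j) \<in> D}"

definition col_len :: "(nat \<times> nat \<times> nat) set \<Rightarrow> nat \<Rightarrow> nat \<Rightarrow> nat" where
  "col_len D s j = card {i. (s, i, j) \<in> D}"

definition addable :: "nat \<Rightarrow> (nat \<times> nat \<times> nat) set \<Rightarrow> (nat \<times> nat \<times> nat) set" where
  "addable l D = {A. A \<notin> D \<and> diagram l (insert A D)}"

definition removable :: "nat \<Rightarrow> (nat \<times> nat \<times> nat) set \<Rightarrow> (nat \<times> nat \<times> nat) set" where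
  "removable l D = {B \<in> D. diagram l (D - {B})}"

lemma diagram_finite: "diagram l D \<Longrightarrow> finite D"
  by (simp add: diagram_def)

lemma diagram_empty: "diagram l {}"
  by (simp add: diagram_def)

lemma diagram_memD:
  assumes "diagram l D" "(s, i, j) \<in> D"
  shows "s < l" "1 \<le> i" "1 \<le> j" "1 < i \<Longrightarrow> (s, i - 1, j) \<in> D" "1 < j \<Longrightarrow> (s, i, j - 1) \<in> D"
  using assms unfolding diagram_def by fastforce+

text \<open>A finite set of positive integers closed under predecessor is fixed by its size. Applied
  to rows and columns, this turns membership in a diagram into inequalities on
  \<open>row_len\<close> and \<open>col_len\<close>.\<close>

lemma finite_initial_segment:
  fixes U :: "nat set"
  assumes "finite U" "0 \<notin> U" "\<And>j. j \<in> U \<Longrightarrow> 1 < j \<Longrightarrow> j - 1 \<in> U"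
  shows "U = {1..card U}"
proof (cases "U = {}")
  case False
  define m where "m = Max U"
  have m: "m \<in> U" "\<And>j. j \<in> U \<Longrightarrow> j \<le> m" using assms(1) False by (auto simp: m_def)
  have down: "m - d \<in> U" if "d < m" for d
    using that
  proof (induction d)
    case 0 then show ?case using m by simp
  next
    case (Suc d)
    then have "m - d \<in> U" "1 < m - d" by auto
    then have "m - d - 1 \<in> U" by (rule assms(3))
    then show ?case by simp
  qed
  have "U = {1..m}"
  proof
    show "U \<subseteq> {1..m}" using m assms(2) by (metis atLeastAtMost_iff less_one not_le subsetI)
    show "{1..m} \<subseteq> U"
    proof
      fix j assume "j \<in> {1..m}"
      then show "j \<in> U" using down[of "m - j"] by auto
    qed
  qed
  then show ?thesis by simp
qed simp

lemma diagram_row_set: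
  assumes "diagram l D"
  shows "{j. (s, i, j) \<in> D} = {1..row_len D s i}"
  unfolding row_len_def
proof (rule finite_initial_segment)
  have "{j. (s, i, j) \<in> D} \<subseteq> (\<lambda>N. snd (snd N)) ` D" by force
  then show "finite {j. (s, i, j) \<in> D}" using assms by (meson diagram_finite finite_imageI finite_subset)
qed (use diagram_memD[OF assms] in \<open>fastforce+\<close>)

lemma diagram_col_set:
  assumes "diagram l D"
  shows "{i. (s, i, j) \<in> D} = {1..col_len D s j}"
  unfolding col_len_def
proof (rule finite_initial_segment)
  have "{i. (s, i, j) \<in> D} \<subseteq> (\<lambda>N. fst (snd N)) ` D" by force
  then show "finite {i. (s, i, j) \<in> D}" using assms by (meson diagram_finite finite_imageI finite_subset)
qed (use diagram_memD[OF assms] in \<open>fastforce+\<close>)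

lemma mem_diagram_row: "diagram l D \<Longrightarrow> (s, i, j) \<in> D \<longleftrightarrow> 1 \<le> j \<and> j \<le> row_len D s i"
  by (metis diagram_row_set atLeastAtMost_iff mem_Collect_eq)

lemma mem_diagram_col: "diagram l D \<Longrightarrow> (s, i, j) \<in> D \<longleftrightarrow> 1 \<le> i \<and> i \<le> col_len D s j"
  by (metis diagram_col_set atLeastAtMost_iff mem_Collect_eq)

text \<open>The relation between conjugate partitions: both sides say that (s, i, j) lies in D. Rows
  are exchanged for columns through it.\<close>

lemma row_col_iff:
  "diagram l D \<Longrightarrow> 1 \<le> i \<Longrightarrow> 1 \<le> j \<Longrightarrow> i \<le> col_len D s j \<longleftrightarrow> j \<le> row_len D s i"
  by (metis mem_diagram_row mem_diagram_col)

lemma row_len_antimono: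
  assumes "diagram l D" "1 \<le> i" "i \<le> i'"
  shows "row_len D s i' \<le> row_len D s i"
proof (cases "row_len D s i' = 0")
  case False
  then have "i' \<le> col_len D s (row_len D s i')" using assms row_col_iff[of l D i' "row_len D s i'" s] by auto
  then show ?thesis using assms False row_col_iff[of l D i "row_len D s i'" s] by auto
qed simp

lemma col_len_antimono:
  assumes "diagram l D" "1 \<le> j" "j \<le> j'"
  shows "col_len D s j' \<le> col_len D s j"
proof (cases "col_len D s j' = 0")
  case False
  then have "j' \<le> row_len D s (col_len D s j')" using assms row_col_iff[of l D "col_len D s j'" j' s] by auto
  then show ?thesis using assms False row_col_iff[of l D "col_len D s j'" j s] by auto
qed simp

lemma diagram_down_closed:
  assumes "diagram l D" "(s, i, j) \<in> D" "1 \<le> i'" "i' \<le> i" "1 \<le> j'" "j' \<le> j"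
  shows "(s, i', j') \<in> D"
  using assms mem_diagram_row[OF assms(1)] row_len_antimono[OF assms(1,3,4), of s]
  by (metis le_trans)

section \<open>Addable and removable nodes\<close>

lemma addable_iff:
  assumes "diagram l D"
  shows "(s, i, j) \<in> addable l D \<longleftrightarrow> s < l \<and> 1 \<le> i \<and> 1 \<le> j \<and> (s, i, j) \<notin> D \<and>
     (1 < i \<longrightarrow> (s, i - 1, j) \<in> D) \<and> (1 < j \<longrightarrow> (s, i, j - 1) \<in> D)"
  using assms unfolding addable_def diagram_def by (auto split: prod.splits)

text \<open>An addable node is the first free place of its row and of its column at once, so within
  a component it is determined by either coordinate.\<close>

lemma addable_iff_len:
  assumes "diagram l D"
  shows "(s, i, j) \<in> addable l D \<longleftrightarrow>
    s < l \<and> 1 \<le> i \<and> 1 \<le> j \<and> col_len D s j + 1 = i \<and> row_len D s i + 1 = j"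
proof -
  have a: "(s, i, j) \<notin> D \<longleftrightarrow> row_len D s i < j" "(s, i, j) \<notin> D \<longleftrightarrow> col_len D s j < i"
    "1 < i \<longrightarrow> ((s, i - 1, j) \<in> D \<longleftrightarrow> i - 1 \<le> col_len D s j)"
    "1 < j \<longrightarrow> ((s, i, j - 1) \<in> D \<longleftrightarrow> j - 1 \<le> row_len D s i)" if "1 \<le> i" "1 \<le> j"
    using that mem_diagram_row[OF assms, of s i j] mem_diagram_col[OF assms, of s i j]
      mem_diagram_col[OF assms, of s "i - 1" j] mem_diagram_row[OF assms, of s i "j - 1"] by auto
  show ?thesis
  proof
    assume "(s, i, j) \<in> addable l D"
    then have *: "s < l" "1 \<le> i" "1 \<le> j" "(s, i, j) \<notin> D"
      "1 < i \<longrightarrow> (s, i - 1, j) \<in> D" "1 < j \<longrightarrow> (s, i, j - 1) \<in> D"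
      unfolding addable_iff[OF assms] by auto
    show "s < l \<and> 1 \<le> i \<and> 1 \<le> j \<and> col_len D s j + 1 = i \<and> row_len D s i + 1 = j"
    proof -
      have "row_len D s i < j" "col_len D s j < i" using a(1,2)[OF *(2,3)] *(4) by blast+
      moreover have "i - 1 \<le> col_len D s j" using a(3)[OF *(2,3)] *(5) by (cases "1 < i") auto
      moreover have "j - 1 \<le> row_len D s i" using a(4)[OF *(2,3)] *(6) by (cases "1 < j") auto
      ultimately show ?thesis using *(1-3) by auto
    qed
  next
    assume *: "s < l \<and> 1 \<le> i \<and> 1 \<le> j \<and> col_len D s j + 1 = i \<and> row_len D s i + 1 = j"
    then have ge: "1 \<le> i" "1 \<le> j" and "col_len D s j < i" "i - 1 \<le> col_len D s j" "j - 1 \<le> row_len D s i"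
      by linarith+
    then have "(s, i, j) \<notin> D" "1 < i \<longrightarrow> (s, i - 1, j) \<in> D" "1 < j \<longrightarrow> (s, i, j - 1) \<in> D"
      using a(2,3,4)[OF ge] by blast+
    then show "(s, i, j) \<in> addable l D"
      unfolding addable_iff[OF assms] using * by blast
  qed
qed

lemma removable_iff_len:
  assumes "diagram l D"
  shows "(s, i, j) \<in> removable l D \<longleftrightarrow> 1 \<le> i \<and> 1 \<le> j \<and> col_len D s j = i \<and> row_len D s i = j"
proof -
  have 1: "(s, i, j) \<in> removable l D \<longleftrightarrow> (s, i, j) \<in> D \<and> (s, i + 1, j) \<notin> D \<and> (s, i, j + 1) \<notin> D"
  proof -
    have "(s, i, j) \<in> removable l D"
      if *: "(s, i, j) \<in> D" "(s, i + 1, j) \<notin> D" "(s, i, j + 1) \<notin> D"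
    proof -
      have "diagram l (D - {(s, i, j)})"
        unfolding diagram_def
      proof (intro conjI ballI, goal_cases)
        case 1 then show ?case using assms diagram_finite by auto
      next
        case (2 N)
        obtain s' i' j' where N: "N = (s', i', j')" by (cases N)
        have "N \<in> D" using 2 by auto
        note m = diagram_memD[OF assms, of s' i' j', folded N, OF this]
        have "1 < i' \<longrightarrow> (s', i' - 1, j') \<noteq> (s, i, j)"
          using *(2) \<open>N \<in> D\<close> N by auto
        moreover have "1 < j' \<longrightarrow> (s', i', j' - 1) \<noteq> (s, i, j)"
          using *(3) \<open>N \<in> D\<close> N by auto
        ultimately show ?case using m N by auto
      qed
      then show ?thesis using * by (simp add: removable_def)
    qed
    moreover have "(s, i + 1, j) \<notin> D" "(s, i, j + 1) \<notin> D" "(s, i, j) \<in> D" if *: "(s, i, j) \<in> removable l D"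
    proof -
      have d: "diagram l (D - {(s, i, j)})" and m: "(s, i, j) \<in> D"
        using * by (auto simp: removable_def)
      show "(s, i, j) \<in> D" by fact
      have "1 \<le> i" "1 \<le> j" using diagram_memD[OF assms m] by auto
      then show "(s, i + 1, j) \<notin> D" "(s, i, j + 1) \<notin> D"
        using diagram_memD(4)[OF d, of s "i+1" j] diagram_memD(5)[OF d, of s i "j+1"] by auto
    qed
    ultimately show ?thesis by blast
  qed
  show ?thesis
    unfolding 1 using mem_diagram_row[OF assms, of s i j] mem_diagram_col[OF assms, of s i j]
      mem_diagram_col[OF assms, of s "i+1" j] mem_diagram_row[OF assms, of s i "j+1"]
    by (auto intro!: antisym)
qed

text \<open>An addable node is the corner (s, 1, 1) of a component or a neighbour of some node of D,
  so finitely many candidates cover all of them.\<close>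

lemma addable_finite:
  assumes "diagram l D"
  shows "finite (addable l D)"
proof (rule finite_subset)
  show "addable l D \<subseteq> (\<lambda>(s,k). (s, 1, k)) ` ({..<l} \<times> {1})
      \<union> (\<Union>(s,i,j)\<in>D. {(s, i, j+1), (s, i+1, 1), (s, i + 1, j)}) \<union> {}"
  proof
    fix A assume A: "A \<in> addable l D"
    obtain s i j where s: "A = (s, i, j)" by (cases A)
    have a: "s < l" "1 \<le> i" "1 \<le> j" "1 < i \<longrightarrow> (s, i - 1, j) \<in> D" "1 < j \<longrightarrow> (s, i, j - 1) \<in> D"
      using A addable_iff[OF assms] unfolding s by auto
    consider "i = 1" "j = 1" | "1 < i" | "1 < j" using a(2,3) by linarith
    then show "A \<in> (\<lambda>(s,k). (s, 1, k)) ` ({..<l} \<times> {1})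
      \<union> (\<Union>(s,i,j)\<in>D. {(s, i, j+1), (s, i+1, 1), (s, i + 1, j)}) \<union> {}"
    proof cases
      case 1 then show ?thesis using a s by auto
    next
      case 2 then show ?thesis using a s by (auto intro!: bexI[of _ "(s, i - 1, j)"])
    next
      case 3 then show ?thesis using a s by (auto intro!: bexI[of _ "(s, i, j - 1)"])
    qed
  qed
qed (use diagram_finite[OF assms] in auto)

lemma removable_finite: "diagram l D \<Longrightarrow> finite (removable l D)"
  by (simp add: removable_def diagram_finite)

text \<open>The exponent of x in the residue of a node; constant along the diagonals of a component,
  and known there as the content.\<close>

definition node_diff :: "nat \<times> nat \<times> nat \<Rightarrow> int" where
  "node_diff N = int (snd (snd N)) - int (fst (snd N))"

lemma node_diff_simp [simp]: "node_diff (s, i, j) = int j - int i"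
  by (simp add: node_diff_def)

text \<open>The lower of two addable nodes on one diagonal needs the node above it in D. That node
  lies weakly south-east of the upper one, which would then be in D already.\<close>

lemma addable_inj:
  assumes "diagram l D" "A \<in> addable l D" "B \<in> addable l D" "fst A = fst B" "node_diff A = node_diff B"
  shows "A = B"
proof -
  obtain s i j i' j' where A: "A = (s, i, j)" "B = (s, i', j')"
    using assms(4) by (metis prod.collapse)
  have "\<not> i < i'" if "(s, i, j) \<in> addable l D" "(s, i', j') \<in> addable l D" "int j - int i = int j' - int i'"
    for i j i' j'
  proof
    assume "i < i'"
    then have "(s, i' - 1, j') \<in> D" "1 \<le> i" "1 \<le> j" "(s, i, j) \<notin> D" "j \<le> j'" "i \<le> i' - 1"
      using that unfolding addable_iff[OF assms(1)] by auto
    then show False using diagram_down_closed[OF assms(1)] by blast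
  qed
  from this[of i j i' j'] this[of i' j' i j] show ?thesis
    using assms A by auto
qed

text \<open>On the diagonal of a removable node B, a place weakly north-west of B is in D; at a
  place strictly south-east of B, addability would force the node below B into D. This keeps the
  denominators c_A - c_B nonzero.\<close>

lemma addable_removable_diff:
  assumes "diagram l D" "A \<in> addable l D" "B \<in> removable l D" "fst A = fst B"
  shows "node_diff A \<noteq> node_diff B"
proof
  obtain s i j i' j' where A: "A = (s, i, j)" "B = (s, i', j')"
    using assms(4) by (metis prod.collapse)
  assume eq: "node_diff A = node_diff B"
  have a: "1 \<le> i" "1 \<le> j" "(s, i, j) \<notin> D" 
    using assms(2) addable_iff[OF assms(1)] unfolding A by auto
  have b: "1 \<le> i'" "1 \<le> j'" "col_len D s j' = i'" "row_len D s i' = j'"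
    using assms(3) removable_iff_len[OF assms(1)] unfolding A by auto
  have bD: "(s, i', j') \<in> D" using assms(3) by (auto simp: removable_def A)
  show False
  proof (cases "i \<le> i'")
    case True
    then have "j \<le> j'" using eq A by auto
    then show False using True a bD diagram_down_closed[OF assms(1) bD, of i j] by auto
  next
    case False
    then have "i' + 1 \<le> i" "j' + 1 \<le> j" using eq A by auto
    then have "(s, i, j - 1) \<in> D" using assms(2) b unfolding A addable_iff[OF assms(1)] by auto
    then have "(s, i' + 1, j') \<in> D"
      using diagram_down_closed[OF assms(1), of s i "j - 1" "i' + 1" j'] \<open>i' + 1 \<le> i\<close> \<open>j' + 1 \<le> j\<close> b by auto
    then show False using b mem_diagram_col[OF assms(1), of s "i' + 1" j'] by auto
  qed
qed

text \<open>If b does not drop from k to k + 1, the factor at k + 1 of the first product equals the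
  factor at k of the last one, both being \<open>f (int k - int (b k))\<close>. Only the drops of b
  survive, and each one is an addable position together with a removable one.\<close>

lemma boundary_telescope:
  fixes f :: "int \<Rightarrow> 'b::comm_ring_1" and b :: "nat \<Rightarrow> nat"
  assumes "\<And>k. 1 \<le> k \<Longrightarrow> b (Suc k) \<le> b k"
  shows "(\<Prod>k=1..m. f (int k - 1 - int (b k))) *
      (\<Prod>k\<in>{k\<in>{1..<m}. b (Suc k) < b k}. f (int k - int (b k))) =
    (\<Prod>k\<in>{k\<in>{1..m}. k = 1 \<or> b k < b (k - 1)}. f (int k - 1 - int (b k))) *
      (\<Prod>k=1..<m. f (int k - int (b k)))"
proof (induction m)
  case (Suc m)
  show ?case
  proof (cases "m = 0")
    case True
    have "{k. k = Suc 0 \<and> (k = 1 \<or> b k < b (k - 1))} = {1}" by auto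
    then show ?thesis using True by simp
  next
    case False
    have A: "{k\<in>{1..<Suc m}. b (Suc k) < b k} =
        (if b (Suc m) < b m then insert m {k\<in>{1..<m}. b (Suc k) < b k} else {k\<in>{1..<m}. b (Suc k) < b k})"
      using False by (auto simp: less_Suc_eq)
    have B: "{k\<in>{1..Suc m}. k = 1 \<or> b k < b (k - 1)} =
        (if b (Suc m) < b m then insert (Suc m) {k\<in>{1..m}. k = 1 \<or> b k < b (k - 1)}
         else {k\<in>{1..m}. k = 1 \<or> b k < b (k - 1)})"
      using False by (auto simp: le_Suc_eq)
    have C: "(\<Prod>k=1..<Suc m. f (int k - int (b k))) = f (int m - int (b m)) * (\<Prod>k=1..<m. f (int k - int (b k)))"
      using False by (simp add: prod.atLeastLessThan_Suc mult.commute)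
    show ?thesis
    proof (cases "b (Suc m) < b m")
      case True
      then show ?thesis unfolding A B C using Suc.IH by (simp add: mult_ac)
    next
      case f: False
      then have "b (Suc m) = b m" using assms[of m] False by auto
      then show ?thesis unfolding A B C using Suc.IH f by (simp add: mult_ac)
    qed
  qed
qed simp

text \<open>The addable nodes in columns \<open>\<le> j\<close> are read off the columns, the others off the rows
  \<open>\<le> col_len D t j\<close>.\<close>

lemma component_boundary:
  fixes f :: "int \<Rightarrow> 'b::field"
  assumes D: "diagram l D" and t: "t < l" and j: "1 \<le> j" and nz: "\<And>e. f e \<noteq> 0"
  shows "(\<Prod>A\<in>{A\<in>addable l D. fst A = t}. f (node_diff A)) /
      (\<Prod>B\<in>{B\<in>removable l D. fst B = t}. f (node_diff B)) =
    (\<Prod>k=1..j. f (int k - 1 - int (col_len D t k))) / (\<Prod>k=1..<j. f (int k - int (col_len D t k))) *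
    (\<Prod>a=1..col_len D t j. f (int (row_len D t a) - int a + 1) / f (int (row_len D t a) - int a))"
proof -
  define c p where "c = col_len D t" and "p = row_len D t"
  define m where "m = c j"
  have rc: "i \<le> c k \<longleftrightarrow> k \<le> p i" if "1 \<le> i" "1 \<le> k" for i k
    using row_col_iff[OF D that] by (simp add: c_def p_def)
  have cm: "c k' \<le> c k" if "1 \<le> k" "k \<le> k'" for k k'
    using col_len_antimono[OF D that] by (simp add: c_def)
  have pm: "p k' \<le> p k" if "1 \<le> k" "k \<le> k'" for k k'
    using row_len_antimono[OF D that] by (simp add: p_def)
  have add: "(t, i, k) \<in> addable l D \<longleftrightarrow> 1 \<le> i \<and> 1 \<le> k \<and> c k + 1 = i \<and> p i + 1 = k" for i k
    using addable_iff_len[OF D] t by (simp add: c_def p_def)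
  have rem: "(t, i, k) \<in> removable l D \<longleftrightarrow> 1 \<le> i \<and> 1 \<le> k \<and> c k = i \<and> p i = k" for i k
    using removable_iff_len[OF D] by (simp add: c_def p_def)
  define A1 A2 R1 R2 where "A1 = {k\<in>{1..j}. k = 1 \<or> c k < c (k - 1)}"
    and "A2 = {a\<in>{1..m}. a = 1 \<or> p a < p (a - 1)}"
    and "R1 = {k\<in>{1..<j}. c (Suc k) < c k}" and "R2 = {a\<in>{1..m}. p (Suc a) < p a}"
  have pc: "p (c k + 1) = k - 1" if "1 \<le> k" "k = 1 \<or> c k < c (k - 1)" for k
  proof -
    have "\<not> k \<le> p (c k + 1)" using rc[of "c k + 1" k] that by auto
    moreover have "k = 1 \<or> k - 1 \<le> p (c k + 1)" using rc[of "c k + 1" "k - 1"] that by auto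
    ultimately show ?thesis by auto
  qed
  have cp: "c (p k + 1) = k - 1" if "1 \<le> k" "k = 1 \<or> p k < p (k - 1)" for k
  proof -
    have "\<not> k \<le> c (p k + 1)" using rc[of k "p k + 1"] that by auto
    moreover have "k = 1 \<or> k - 1 \<le> c (p k + 1)" using rc[of "k - 1" "p k + 1"] that by auto
    ultimately show ?thesis by auto
  qed
  have add_set: "{A\<in>addable l D. fst A = t} = (\<lambda>k. (t, c k + 1, k)) ` A1 \<union> (\<lambda>a. (t, a, p a + 1)) ` A2"
    (is "?L = ?R")
  proof
    show "?L \<subseteq> ?R"
    proof
      fix A assume "A \<in> ?L"
      then obtain i k where A: "A = (t, i, k)" "1 \<le> i" "1 \<le> k" "c k + 1 = i" "p i + 1 = k"
        using add by (cases A) auto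
      have 1: "k = 1 \<or> c k < c (k - 1)"
      proof (cases "k = 1")
        case False
        then have "1 \<le> k - 1" "k - 1 \<le> p i" using A(3,5) by linarith+
        then have "i \<le> c (k - 1)" using rc[OF A(2)] by blast
        then show ?thesis using A(4) by linarith
      qed simp
      have 2: "i = 1 \<or> p i < p (i - 1)"
      proof (cases "i = 1")
        case False
        then have "1 \<le> i - 1" "i - 1 \<le> c k" using A(2,4) by linarith+
        then have "k \<le> p (i - 1)" using rc[OF _ A(3)] by blast
        then show ?thesis using A(5) by linarith
      qed simp
      show "A \<in> ?R"
      proof (cases "k \<le> j")
        case True
        then have "k \<in> A1" using 1 A(3) by (simp add: A1_def)
        then have "(t, c k + 1, k) \<in> ?R" by blast
        then show ?thesis unfolding A(1,4) .
      next
        case False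
        then have "i \<le> m" using rc[of i j] j A(2-5) unfolding m_def by linarith
        then have "i \<in> A2" using 2 A(2) by (simp add: A2_def)
        then have "(t, i, p i + 1) \<in> ?R" by blast
        then show ?thesis unfolding A(1,5) .
      qed
    qed
    show "?R \<subseteq> ?L" using pc cp by (auto simp: add A1_def A2_def)
  qed
  have add_disj: "(\<lambda>k. (t, c k + 1, k)) ` A1 \<inter> (\<lambda>a. (t, a, p a + 1)) ` A2 = {}"
  proof -
    have "j \<le> p a" if "a \<in> A2" for a using rc[of a j] that j by (auto simp: A2_def m_def)
    then have "k \<noteq> p a + 1" if "k \<in> A1" "a \<in> A2" for k a using that by (fastforce simp: A1_def)
    then show ?thesis by auto
  qed
  have rem_set: "{A\<in>removable l D. fst A = t} = (\<lambda>k. (t, c k, k)) ` R1 \<union> (\<lambda>a. (t, a, p a)) ` R2"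
    (is "?L = ?R")
  proof
    show "?L \<subseteq> ?R"
    proof
      fix A assume "A \<in> ?L"
      then obtain i k where A: "A = (t, i, k)" "1 \<le> i" "1 \<le> k" "c k = i" "p i = k"
        using rem by (cases A) auto
      have 1: "c (Suc k) < c k" using rc[of i "Suc k"] A(2-5) by linarith
      have 2: "p (Suc i) < p i" using rc[of "Suc i" k] A(2-5) by linarith
      show "A \<in> ?R"
      proof (cases "k < j")
        case True
        then have "k \<in> R1" using 1 A(3) by (simp add: R1_def)
        then have "(t, c k, k) \<in> ?R" by blast
        then show ?thesis unfolding A(1,4) .
      next
        case False
        then have "i \<le> m" using rc[of i j] j A(2-5) unfolding m_def by linarith
        then have "i \<in> R2" using 2 A(2) by (simp add: R2_def)
        then have "(t, i, p i) \<in> ?R" by blast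
        then show ?thesis unfolding A(1,5) .
      qed
    qed
    have a: "p (c k) = k" if "1 \<le> k" "c (Suc k) < c k" for k
    proof -
      have "k \<le> p (c k)" "\<not> Suc k \<le> p (c k)" using rc[of "c k" k] rc[of "c k" "Suc k"] that by auto
      then show ?thesis by simp
    qed
    have b: "c (p k) = k" if "1 \<le> k" "p (Suc k) < p k" for k
    proof -
      have "k \<le> c (p k)" "\<not> Suc k \<le> c (p k)" using rc[of k "p k"] rc[of "Suc k" "p k"] that by auto
      then show ?thesis by simp
    qed
    show "?R \<subseteq> ?L" using a b by (auto simp: rem R1_def R2_def)
  qed
  have rem_disj: "(\<lambda>k. (t, c k, k)) ` R1 \<inter> (\<lambda>a. (t, a, p a)) ` R2 = {}"
  proof -
    have "j \<le> p a" if "a \<in> R2" for a using rc[of a j] that j by (auto simp: R2_def m_def)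
    then have "k \<noteq> p a" if "k \<in> R1" "a \<in> R2" for k a using that by (fastforce simp: R1_def)
    then show ?thesis by auto
  qed
  have fin: "finite A1" "finite A2" "finite R1" "finite R2"
    by (simp_all add: A1_def A2_def R1_def R2_def)
  have padd: "(\<Prod>A\<in>{A\<in>addable l D. fst A = t}. f (node_diff A)) =
     (\<Prod>k\<in>A1. f (int k - 1 - int (c k))) * (\<Prod>a\<in>A2. f (int (p a) - int a + 1))"
    unfolding add_set
    by (subst prod.union_disjoint[OF _ _ add_disj])
      (use fin in \<open>auto simp: prod.reindex inj_on_def algebra_simps\<close>)
  have prem: "(\<Prod>A\<in>{A\<in>removable l D. fst A = t}. f (node_diff A)) =
     (\<Prod>k\<in>R1. f (int k - int (c k))) * (\<Prod>a\<in>R2. f (int (p a) - int a))"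
    unfolding rem_set
    by (subst prod.union_disjoint[OF _ _ rem_disj])
      (use fin in \<open>auto simp: prod.reindex inj_on_def algebra_simps\<close>)
  have T1: "(\<Prod>k=1..j. f (int k - 1 - int (c k))) * (\<Prod>k\<in>R1. f (int k - int (c k))) =
      (\<Prod>k\<in>A1. f (int k - 1 - int (c k))) * (\<Prod>k=1..<j. f (int k - int (c k)))"
    unfolding A1_def R1_def by (rule boundary_telescope) (simp add: cm)
  \<comment> \<open>The same telescoping along the rows; since column minus row changes sign when
    rows and columns are interchanged, it is applied to \<open>f (- e)\<close>.\<close>
  have T2: "(\<Prod>a=1..m. f (int (p a) - int a + 1)) * (\<Prod>a\<in>{a\<in>{1..<m}. p (Suc a) < p a}. f (int (p a) - int a)) =
      (\<Prod>a\<in>A2. f (int (p a) - int a + 1)) * (\<Prod>a=1..<m. f (int (p a) - int a))"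
    using boundary_telescope[of p "\<lambda>e. f (- e)" m] pm unfolding A2_def by (simp add: algebra_simps)
  \<comment> \<open>At the cut, row m reaches column j and row m + 1 does not. So m is a drop of the
    rows that the telescoping over the first m rows does not see.\<close>
  have T3: "(\<Prod>a\<in>R2. f (int (p a) - int a)) * (\<Prod>a=1..<m. f (int (p a) - int a)) =
     (\<Prod>a\<in>{a\<in>{1..<m}. p (Suc a) < p a}. f (int (p a) - int a)) * (\<Prod>a=1..m. f (int (p a) - int a))"
  proof (cases "m = 0")
    case True then show ?thesis by (simp add: R2_def)
  next
    case False
    have "j \<le> p m" "\<not> j \<le> p (Suc m)" using rc[of m j] rc[of "Suc m" j] False j by (auto simp: m_def)
    then have "R2 = insert m {a\<in>{1..<m}. p (Suc a) < p a}" using False by (auto simp: R2_def)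
    moreover have "{1..m} = insert m {1..<m}" using False by auto
    ultimately show ?thesis by (simp add: mult_ac)
  qed
  have nzp: "(\<Prod>k\<in>U. f (g k)) \<noteq> 0" if "finite U" for U and g :: "nat \<Rightarrow> int"
    using that nz by (simp add: prod_zero_iff)
  show ?thesis
    unfolding padd prem c_def[symmetric] p_def[symmetric] m_def[symmetric] prod_dividef
  proof -
    let ?A1 = "\<Prod>k\<in>A1. f (int k - 1 - int (c k))" and ?A2 = "\<Prod>a\<in>A2. f (int (p a) - int a + 1)"
    let ?R1 = "\<Prod>k\<in>R1. f (int k - int (c k))" and ?R2 = "\<Prod>a\<in>R2. f (int (p a) - int a)"
    let ?r = "\<Prod>a\<in>{a\<in>{1..<m}. p (Suc a) < p a}. f (int (p a) - int a)"
    let ?C = "\<Prod>k=1..j. f (int k - 1 - int (c k))" and ?C' = "\<Prod>k=1..<j. f (int k - int (c k))"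
    let ?P = "\<Prod>a=1..m. f (int (p a) - int a + 1)" and ?P' = "\<Prod>a=1..m. f (int (p a) - int a)"
      and ?q = "\<Prod>a=1..<m. f (int (p a) - int a)"
    have n: "?R1 \<noteq> 0" "?R2 \<noteq> 0" "?C' \<noteq> 0" "?P' \<noteq> 0" "?r \<noteq> 0" "?q \<noteq> 0" using nzp fin by auto
    have e1: "?A1 / ?R1 = ?C / ?C'" using T1 n by (simp add: field_simps)
    have e2: "?A2 / ?R2 = ?P / ?P'"
    proof -
      have "?A2 = ?P * ?r / ?q" "?R2 = ?r * ?P' / ?q"
        using T2 T3 n(6) by (simp_all only: nonzero_eq_divide_eq[OF n(6)])
      then show ?thesis using n(5,6) by simp
    qed
    show "?A1 * ?A2 / (?R1 * ?R2) = ?C / ?C' * (?P / ?P')" unfolding times_divide_times_eq[symmetric] e1 e2 ..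
  qed
qed

text \<open>The sum is the coefficient of degree \<open>card S - 1\<close> in the Lagrange
  interpolant of p at the points \<open>c a\<close>. The interpolant is p itself, whose degree is
  smaller.\<close>

lemma lagrange_sum_zero:
  fixes c :: "'i \<Rightarrow> 'a::field"
  assumes fin: "finite S" and inj: "inj_on c S" and deg: "degree p + 1 < card S"
  shows "(\<Sum>a\<in>S. poly p (c a) / (\<Prod>b\<in>S - {a}. c a - c b)) = 0"
proof -
  define d where "d a = (\<Prod>b\<in>S - {a}. c a - c b)" for a
  define B where "B a = (\<Prod>b\<in>S - {a}. [:- c b, 1:])" for a
  define q where "q = (\<Sum>a\<in>S. Polynomial.smult (poly p (c a) / d a) (B a))"
  have dB: "degree (B a) = card S - 1" if "a \<in> S" for a
  proof -
    have "degree (B a) = (\<Sum>b\<in>S - {a}. degree [:- c b, 1:])"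
      unfolding B_def by (rule degree_prod_eq_sum_degree) simp
    then show ?thesis using that fin by simp
  qed
  have lB: "coeff (B a) (card S - 1) = 1" if "a \<in> S" for a
  proof -
    have "lead_coeff (B a) = 1" unfolding B_def by (simp add: lead_coeff_prod)
    then show ?thesis using dB[OF that] by simp
  qed
  have dnz: "d a \<noteq> 0" if "a \<in> S" for a
    using that fin inj by (auto simp: d_def prod_zero_iff dest: inj_onD)
  have pB: "poly (B a) (c e) = (if a = e then d a else 0)" if "a \<in> S" "e \<in> S" for a e
  proof (cases "a = e")
    case True then show ?thesis by (simp add: B_def d_def poly_prod)
  next
    case False
    then have "\<exists>b\<in>S - {a}. poly [:- c b, 1:] (c e) = 0" using that by (intro bexI[of _ e]) auto
    then show ?thesis using False fin by (simp add: B_def poly_prod prod_zero_iff)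
  qed
  have "q = p"
  proof (rule poly_eqI_degree[of "c ` S"])
    fix y assume "y \<in> c ` S"
    then obtain e where e: "e \<in> S" "y = c e" by auto
    have "poly q y = (\<Sum>a\<in>S. poly p (c a) / d a * (if a = e then d a else 0))"
      unfolding q_def poly_sum e(2) using e by (intro sum.cong) (simp_all add: pB)
    also have "\<dots> = (\<Sum>a\<in>S. if a = e then poly p (c a) else 0)"
      using dnz by (intro sum.cong) auto
    also have "\<dots> = poly p y" using e fin by simp
    finally show "poly q y = poly p y" .
  next
    have card: "card (c ` S) = card S" using inj by (rule card_image)
    show "degree p < card (c ` S)" using deg card by simp
    have "degree q \<le> card S - 1"
      unfolding q_def by (rule degree_sum_le) (use fin dB degree_smult_le le_trans in metis)+
    then show "degree q < card (c ` S)" using card deg by simp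
  qed
  then have "coeff q (card S - 1) = 0" using deg by (simp add: coeff_eq_0)
  moreover have "coeff q (card S - 1) = (\<Sum>a\<in>S. poly p (c a) / d a)"
    unfolding q_def coeff_sum using lB by (intro sum.cong) (simp_all del: One_nat_def)
  ultimately show ?thesis by (simp add: d_def)
qed

text \<open>With the constant function 2 and the cut j = 1 the boundary product of a component
  becomes a power of 2 whose exponent is the number of addable minus the number of removable nodes,
  and its value is 2.\<close>

lemma card_addable:
  assumes D: "diagram l D"
  shows "card (addable l D) = card (removable l D) + l"
proof -
  have comp: "card {A\<in>addable l D. fst A = t} = card {B\<in>removable l D. fst B = t} + 1" if "t < l" for t
  proof -
    have "(2::rat) ^ card {A\<in>addable l D. fst A = t} / 2 ^ card {B\<in>removable l D. fst B = t} = 2"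
      using component_boundary[OF D that, of 1 "\<lambda>_. 2 :: rat"] by simp
    then have "(2::rat) ^ card {A\<in>addable l D. fst A = t} = 2 ^ (card {B\<in>removable l D. fst B = t} + 1)"
      by (simp add: field_simps)
    then show ?thesis by (rule power_inject_exp[THEN iffD1, rotated]) simp
  qed
  have fa: "finite (addable l D)" and fr: "finite (removable l D)"
    using D addable_finite removable_finite by auto
  have "card (addable l D) = (\<Sum>t<l. card {A\<in>addable l D. fst A = t})"
  proof -
    have "addable l D = (\<Union>t<l. {A\<in>addable l D. fst A = t})"
      using addable_iff[OF D] by fastforce
    then show ?thesis using fa by (subst card_UN_disjoint[symmetric]) auto
  qed
  moreover have "card (removable l D) = (\<Sum>t<l. card {A\<in>removable l D. fst A = t})"
  proof -
    have "removable l D = (\<Union>t<l. {A\<in>removable l D. fst A = t})"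
      using diagram_memD(1)[OF D] by (fastforce simp: removable_def)
    then show ?thesis using fr by (subst card_UN_disjoint[symmetric]) auto
  qed
  ultimately show ?thesis using comp by (simp add: sum_Suc)
qed

section \<open>The hook formula\<close>

text \<open>The statistic n of the merged partition, read off its columns: column j of the merged
  partition has as its length the sum of the lengths of the columns j of all components. In this
  form adding a node changes a single summand.\<close>

definition col_stat :: "nat \<Rightarrow> (nat \<times> nat \<times> nat) set \<Rightarrow> nat" where
  "col_stat l D = (\<Sum>j\<in>(\<lambda>N. snd (snd N)) ` D. (\<Sum>s<l. col_len D s j) choose 2)"

lemma row_len_insert:
  assumes "finite D" "(s0, i0, j0) \<notin> D"
  shows "row_len (insert (s0, i0, j0) D) s i = row_len D s i + (if s = s0 \<and> i = i0 then 1 else 0)"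
proof (cases "s = s0 \<and> i = i0")
  case True
  have "{j. (s, i, j) \<in> insert (s0, i0, j0) D} = insert j0 {j. (s, i, j) \<in> D}" using True by auto
  moreover have "finite {j. (s, i, j) \<in> D}"
    by (rule finite_subset[of _ "(\<lambda>N. snd (snd N)) ` D"]) (use assms in force)+
  ultimately show ?thesis using True assms by (simp add: row_len_def)
next
  case False
  then have "{j. (s, i, j) \<in> insert (s0, i0, j0) D} = {j. (s, i, j) \<in> D}" by auto
  then show ?thesis using False by (auto simp: row_len_def)
qed

lemma col_len_insert:
  assumes "finite D" "(s0, i0, j0) \<notin> D"
  shows "col_len (insert (s0, i0, j0) D) s j = col_len D s j + (if s = s0 \<and> j = j0 then 1 else 0)"
proof (cases "s = s0 \<and> j = j0")
  case True
  have "{i. (s, i, j) \<in> insert (s0, i0, j0) D} = insert i0 {i. (s, i, j) \<in> D}" using True by auto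
  moreover have "finite {i. (s, i, j) \<in> D}"
    by (rule finite_subset[of _ "(\<lambda>N. fst (snd N)) ` D"]) (use assms in force)+
  ultimately show ?thesis using True assms by (simp add: col_len_def)
next
  case False
  then have "{i. (s, i, j) \<in> insert (s0, i0, j0) D} = {i. (s, i, j) \<in> D}" by auto
  then show ?thesis using False by (auto simp: col_len_def)
qed

text \<open>Pascal's rule in the one column that grows: (c + 1 choose 2) = (c choose 2) + c.\<close>

lemma col_stat_insert:
  assumes D: "diagram l D" and A: "(s0, i0, j0) \<in> addable l D"
  shows "col_stat l (insert (s0, i0, j0) D) = col_stat l D + (\<Sum>t<l. col_len D t j0)"
proof -
  have fin: "finite D" and nin: "(s0, i0, j0) \<notin> D" and s0: "s0 < l"
    using D A diagram_finite addable_iff[OF D] by auto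
  define J where "J = insert j0 ((\<lambda>N. snd (snd N)) ` D)"
  have finJ: "finite J" using fin by (simp add: J_def)
  have "col_stat l D = (\<Sum>j\<in>J. (\<Sum>s<l. col_len D s j) choose 2)"
    unfolding col_stat_def
  proof (rule sum.mono_neutral_left[OF finJ])
    show "\<forall>j\<in>J - (\<lambda>N. snd (snd N)) ` D. (\<Sum>s<l. col_len D s j) choose 2 = 0"
    proof
      fix j assume "j \<in> J - (\<lambda>N. snd (snd N)) ` D"
      then have "{i. (s, i, j) \<in> D} = {}" for s by force
      then show "(\<Sum>s<l. col_len D s j) choose 2 = 0" by (simp add: col_len_def)
    qed
  qed (auto simp: J_def)
  moreover have "col_stat l (insert (s0, i0, j0) D) =
      (\<Sum>j\<in>J. ((\<Sum>s<l. col_len D s j) choose 2) + (if j = j0 then \<Sum>s<l. col_len D s j else 0))"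
  proof -
    have "col_stat l (insert (s0, i0, j0) D) =
        (\<Sum>j\<in>J. (\<Sum>s<l. col_len (insert (s0, i0, j0) D) s j) choose 2)"
      by (simp add: col_stat_def J_def)
    also have "\<dots> = (\<Sum>j\<in>J. ((\<Sum>s<l. col_len D s j) choose 2) + (if j = j0 then \<Sum>s<l. col_len D s j else 0))"
    proof (rule sum.cong[OF refl])
      fix j
      have "(\<Sum>s<l. col_len (insert (s0, i0, j0) D) s j) = (\<Sum>s<l. col_len D s j) + (if j = j0 then 1 else 0)"
        using s0 by (simp add: col_len_insert[OF fin nin] sum.distrib)
      then show "(\<Sum>s<l. col_len (insert (s0, i0, j0) D) s j) choose 2 =
        ((\<Sum>s<l. col_len D s j) choose 2) + (if j = j0 then \<Sum>s<l. col_len D s j else 0)"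
        by (auto simp: numeral_2_eq_2)
    qed
    finally show ?thesis .
  qed
  ultimately show ?thesis
    using finJ by (simp add: sum.distrib J_def)
qed

text \<open>For s = t the assumption \<open>generic\<close> says that x is not a root of unity,
  otherwise that the parameters lie in different orbits under multiplication by powers of x. It does
  not mention n, so diagrams of all sizes can be treated together.\<close>

locale ak_generic =
  fixes l :: nat and x :: "'a::field" and Q :: "nat \<Rightarrow> 'a"
  assumes l_pos: "1 \<le> l" and x_nz: "x \<noteq> 0" and Q_nz: "s < l \<Longrightarrow> Q s \<noteq> 0"
    and generic: "s < l \<Longrightarrow> t < l \<Longrightarrow> x powi k * Q s = Q t \<Longrightarrow> s = t \<and> k = 0"
begin

definition res :: "nat \<times> nat \<times> nat \<Rightarrow> 'a" where
  "res N = x powi (node_diff N) * Q (fst N)"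

definition hook_factor :: "(nat \<times> nat \<times> nat) set \<Rightarrow> nat \<times> nat \<times> nat \<Rightarrow> nat \<Rightarrow> 'a" where
  "hook_factor D = (\<lambda>(s, i, j) t.
     x powi (int (row_len D s i) - int i + int (col_len D t j) - int j + 1) * Q s / Q t - 1)"

text \<open>The factors with t equal to the component of N are x^h - 1 for the ordinary hook lengths
  h, and division by one x - 1 per node turns them into quantum integers. The sign and the power of
  x are the normalisation for which adding a node has the ratio
  \<open>schur_insert_ratio\<close>.\<close>

definition schur :: "(nat \<times> nat \<times> nat) set \<Rightarrow> 'a" where
  "schur D = (- 1) ^ ((l - 1) * card D) * x powi (- int (col_stat l D)) / (x - 1) ^ card D *
     (\<Prod>N\<in>D. \<Prod>t<l. hook_factor D N t)"

lemma x_powi_eq_1: "x powi k = 1 \<Longrightarrow> k = 0"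
  using generic[of 0 0 k] l_pos by simp

lemma x_not_1: "x \<noteq> 1"
  using x_powi_eq_1[of 1] by auto

lemma powi_nz [simp]: "x powi k \<noteq> 0"
  using x_nz by simp

lemma res_nz: "fst N < l \<Longrightarrow> res N \<noteq> 0"
  using Q_nz x_nz by (simp add: res_def)

lemma res_eq_iff:
  assumes "fst N < l" "fst M < l"
  shows "res N = res M \<longleftrightarrow> fst N = fst M \<and> node_diff N = node_diff M"
proof
  assume "res N = res M"
  then have "x powi (node_diff N - node_diff M) * Q (fst N) = Q (fst M)"
    using x_nz by (simp add: res_def power_int_diff field_simps)
  from generic[OF assms this] show "fst N = fst M \<and> node_diff N = node_diff M" by simp
qed (simp add: res_def)

lemma hook_factor_nz:
  assumes D: "diagram l D" and N: "N \<in> D" and t: "t < l"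
  shows "hook_factor D N t \<noteq> 0"
proof
  obtain s i j where s: "N = (s, i, j)" by (cases N)
  let ?h = "int (row_len D s i) - int i + int (col_len D t j) - int j + 1"
  have sl: "s < l" using diagram_memD[OF D] N s by auto
  assume "hook_factor D N t = 0"
  then have "x powi ?h * Q s = Q t" using Q_nz[OF t] by (simp add: hook_factor_def s field_simps)
  then have "s = t" "?h = 0" using generic[OF sl t] by auto
  moreover have "j \<le> row_len D s i" "i \<le> col_len D s j"
    using N s mem_diagram_row[OF D, of s i j] mem_diagram_col[OF D, of s i j] by auto
  ultimately show False by auto
qed

lemma schur_nz: "diagram l D \<Longrightarrow> schur D \<noteq> 0"
  using hook_factor_nz x_nz x_not_1 diagram_finite by (auto simp: schur_def prod_zero_iff)


text \<open>Adding A lengthens the arms of the nodes in its row and the legs, measured in the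
  component of A, of the nodes of all components in its column; other factors are unchanged. For
  each component t the changed quotients form one side of \<open>component_boundary\<close>, and its
  other side mentions only addable and removable nodes.\<close>

lemma schur_insert_ratio:
  assumes D: "diagram l D" and A: "A \<in> addable l D"
  shows "schur (insert A D) = schur D * ((- 1) ^ (l - 1) *
    (\<Prod>A'\<in>addable l D - {A}. res A / res A' - 1) / (\<Prod>B\<in>removable l D. res A / res B - 1))"
proof -
  obtain s0 i0 j0 where A_eq: "A = (s0, i0, j0)" by (cases A)
  define D' where "D' = insert A D"
  have fin: "finite D" and nin: "(s0, i0, j0) \<notin> D" and s0: "s0 < l" and ge: "1 \<le> i0" "1 \<le> j0"
    using D A diagram_finite addable_iff[OF D] unfolding A_eq by auto
  have D': "diagram l D'" using A by (simp add: addable_def D'_def)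
  have len0: "col_len D s0 j0 + 1 = i0" "row_len D s0 i0 + 1 = j0"
    using A addable_iff_len[OF D] unfolding A_eq by auto
  note row' = row_len_insert[OF fin nin, folded A_eq, folded D'_def]
  note col' = col_len_insert[OF fin nin, folded A_eq, folded D'_def]
  \<comment> \<open>\<open>F t e\<close> stands for res A / res M - 1 at a node M of component t
    with content e. At the content of A itself the value is set to 1: that factor has to be absent
    from the final product, and \<open>component_boundary\<close> asks for a function without
    zeros.\<close>
  define F where "F t e = (if t = s0 \<and> e = int j0 - int i0 then 1
     else x powi (int j0 - int i0 - e) * Q s0 / Q t - 1)" for t e
  have F_nz: "F t e \<noteq> 0" if "t < l" for t e
  proof
    assume *: "F t e = 0"
    then have "x powi (int j0 - int i0 - e) * Q s0 = Q t"
      using Q_nz[OF that] by (auto simp: F_def split: if_splits)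
    from generic[OF s0 that this] * show False by (auto simp: F_def split: if_splits)
  qed
  define q where "q N t = hook_factor D' N t / hook_factor D N t" for N t
  define R where "R = (\<lambda>k. (s0, i0, k)) ` {1..<j0}"
  \<comment> \<open>C runs through all components, because the leg entering a factor with second
    index s0 is measured in component s0 whatever the component of the node.\<close>
  define C where "C = (\<Union>t<l. (\<lambda>a. (t, a, j0)) ` {1..col_len D t j0})"
  have memR: "N \<in> R \<longleftrightarrow> N \<in> D \<and> fst N = s0 \<and> fst (snd N) = i0" for N
  proof -
    obtain s i k where N: "N = (s, i, k)" by (cases N)
    have "row_len D s0 i0 < k \<or> k \<le> row_len D s0 i0" by linarith
    then have "(s0, i0, k) \<in> D \<longleftrightarrow> 1 \<le> k \<and> k < j0"
      unfolding mem_diagram_row[OF D] using len0(2) by linarith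
    moreover have "N \<in> R \<longleftrightarrow> s = s0 \<and> i = i0 \<and> 1 \<le> k \<and> k < j0" unfolding R_def N image_iff by auto
    ultimately show ?thesis unfolding N fst_conv snd_conv by blast
  qed
  have memC: "N \<in> C \<longleftrightarrow> N \<in> D \<and> snd (snd N) = j0" for N
  proof -
    obtain s i k where N: "N = (s, i, k)" by (cases N)
    have "(s, i, j0) \<in> D \<longleftrightarrow> s < l \<and> 1 \<le> i \<and> i \<le> col_len D s j0"
      using mem_diagram_col[OF D, of s i j0] diagram_memD(1)[OF D, of s i j0] by blast
    moreover have "N \<in> C \<longleftrightarrow> s < l \<and> 1 \<le> i \<and> i \<le> col_len D s j0 \<and> k = j0"
      unfolding C_def N UN_iff image_iff by auto
    ultimately show ?thesis unfolding N fst_conv snd_conv by blast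
  qed
  have disj: "R \<inter> C = {}" using memR memC nin by auto
  have sub: "R \<union> C \<subseteq> D" using memR memC by auto
  have q1: "q N t = 1" if "N \<in> D" "t < l" "N \<notin> R" "N \<notin> C \<or> t \<noteq> s0" for N t
    using that hook_factor_nz[OF D that(1,2)] memR[of N] memC[of N]
    by (cases N) (auto simp: q_def hook_factor_def row' col')
  have qR: "q (s0, i0, k) t = F t (int k - 1 - int (col_len D t k)) / F t (int k - int (col_len D t k))"
    if "1 \<le> k" "k < j0" "t < l" for k t
  proof -
    have ne: "int k - int (col_len D t k) < int j0 - int i0" if "t = s0"
    proof -
      have "k \<le> row_len D s0 i0" using len0 \<open>k < j0\<close> by simp
      then have "i0 \<le> col_len D s0 k" using row_col_iff[OF D] ge \<open>1 \<le> k\<close> by blast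
      then show ?thesis using that \<open>k < j0\<close> by simp
    qed
    have r: "row_len D' s0 i0 = j0" "row_len D s0 i0 = j0 - 1" using row'[of s0 i0] len0 by auto
    have c: "col_len D' t k = col_len D t k" using col'[of t k] \<open>k < j0\<close> by simp
    have e: "int j0 - int i0 + int (col_len D t k) - int k + 1 = int j0 - int i0 - (int k - 1 - int (col_len D t k))"
       "int (j0 - 1) - int i0 + int (col_len D t k) - int k + 1 = int j0 - int i0 - (int k - int (col_len D t k))"
      using ge by auto
    show ?thesis unfolding q_def hook_factor_def prod.case r c e
      using ne by (auto simp: F_def)
  qed
  have qC: "q (t, a, j0) s0 = x * (F t (int (row_len D t a) - int a + 1) / F t (int (row_len D t a) - int a))"
    if "1 \<le> a" "a \<le> col_len D t j0" "t < l" for a t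
  proof -
    have na: "\<not> (t = s0 \<and> a = i0)" using that len0 by auto
    have ra: "row_len D' t a = row_len D t a" using row'[of t a] na by simp
    have ne: "int j0 - int i0 < int (row_len D t a) - int a" if "t = s0"
    proof -
      have "j0 \<le> row_len D s0 a" using row_col_iff[OF D, of a j0 s0] ge \<open>1 \<le> a\<close> \<open>a \<le> _\<close> that by simp
      moreover have "a < i0" using len0 \<open>a \<le> _\<close> that by simp
      ultimately show ?thesis using that by simp
    qed
    have c: "col_len D' s0 j0 = i0" "col_len D s0 j0 = i0 - 1" using col'[of s0 j0] len0 by auto
    \<comment> \<open>Here the parameters of t and s0 stand in the opposite order to F. Turning the
      factor round costs a power of x, and the two exponents differ by one, which leaves the x in
      \<open>qC\<close>.\<close>
    have flip: "x powi (- e) * Q t / Q s0 - 1 = - (x powi (- e) * Q t / Q s0) * (x powi e * Q s0 / Q t - 1)" for e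
      using Q_nz[OF \<open>t < l\<close>] Q_nz[OF s0] x_nz by (simp add: field_simps power_int_minus)
    let ?e = "int (row_len D t a) - int a"
    have e1: "int (row_len D t a) - int a + int i0 - int j0 + 1 = - (int j0 - int i0 - (?e + 1))"
      "int (row_len D t a) - int a + int (i0 - 1) - int j0 + 1 = - (int j0 - int i0 - ?e)"
      using ge by auto
    have "F t (?e + 1) = x powi (int j0 - int i0 - (?e + 1)) * Q s0 / Q t - 1"
      "F t ?e = x powi (int j0 - int i0 - ?e) * Q s0 / Q t - 1"
      using ne by (auto simp: F_def)
    then have "q (t, a, j0) s0 =
        (- (x powi (- (int j0 - int i0 - (?e + 1))) * Q t / Q s0) * F t (?e + 1)) /
        (- (x powi (- (int j0 - int i0 - ?e)) * Q t / Q s0) * F t ?e)"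
      unfolding q_def hook_factor_def prod.case ra c e1 flip by simp
    also have "\<dots> = x * (F t (?e + 1) / F t ?e)"
    proof -
      have "x powi (- (int j0 - int i0 - (?e + 1))) = x powi (- (int j0 - int i0 - ?e)) * x"
        using x_nz power_int_add_1[of x "- (int j0 - int i0 - ?e)"] by (simp add: algebra_simps)
      then show ?thesis using Q_nz[OF \<open>t < l\<close>] Q_nz[OF s0] x_nz F_nz[OF \<open>t < l\<close>] by (simp add: field_simps)
    qed
    finally show ?thesis .
  qed
  have hA: "hook_factor D' A t = (if t = s0 then x - 1 else F t (int j0 - 1 - int (col_len D t j0)))"
    if "t < l" for t
  proof -
    have r: "row_len D' s0 i0 = j0" using row'[of s0 i0] len0 by auto
    show ?thesis
    proof (cases "t = s0")
      case True
      have "col_len D' s0 j0 = i0" using col'[of s0 j0] len0 by auto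
      then show ?thesis using True r Q_nz[OF s0] by (simp add: hook_factor_def A_eq)
    next
      case False
      then have "col_len D' t j0 = col_len D t j0" using col'[of t j0] by simp
      then show ?thesis using False r by (simp add: hook_factor_def A_eq F_def algebra_simps)
    qed
  qed
  \<comment> \<open>Column j0 of component s0 ends directly above A, so this argument is the content
    of A, where F is 1 by convention. The hook of A in its own component supplies x - 1
    instead.\<close>
  have F1: "F s0 (int j0 - 1 - int (col_len D s0 j0)) = 1" using len0 by (auto simp: F_def)
  define G where "G t = (\<Prod>A\<in>{A\<in>addable l D. fst A = t}. F t (node_diff A)) /
      (\<Prod>B\<in>{B\<in>removable l D. fst B = t}. F t (node_diff B))" for t
  have G: "hook_factor D' A t * (\<Prod>N\<in>R. q N t) * (\<Prod>a=1..col_len D t j0. q (t, a, j0) s0) =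
      (if t = s0 then x - 1 else 1) * x ^ col_len D t j0 * G t" if t: "t < l" for t
  proof -
    have "(\<Prod>N\<in>R. q N t) = (\<Prod>k=1..<j0. F t (int k - 1 - int (col_len D t k)) / F t (int k - int (col_len D t k)))"
      unfolding R_def using qR t by (subst prod.reindex) (auto simp: inj_on_def intro!: prod.cong)
    moreover have "(\<Prod>a=1..col_len D t j0. q (t, a, j0) s0) = x ^ col_len D t j0 *
        (\<Prod>a=1..col_len D t j0. F t (int (row_len D t a) - int a + 1) / F t (int (row_len D t a) - int a))"
      using qC t by (simp add: prod.distrib prod_dividef)
    moreover have "G t = (\<Prod>k=1..j0. F t (int k - 1 - int (col_len D t k))) /
        (\<Prod>k=1..<j0. F t (int k - int (col_len D t k))) *
        (\<Prod>a=1..col_len D t j0. F t (int (row_len D t a) - int a + 1) / F t (int (row_len D t a) - int a))"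
      unfolding G_def by (rule component_boundary[OF D t ge(2)]) (rule F_nz[OF t])
    moreover have "(\<Prod>k=1..j0. F t (int k - 1 - int (col_len D t k))) =
        (\<Prod>k=1..<j0. F t (int k - 1 - int (col_len D t k))) * F t (int j0 - 1 - int (col_len D t j0))"
    proof -
      have "{1..j0} = insert j0 {1..<j0}" using ge by auto
      then show ?thesis by (simp add: mult.commute)
    qed
    ultimately show ?thesis
      unfolding prod_dividef using hA[OF t] F1 by simp
  qed
  have prodC: "(\<Prod>N\<in>C. q N s0) = (\<Prod>t<l. \<Prod>a=1..col_len D t j0. q (t, a, j0) s0)"
    unfolding C_def by (subst prod.UNION_disjoint) (auto simp: prod.reindex inj_on_def)
  have "(\<Prod>N\<in>D'. \<Prod>t<l. hook_factor D' N t) =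
      (\<Prod>t<l. hook_factor D' A t) * (\<Prod>N\<in>D. \<Prod>t<l. hook_factor D N t * q N t)"
  proof -
    have "(\<Prod>N\<in>D'. g N) = g A * (\<Prod>N\<in>D. g N)" for g :: "_ \<Rightarrow> 'a"
      unfolding D'_def using nin fin by (simp add: A_eq)
    moreover have "(\<Prod>N\<in>D. \<Prod>t<l. hook_factor D' N t) = (\<Prod>N\<in>D. \<Prod>t<l. hook_factor D N t * q N t)"
      using hook_factor_nz[OF D] by (intro prod.cong) (auto simp: q_def)
    ultimately show ?thesis by simp
  qed
  also have "(\<Prod>N\<in>D. \<Prod>t<l. hook_factor D N t * q N t) =
      (\<Prod>N\<in>D. \<Prod>t<l. hook_factor D N t) * (\<Prod>N\<in>D. \<Prod>t<l. q N t)"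
    by (simp add: prod.distrib)
  also have "(\<Prod>N\<in>D. \<Prod>t<l. q N t) = (\<Prod>N\<in>R. \<Prod>t<l. q N t) * (\<Prod>N\<in>C. \<Prod>t<l. q N t)"
  proof -
    have "(\<Prod>N\<in>D. \<Prod>t<l. q N t) = (\<Prod>N\<in>R \<union> C. \<Prod>t<l. q N t)"
      using q1 by (intro prod.mono_neutral_right[OF fin sub]) auto
    also have "\<dots> = (\<Prod>N\<in>R. \<Prod>t<l. q N t) * (\<Prod>N\<in>C. \<Prod>t<l. q N t)"
      using sub fin disj by (intro prod.union_disjoint) (auto intro: finite_subset)
    finally show ?thesis .
  qed
  also have "(\<Prod>N\<in>C. \<Prod>t<l. q N t) = (\<Prod>N\<in>C. q N s0)"
  proof (rule prod.cong[OF refl])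
    fix N assume N: "N \<in> C"
    then have "N \<in> D" "N \<notin> R" using sub disj by auto
    then have "(\<Prod>t<l. q N t) = (\<Prod>t\<in>{s0}. q N t)"
      using q1 s0 by (intro prod.mono_neutral_right) auto
    then show "(\<Prod>t<l. q N t) = q N s0" by simp
  qed
  also have "(\<Prod>N\<in>R. \<Prod>t<l. q N t) = (\<Prod>t<l. \<Prod>N\<in>R. q N t)"
    by (rule prod.swap)
  finally have H: "(\<Prod>N\<in>D'. \<Prod>t<l. hook_factor D' N t) = (\<Prod>N\<in>D. \<Prod>t<l. hook_factor D N t) *
     (\<Prod>t<l. hook_factor D' A t * (\<Prod>N\<in>R. q N t) * (\<Prod>a=1..col_len D t j0. q (t, a, j0) s0))"
    unfolding prodC prod.distrib by (simp add: mult_ac)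
  also have "(\<Prod>t<l. hook_factor D' A t * (\<Prod>N\<in>R. q N t) * (\<Prod>a=1..col_len D t j0. q (t, a, j0) s0)) =
     (\<Prod>t<l. (if t = s0 then x - 1 else 1) * x ^ col_len D t j0 * G t)"
    using G by (intro prod.cong) auto
  also have "\<dots> = (x - 1) * x ^ (\<Sum>t<l. col_len D t j0) * (\<Prod>t<l. G t)"
    using s0 by (simp add: prod.distrib power_sum)
  finally have H: "(\<Prod>N\<in>D'. \<Prod>t<l. hook_factor D' N t) = (\<Prod>N\<in>D. \<Prod>t<l. hook_factor D N t) *
     ((x - 1) * x ^ (\<Sum>t<l. col_len D t j0) * (\<Prod>t<l. G t))" .
  have grp: "(\<Prod>t<l. \<Prod>A\<in>{A\<in>Y. fst A = t}. g t A) = (\<Prod>A\<in>Y. g (fst A) A)"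
    if "finite Y" "\<And>A. A \<in> Y \<Longrightarrow> fst A < l" for Y :: "(nat \<times> nat \<times> nat) set" and g :: "nat \<Rightarrow> _ \<Rightarrow> 'a"
  proof -
    have "(\<Prod>t<l. \<Prod>A\<in>{A\<in>Y. fst A = t}. g t A) = (\<Prod>t<l. \<Prod>A\<in>{A\<in>Y. fst A = t}. g (fst A) A)"
      by (intro prod.cong) auto
    also have "\<dots> = (\<Prod>A\<in>Y. g (fst A) A)"
      using that by (intro prod.group) auto
    finally show ?thesis .
  qed
  have la: "fst A' < l" if "A' \<in> addable l D" for A'
    using that addable_iff[OF D] by (cases A') auto
  have lr: "fst B < l" if "B \<in> removable l D" for B
    using that diagram_memD(1)[OF D] by (cases B) (auto simp: removable_def)
  have Fres: "F (fst M) (node_diff M) = res A / res M - 1" if "fst M < l" "\<not> (fst M = s0 \<and> node_diff M = int j0 - int i0)" for M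
  proof -
    have "F (fst M) (node_diff M) = x powi (int j0 - int i0 - node_diff M) * Q s0 / Q (fst M) - 1"
      unfolding F_def using that(2) by (simp only: if_False)
    also have "\<dots> = res A / res M - 1"
    proof -
      have "x powi (int j0 - int i0 - node_diff M) = x powi (int j0 - int i0) / x powi (node_diff M)"
        by (rule power_int_diff) (simp add: x_nz)
      then show ?thesis by (simp add: res_def A_eq)
    qed
    finally show ?thesis .
  qed
  have "(\<Prod>t<l. G t) = (\<Prod>A'\<in>addable l D. F (fst A') (node_diff A')) / (\<Prod>B\<in>removable l D. F (fst B) (node_diff B))"
    unfolding G_def prod_dividef using addable_finite[OF D] removable_finite[OF D] la lr by (simp add: grp)
  also have "(\<Prod>A'\<in>addable l D. F (fst A') (node_diff A')) = (\<Prod>A'\<in>addable l D - {A}. res A / res A' - 1)"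
  proof -
    have "(\<Prod>A'\<in>addable l D. F (fst A') (node_diff A')) =
        F (fst A) (node_diff A) * (\<Prod>A'\<in>addable l D - {A}. F (fst A') (node_diff A'))"
      using A addable_finite[OF D] by (simp add: prod.remove)
    also have "F (fst A) (node_diff A) = 1" by (simp add: F_def A_eq)
    also have "(\<Prod>A'\<in>addable l D - {A}. F (fst A') (node_diff A')) = (\<Prod>A'\<in>addable l D - {A}. res A / res A' - 1)"
    proof (intro prod.cong[OF refl] Fres)
      fix A' assume A': "A' \<in> addable l D - {A}"
      then show "fst A' < l" using la by auto
      show "\<not> (fst A' = s0 \<and> node_diff A' = int j0 - int i0)"
        using addable_inj[OF D A, of A'] A' by (auto simp: A_eq)
    qed
    finally show ?thesis by simp
  qed
  also have "(\<Prod>B\<in>removable l D. F (fst B) (node_diff B)) = (\<Prod>B\<in>removable l D. res A / res B - 1)"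
  proof (intro prod.cong[OF refl] Fres)
    fix B assume B: "B \<in> removable l D"
    then show "fst B < l" using lr by auto
    show "\<not> (fst B = s0 \<and> node_diff B = int j0 - int i0)"
      using addable_removable_diff[OF D A B] by (auto simp: A_eq)
  qed
  finally have G_all: "(\<Prod>t<l. G t) = (\<Prod>A'\<in>addable l D - {A}. res A / res A' - 1) /
     (\<Prod>B\<in>removable l D. res A / res B - 1)" .
  have cs: "col_stat l D' = col_stat l D + (\<Sum>t<l. col_len D t j0)"
    using col_stat_insert[OF D] A by (simp add: A_eq D'_def)
  have cd: "card D' = Suc (card D)" using fin nin by (simp add: D'_def A_eq)
  \<comment> \<open>The factors x collected from the column of A match the growth of
    \<open>col_stat\<close>.\<close>
  have xp: "x powi (- int (col_stat l D')) * x ^ (\<Sum>t<l. col_len D t j0) = x powi (- int (col_stat l D))"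
    unfolding cs power_int_minus power_int_of_nat power_add using x_nz by simp
  have "schur D' = (- 1) ^ ((l - 1) * card D) * (- 1) ^ (l - 1) *
      (x powi (- int (col_stat l D')) * x ^ (\<Sum>t<l. col_len D t j0)) / (x - 1) ^ card D *
      ((x - 1) / (x - 1)) * (\<Prod>N\<in>D. \<Prod>t<l. hook_factor D N t) * (\<Prod>t<l. G t)"
    unfolding schur_def H cd by (simp add: power_add mult_ac)
  also have "\<dots> = schur D * ((- 1) ^ (l - 1) * (\<Prod>t<l. G t))"
    unfolding xp schur_def using x_not_1 by (simp add: mult_ac)
  finally show ?thesis unfolding G_all D'_def by simp
qed


section \<open>Interpolation at the residues of the addable nodes\<close>

lemma addable_fst: "diagram l D \<Longrightarrow> A \<in> addable l D \<Longrightarrow> fst A < l"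
  using addable_iff by (cases A) auto

lemma removable_fst: "diagram l D \<Longrightarrow> B \<in> removable l D \<Longrightarrow> fst B < l"
  using diagram_memD(1) by (cases B) (auto simp: removable_def)

lemma addable_res_inj: "diagram l D \<Longrightarrow> inj_on res (addable l D)"
  by (rule inj_onI) (metis addable_fst addable_inj res_eq_iff)

lemma addable_removable_res:
  "diagram l D \<Longrightarrow> A \<in> addable l D \<Longrightarrow> B \<in> removable l D \<Longrightarrow> res A \<noteq> res B"
  by (metis addable_fst removable_fst addable_removable_diff res_eq_iff)

text \<open>The part of the ratio that does not depend on A, once every
  \<open>res A / res M - 1\<close> is written as \<open>res A - res M\<close> over
  \<open>res M\<close>.\<close>

definition kappa :: "(nat \<times> nat \<times> nat) set \<Rightarrow> 'a" where
  "kappa D = (- 1) ^ (l - 1) * (\<Prod>A\<in>addable l D. res A) / (\<Prod>B\<in>removable l D. res B)"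

lemma schur_ratio_lagrange:
  assumes D: "diagram l D" and A: "A \<in> addable l D"
  shows "schur D / schur (insert A D) = kappa D * ((\<Prod>B\<in>removable l D. res A - res B) /
    (res A * (\<Prod>A'\<in>addable l D - {A}. res A - res A')))"
proof -
  have fin: "finite (addable l D)" by (rule addable_finite[OF D])
  have nzA: "res A' \<noteq> 0" if "A' \<in> addable l D" for A' using that addable_fst[OF D] res_nz by auto
  have nzB: "res B \<noteq> 0" if "B \<in> removable l D" for B using that removable_fst[OF D] res_nz by auto
  have 1: "(\<Prod>A'\<in>addable l D - {A}. res A / res A' - 1) =
      (\<Prod>A'\<in>addable l D - {A}. res A - res A') / (\<Prod>A'\<in>addable l D - {A}. res A')"
    unfolding prod_dividef[symmetric] using nzA by (intro prod.cong) (auto simp: field_simps)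
  have 2: "(\<Prod>B\<in>removable l D. res A / res B - 1) =
      (\<Prod>B\<in>removable l D. res A - res B) / (\<Prod>B\<in>removable l D. res B)"
    unfolding prod_dividef[symmetric] using nzB by (intro prod.cong) (auto simp: field_simps)
  have 3: "(\<Prod>A\<in>addable l D. res A) = res A * (\<Prod>A'\<in>addable l D - {A}. res A')"
    using A fin by (simp add: prod.remove)
  have n1: "(\<Prod>A'\<in>addable l D - {A}. res A - res A') \<noteq> 0"
    using fin addable_res_inj[OF D] A by (auto simp: prod_zero_iff dest: inj_onD)
  have n2: "(\<Prod>A'\<in>addable l D - {A}. res A') \<noteq> 0" using fin nzA by (auto simp: prod_zero_iff)
  have n3: "(\<Prod>B\<in>removable l D. res A - res B) \<noteq> 0"
    using removable_finite[OF D] addable_removable_res[OF D A] by (auto simp: prod_zero_iff)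
  have n4: "(\<Prod>B\<in>removable l D. res B) \<noteq> 0"
    using removable_finite[OF D] nzB by (auto simp: prod_zero_iff)
  have sgn: "(- 1 :: 'a) ^ (l - 1) * (- 1) ^ (l - 1) = 1"
    by (simp flip: power_mult_distrib)
  have "schur D / schur (insert A D) = 1 / ((- 1) ^ (l - 1) *
    (\<Prod>A'\<in>addable l D - {A}. res A / res A' - 1) / (\<Prod>B\<in>removable l D. res A / res B - 1))"
    using schur_insert_ratio[OF D A] schur_nz[OF D] by simp
  also have "\<dots> = (- 1) ^ (l - 1) *
     ((\<Prod>B\<in>removable l D. res A / res B - 1) / (\<Prod>A'\<in>addable l D - {A}. res A / res A' - 1))"
  proof -
    have "inverse ((- 1 :: 'a) ^ (l - 1)) = (- 1) ^ (l - 1)" by (rule inverse_unique[OF sgn])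
    then show ?thesis by (simp add: divide_inverse mult_ac)
  qed
  finally show ?thesis
    unfolding 1 2 3 kappa_def using n1 n2 n3 n4 nzA[OF A] by (simp add: field_simps)
qed

text \<open>This makes the inverse hook products compatible with restriction from n + 1 to n: the
  sums over A are those by which the exponent of the last Jucys-Murphy element enters the weighted
  traces.\<close>

lemma schur_ratio_power_sum:
  assumes D: "diagram l D" and c: "c < l"
  shows "(\<Sum>A\<in>addable l D. schur D / schur (insert A D) * res A ^ c) = (if c = 0 then 1 else 0)"
proof -
  have fin: "finite (addable l D)" and finr: "finite (removable l D)"
    using addable_finite[OF D] removable_finite[OF D] by auto
  have nzA: "res A' \<noteq> 0" if "A' \<in> addable l D" for A' using that addable_fst[OF D] res_nz by auto
  have nzB: "res B \<noteq> 0" if "B \<in> removable l D" for B using that removable_fst[OF D] res_nz by auto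
  define P where "P = (\<Prod>B\<in>removable l D. [:- res B, 1:])"
  have degP: "degree P = card (removable l D)"
    unfolding P_def by (subst degree_prod_eq_sum_degree) auto
  have polyP: "poly P y = (\<Prod>B\<in>removable l D. y - res B)" for y
    by (simp add: P_def poly_prod)
  show ?thesis
  proof (cases "c = 0")
    case False
    have "(\<Sum>A\<in>addable l D. schur D / schur (insert A D) * res A ^ c) =
      (\<Sum>A\<in>addable l D. kappa D * (poly (monom 1 (c - 1) * P) (res A) / (\<Prod>A'\<in>addable l D - {A}. res A - res A')))"
    proof (rule sum.cong[OF refl])
      fix A assume A: "A \<in> addable l D"
      have "res A ^ c = res A * res A ^ (c - 1)" using False by (simp add: power_eq_if)
      then show "schur D / schur (insert A D) * res A ^ c =
        kappa D * (poly (monom 1 (c - 1) * P) (res A) / (\<Prod>A'\<in>addable l D - {A}. res A - res A'))"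
        unfolding schur_ratio_lagrange[OF D A] using nzA[OF A] by (simp add: polyP poly_monom)
    qed
    also have "\<dots> = kappa D * (\<Sum>A\<in>addable l D. poly (monom 1 (c - 1) * P) (res A) / (\<Prod>A'\<in>addable l D - {A}. res A - res A'))"
      by (simp add: sum_distrib_left)
    also have "(\<Sum>A\<in>addable l D. poly (monom 1 (c - 1) * P) (res A) / (\<Prod>A'\<in>addable l D - {A}. res A - res A')) = 0"
    proof (rule lagrange_sum_zero[OF fin addable_res_inj[OF D]])
      have "degree (monom 1 (c - 1) * P) \<le> (c - 1) + card (removable l D)"
        using degree_mult_le[of "monom 1 (c - 1)" P] degree_monom_le[of "1::'a" "c - 1"] degP by linarith
      then show "degree (monom 1 (c - 1) * P) + 1 < card (addable l D)"
        using card_addable[OF D] c False by linarith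
    qed
    finally show ?thesis using False by simp
  next
    case True
    \<comment> \<open>Interpolation at the residues and the extra point 0.\<close>
    define S where "S = insert None (Some ` addable l D)"
    define y where "y = case_option 0 res"
    have finS: "finite S" using fin by (simp add: S_def)
    have injy: "inj_on y S"
      using addable_res_inj[OF D] nzA by (auto simp: inj_on_def S_def y_def split: option.splits)
    have cardS: "card S = Suc (card (addable l D))"
      unfolding S_def using fin by (subst card_insert_disjoint) (auto simp: card_image)
    have z1: "(\<Sum>a\<in>S. poly P (y a) / (\<Prod>b\<in>S - {a}. y a - y b)) = 0"
      by (rule lagrange_sum_zero[OF finS injy]) (use degP cardS card_addable[OF D] l_pos in simp)
    have z2: "(\<Sum>a\<in>S. poly P (y a) / (\<Prod>b\<in>S - {a}. y a - y b)) =
       poly P 0 / (\<Prod>A\<in>addable l D. - res A) +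
       (\<Sum>A\<in>addable l D. poly P (res A) / (res A * (\<Prod>A'\<in>addable l D - {A}. res A - res A')))"
    proof -
      have "S - {None} = Some ` addable l D" by (auto simp: S_def)
      then have e1: "(\<Prod>b\<in>S - {None}. y None - y b) = (\<Prod>A\<in>addable l D. - res A)"
        by (simp add: prod.reindex y_def)
      have e2: "(\<Prod>b\<in>S - {Some A}. y (Some A) - y b) = res A * (\<Prod>A'\<in>addable l D - {A}. res A - res A')"
        if "A \<in> addable l D" for A
      proof -
        have "S - {Some A} = insert None (Some ` (addable l D - {A}))" by (auto simp: S_def)
        then show ?thesis using fin by (simp add: prod.reindex y_def)
      qed
      have "(\<Sum>a\<in>S. poly P (y a) / (\<Prod>b\<in>S - {a}. y a - y b)) =
         poly P (y None) / (\<Prod>b\<in>S - {None}. y None - y b) +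
         (\<Sum>a\<in>Some ` addable l D. poly P (y a) / (\<Prod>b\<in>S - {a}. y a - y b))"
        using fin by (subst S_def, subst sum.insert) auto
      also have "(\<Sum>a\<in>Some ` addable l D. poly P (y a) / (\<Prod>b\<in>S - {a}. y a - y b)) =
         (\<Sum>A\<in>addable l D. poly P (res A) / (res A * (\<Prod>A'\<in>addable l D - {A}. res A - res A')))"
      proof (subst sum.reindex, simp, rule sum.cong[OF refl])
        fix A assume A: "A \<in> addable l D"
        have "y (Some A) = res A" by (simp add: y_def)
        then show "((\<lambda>a. poly P (y a) / (\<Prod>b\<in>S - {a}. y a - y b)) \<circ> Some) A =
           poly P (res A) / (res A * (\<Prod>A'\<in>addable l D - {A}. res A - res A'))"
          unfolding o_def e2[OF A] by simp
      qed
      finally show ?thesis unfolding e1 by (simp add: y_def)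
    qed
    have z3: "(\<Sum>A\<in>addable l D. schur D / schur (insert A D) * res A ^ c) =
      kappa D * (\<Sum>A\<in>addable l D. poly P (res A) / (res A * (\<Prod>A'\<in>addable l D - {A}. res A - res A')))"
      unfolding sum_distrib_left True by (intro sum.cong) (simp_all add: schur_ratio_lagrange[OF D] polyP)
    have eq: "(\<Sum>A\<in>addable l D. schur D / schur (insert A D) * res A ^ c) =
       - (kappa D * (poly P 0 / (\<Prod>A\<in>addable l D. - res A)))"
    proof -
      have "(\<Sum>A\<in>addable l D. poly P (res A) / (res A * (\<Prod>A'\<in>addable l D - {A}. res A - res A'))) =
         - (poly P 0 / (\<Prod>A\<in>addable l D. - res A))"
        using z1[unfolded z2] by (rule minus_unique[symmetric])
      then show ?thesis unfolding z3 by simp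
    qed
    have n: "(\<Prod>A\<in>addable l D. res A) \<noteq> 0" "(\<Prod>B\<in>removable l D. res B) \<noteq> 0"
      using fin finr nzA nzB by (auto simp: prod_zero_iff)
    have neg: "(\<Prod>A\<in>Y. - res A) = (- 1) ^ card Y * (\<Prod>A\<in>Y. res A)" if "finite Y" for Y
      using that by (induction Y rule: finite_induct) auto
    obtain l' where l': "l = Suc l'" using l_pos by (cases l) auto
    have sg: "(- 1 :: 'a) ^ k * (- 1) ^ k = 1" for k
      by (simp flip: power_mult_distrib)
    have "poly P 0 / (\<Prod>A\<in>addable l D. - res A) =
      (- 1) ^ card (removable l D) * (\<Prod>B\<in>removable l D. res B) /
       ((- 1) ^ (card (removable l D) + l) * (\<Prod>A\<in>addable l D. res A))"
      unfolding polyP using neg fin finr card_addable[OF D] by simp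
    also have "\<dots> = (- 1) ^ l * (\<Prod>B\<in>removable l D. res B) / (\<Prod>A\<in>addable l D. res A)"
      using sg[of l] sg[of "card (removable l D)"] n by (simp add: power_add field_simps)
    finally have v: "poly P 0 / (\<Prod>A\<in>addable l D. - res A) =
      (- 1) ^ l * (\<Prod>B\<in>removable l D. res B) / (\<Prod>A\<in>addable l D. res A)" .
    have sl: "(- 1 :: 'a) ^ l = - ((- 1) ^ (l - 1))" using l' by simp
    show ?thesis
      unfolding eq v kappa_def sl using True n sg[of "l - 1"] by simp
  qed
qed

text \<open>The pole at \<open>res B\<close> cancels a factor of the numerator, and the additional
  \<open>res A\<close> cancels the one in the denominator. The remaining polynomial has degree at
  most c plus the number of removable nodes minus one, so every c < l, including 0, gives
  zero.\<close>

lemma schur_ratio_removable_sum: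
  assumes D: "diagram l D" and c: "c < l" and B: "B \<in> removable l D"
  shows "(\<Sum>A\<in>addable l D. schur D / schur (insert A D) * res A ^ c *
     ((x - 1) * res A / (res A - res B))) = 0"
proof -
  have fin: "finite (addable l D)" and finr: "finite (removable l D)"
    using addable_finite[OF D] removable_finite[OF D] by auto
  have nzA: "res A' \<noteq> 0" if "A' \<in> addable l D" for A' using that addable_fst[OF D] res_nz by auto
  define P where "P = (\<Prod>B\<in>removable l D - {B}. [:- res B, 1:])"
  have degP: "degree P = card (removable l D) - 1"
    unfolding P_def using B finr by (subst degree_prod_eq_sum_degree) auto
  have polyP: "poly P y = (\<Prod>B\<in>removable l D - {B}. y - res B)" for y
    by (simp add: P_def poly_prod)
  have "(\<Sum>A\<in>addable l D. schur D / schur (insert A D) * res A ^ c * ((x - 1) * res A / (res A - res B))) =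
    (\<Sum>A\<in>addable l D. (kappa D * (x - 1)) * (poly (monom 1 c * P) (res A) / (\<Prod>A'\<in>addable l D - {A}. res A - res A')))"
  proof (rule sum.cong[OF refl])
    fix A assume A: "A \<in> addable l D"
    have "(\<Prod>B\<in>removable l D. res A - res B) = (res A - res B) * poly P (res A)"
      using B finr by (simp add: prod.remove polyP)
    then show "schur D / schur (insert A D) * res A ^ c * ((x - 1) * res A / (res A - res B)) =
       (kappa D * (x - 1)) * (poly (monom 1 c * P) (res A) / (\<Prod>A'\<in>addable l D - {A}. res A - res A'))"
      unfolding schur_ratio_lagrange[OF D A] using nzA[OF A] addable_removable_res[OF D A B]
      by (simp add: poly_monom)
  qed
  also have "\<dots> = (kappa D * (x - 1)) *
      (\<Sum>A\<in>addable l D. poly (monom 1 c * P) (res A) / (\<Prod>A'\<in>addable l D - {A}. res A - res A'))"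
    by (simp add: sum_distrib_left)
  also have "(\<Sum>A\<in>addable l D. poly (monom 1 c * P) (res A) / (\<Prod>A'\<in>addable l D - {A}. res A - res A')) = 0"
  proof (rule lagrange_sum_zero[OF fin addable_res_inj[OF D]])
    have "degree (monom 1 c * P) \<le> c + (card (removable l D) - 1)"
      using degree_mult_le[of "monom 1 c" P] degree_monom_le[of "1::'a" c] degP by linarith
    moreover have "card (removable l D) > 0" using B finr by (auto simp: card_gt_0_iff)
    ultimately show "degree (monom 1 c * P) + 1 < card (addable l D)"
      using card_addable[OF D] c by linarith
  qed
  finally show ?thesis by simp
qed

end

section \<open>Functionals on words\<close>

text \<open>A linear form on the quotient recorded by its values on words. Each clause is a defining
  relation placed between arbitrary words u and v; the order relation is expanded into the
  coefficients of its polynomial, the quadratic one is solved for the square.\<close>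

definition ak_functional :: "nat \<Rightarrow> nat \<Rightarrow> 'a::field \<Rightarrow> (nat \<Rightarrow> 'a) \<Rightarrow> (nat list \<Rightarrow> 'a) \<Rightarrow> bool" where
  "ak_functional l n x Q g \<longleftrightarrow> (\<forall>u v. set u \<subseteq> {..<n} \<longrightarrow> set v \<subseteq> {..<n} \<longrightarrow>
     (\<Sum>i\<le>l. coeff (\<Prod>j<l. [:- Q j, 1:]) i * g (u @ replicate i 0 @ v)) = 0 \<and>
     (\<forall>i. 1 \<le> i \<longrightarrow> i < n \<longrightarrow> g (u @ [i, i] @ v) = (x - 1) * g (u @ [i] @ v) + x * g (u @ v)) \<and>
     (2 \<le> n \<longrightarrow> g (u @ [0, 1, 0, 1] @ v) = g (u @ [1, 0, 1, 0] @ v)) \<and>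
     (\<forall>i. 1 \<le> i \<longrightarrow> i + 1 < n \<longrightarrow> g (u @ [i, i + 1, i] @ v) = g (u @ [i + 1, i, i + 1] @ v)) \<and>
     (\<forall>i j. i + 1 < j \<longrightarrow> j < n \<longrightarrow> g (u @ [i, j] @ v) = g (u @ [j, i] @ v)))"

text \<open>The word of \<open>x\<^bsup>k-1\<^esup> L\<^sub>k\<close>; the scalar is left out so that the recursion is one of words.\<close>

definition jm_word :: "nat \<Rightarrow> nat list" where
  "jm_word k = rev [1..<k] @ [0] @ [1..<k]"

lemma jm_word_1 [simp]: "jm_word (Suc 0) = [0]"
  by (simp add: jm_word_def)

lemma jm_word_Suc: "1 \<le> k \<Longrightarrow> jm_word (Suc k) = [k] @ jm_word k @ [k]"
  by (simp add: jm_word_def)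

definition jm_powers :: "(nat \<Rightarrow> nat) \<Rightarrow> nat \<Rightarrow> nat list" where
  "jm_powers c n = concat (map (\<lambda>k. concat (replicate (c k) (jm_word k))) [1..<Suc n])"

lemma jm_powers_0 [simp]: "jm_powers c 0 = []"
  by (simp add: jm_powers_def)

lemma jm_powers_Suc: "jm_powers c (Suc n) = jm_powers c n @ concat (replicate (c (Suc n)) (jm_word (Suc n)))"
  by (simp add: jm_powers_def)

section \<open>Standard paths\<close>

text \<open>A standard tableau is represented by the list of its nodes in the order of the entries.
  Splitting off the largest entry is then removing the last list element.\<close>

fun path_from :: "nat \<Rightarrow> (nat \<times> nat \<times> nat) set \<Rightarrow> (nat \<times> nat \<times> nat) list \<Rightarrow> bool" where
  "path_from l D [] \<longleftrightarrow> True"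
| "path_from l D (A # P) \<longleftrightarrow> A \<in> addable l D \<and> path_from l (insert A D) P"

definition paths :: "nat \<Rightarrow> (nat \<times> nat \<times> nat) set \<Rightarrow> (nat \<times> nat \<times> nat) list set" where
  "paths l D = {P. path_from l {} P \<and> set P = D}"

lemma path_from_append: "path_from l D (P @ R) \<longleftrightarrow> path_from l D P \<and> path_from l (set P \<union> D) R"
  by (induction P arbitrary: D) auto

lemma path_from_diagram: "diagram l D \<Longrightarrow> path_from l D P \<Longrightarrow> diagram l (set P \<union> D)"
proof (induction P arbitrary: D)
  case (Cons A P)
  then have "diagram l (insert A D)" by (auto simp: addable_def)
  then have "diagram l (set P \<union> insert A D)" using Cons.IH[of "insert A D"] Cons.prems(2) by simp
  then show ?case by simp
qed simp

lemma path_from_distinct: "path_from l D P \<Longrightarrow> distinct P \<and> set P \<inter> D = {}"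
  by (induction P arbitrary: D) (auto simp: addable_def)

lemma paths_diagram: "P \<in> paths l D \<Longrightarrow> diagram l D"
  using path_from_diagram[OF diagram_empty] by (force simp: paths_def)

lemma paths_length: "P \<in> paths l D \<Longrightarrow> length P = card D"
  using path_from_distinct distinct_card by (force simp: paths_def)

lemma paths_snoc: "P @ [A] \<in> paths l D' \<longleftrightarrow> A \<in> addable l (set P) \<and> P \<in> paths l (set P) \<and> D' = insert A (set P)"
  by (auto simp: paths_def path_from_append)

definition all_paths :: "nat \<Rightarrow> nat \<Rightarrow> (nat \<times> nat \<times> nat) list set" where
  "all_paths l n = {P. path_from l {} P \<and> length P = n}"

lemma all_paths_iff: "P \<in> all_paths l n \<longleftrightarrow> P \<in> paths l (set P) \<and> length P = n"
  by (auto simp: all_paths_def paths_def)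

lemma all_paths_0: "all_paths l 0 = {[]}"
  by (auto simp: all_paths_def)

lemma all_paths_Suc:
  "all_paths l (Suc n) = (\<lambda>(P, A). P @ [A]) ` (SIGMA P:all_paths l n. addable l (set P))"
proof (intro Set.set_eqI iffI)
  fix R assume R: "R \<in> all_paths l (Suc n)"
  then have "R \<noteq> []" by (auto simp: all_paths_def)
  then obtain P A where PA: "R = P @ [A]" by (metis append_butlast_last_id)
  then have "(P, A) \<in> (SIGMA P:all_paths l n. addable l (set P))"
    using R by (auto simp: all_paths_def path_from_append)
  then show "R \<in> (\<lambda>(P, A). P @ [A]) ` (SIGMA P:all_paths l n. addable l (set P))"
    using PA by force
qed (auto simp: all_paths_def path_from_append)

lemma all_paths_diagram: "P \<in> all_paths l n \<Longrightarrow> diagram l (set P)"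
  using paths_diagram all_paths_iff by blast

lemma all_paths_finite: "finite (all_paths l n)"
proof (induction n)
  case (Suc n)
  then show ?case unfolding all_paths_Suc
    by (intro finite_imageI finite_SigmaI) (auto intro: addable_finite all_paths_diagram)
qed (simp add: all_paths_0)

lemma paths_finite: "finite (paths l D)"
proof -
  have "paths l D \<subseteq> all_paths l (card D)" using paths_length by (auto simp: all_paths_def paths_def)
  then show ?thesis using all_paths_finite finite_subset by blast
qed

lemma sum_all_paths_Suc:
  fixes f :: "_ \<Rightarrow> 'b::comm_monoid_add"
  shows "(\<Sum>R\<in>all_paths l (Suc n). f R) = (\<Sum>P\<in>all_paths l n. \<Sum>A\<in>addable l (set P). f (P @ [A]))"
proof -
  have "(\<Sum>R\<in>all_paths l (Suc n). f R) =
     (\<Sum>(P, A)\<in>(SIGMA P:all_paths l n. addable l (set P)). f (P @ [A]))"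
    unfolding all_paths_Suc by (subst sum.reindex) (auto simp: inj_on_def intro!: sum.cong)
  also have "\<dots> = (\<Sum>P\<in>all_paths l n. \<Sum>A\<in>addable l (set P). f (P @ [A]))"
    by (rule sum.Sigma[symmetric]) (auto intro: all_paths_finite addable_finite all_paths_diagram)
  finally show ?thesis .
qed

definition in_line :: "nat \<times> nat \<times> nat \<Rightarrow> nat \<times> nat \<times> nat \<Rightarrow> bool" where
  "in_line N M \<longleftrightarrow> fst N = fst M \<and> (fst (snd N) = fst (snd M) \<or> snd (snd N) = snd (snd M))"

lemma in_line_sym: "in_line N M \<longleftrightarrow> in_line M N"
  by (auto simp: in_line_def)

text \<open>M needs only its upper and its left neighbour. If N is neither, M could be added before
  N, and N is as free afterwards as it was before.\<close>

lemma addable_swap: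
  assumes D: "diagram l D" and N: "N \<in> addable l D" and M: "M \<in> addable l (insert N D)" and "\<not> in_line N M"
  shows "M \<in> addable l D" "N \<in> addable l (insert M D)"
proof -
  obtain s i j s' i' j' where eq: "N = (s, i, j)" "M = (s', i', j')" by (metis prod.collapse)
  have D1: "diagram l (insert N D)" using N by (simp add: addable_def)
  show M1: "M \<in> addable l D"
    using M assms(4) unfolding eq addable_iff[OF D1[unfolded eq]] addable_iff[OF D] by (auto simp: in_line_def)
  then have D2: "diagram l (insert M D)" by (simp add: addable_def)
  show "N \<in> addable l (insert M D)"
    using N M assms(4) unfolding eq addable_iff[OF D1[unfolded eq]] addable_iff[OF D] addable_iff[OF D2[unfolded eq]]
    by (auto simp: in_line_def)
qed

text \<open>Once N is added it ends both its row and its column, so a node added next in one of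
  these lines is the neighbour of N, and the contents differ by one.\<close>

lemma in_line_next:
  assumes D: "diagram l D" and N: "N \<in> addable l D" and M: "M \<in> addable l (insert N D)" and "in_line N M"
  shows "fst M = fst N" "fst (snd M) = fst (snd N) \<Longrightarrow> node_diff M = node_diff N + 1"
    "snd (snd M) = snd (snd N) \<Longrightarrow> node_diff M = node_diff N - 1"
proof -
  obtain s i j s' i' j' where eq: "N = (s, i, j)" "M = (s', i', j')" by (metis prod.collapse)
  have D1: "diagram l (insert N D)" using N by (simp add: addable_def)
  show "fst M = fst N" using assms(4) by (simp add: in_line_def)
  then have s: "s' = s" by (simp add: eq)
  have fin: "finite D" and nin: "(s, i, j) \<notin> D"
    using D N diagram_finite unfolding eq by (auto simp: addable_def)
  have a: "row_len D s i + 1 = j" "col_len D s j + 1 = i"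
    using N unfolding eq addable_iff_len[OF D] by blast+
  have b: "row_len (insert (s, i, j) D) s i' + 1 = j'" "col_len (insert (s, i, j) D) s j' + 1 = i'"
    using M unfolding eq addable_iff_len[OF D1[unfolded eq]] s by blast+
  show "node_diff M = node_diff N + 1" if "fst (snd M) = fst (snd N)"
    using a b that unfolding eq row_len_insert[OF fin nin] by simp
  show "node_diff M = node_diff N - 1" if "snd (snd M) = snd (snd N)"
    using a b that unfolding eq col_len_insert[OF fin nin] by simp
qed

lemma addable_next_diff:
  assumes D: "diagram l D" and N: "N \<in> addable l D" and M: "M \<in> addable l (insert N D)" and "fst N = fst M"
  shows "node_diff N \<noteq> node_diff M"
proof (cases "in_line N M")
  case True
  note d = in_line_next(2,3)[OF D N M True]
  have "fst (snd M) = fst (snd N) \<or> snd (snd M) = snd (snd N)"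
    using True unfolding in_line_def by metis
  then show ?thesis
  proof
    assume "fst (snd M) = fst (snd N)"
    from d(1)[OF this] show ?thesis by linarith
  next
    assume "snd (snd M) = snd (snd N)"
    from d(2)[OF this] show ?thesis by linarith
  qed
next
  case False
  have "M \<in> addable l D" using addable_swap[OF D N M False] by simp
  moreover have "M \<noteq> N" using M by (auto simp: addable_def)
  ultimately show ?thesis using addable_inj[OF D N, of M] assms(4) by auto
qed

text \<open>For the braid relation, which involves three consecutive nodes. If K lay south-east of N
  on the same diagonal, both its upper and its left neighbour would be missing from D and from N,
  and the single node M cannot be both.\<close>

lemma addable_next2_diff:
  assumes D: "diagram l D" and N: "N \<in> addable l D" and M: "M \<in> addable l (insert N D)"
    and K: "K \<in> addable l (insert M (insert N D))" and "fst N = fst K"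
  shows "node_diff N \<noteq> node_diff K"
proof
  assume eqd: "node_diff N = node_diff K"
  obtain s i j i' j' where eq: "N = (s, i, j)" "K = (s, i', j')" using assms(5) by (metis prod.collapse)
  have D1: "diagram l (insert N D)" using N by (simp add: addable_def)
  have D2: "diagram l (insert M (insert N D))" using M by (simp add: addable_def)
  have a: "1 \<le> i" "1 \<le> j" "(s, i, j) \<notin> D" "1 < i \<Longrightarrow> (s, i - 1, j) \<in> D"
    using N unfolding eq addable_iff[OF D] by blast+
  have b: "1 \<le> i'" "1 \<le> j'" "(s, i', j') \<notin> D" "(s, i', j') \<noteq> (s, i, j)"
    "1 < i' \<Longrightarrow> (s, i' - 1, j') \<in> insert M (insert N D)"
    "1 < j' \<Longrightarrow> (s, i', j' - 1) \<in> insert M (insert N D)"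
    using K unfolding eq addable_iff[OF D2[unfolded eq]] by blast+
  have up: "(s, a, b) \<notin> D" if "i \<le> a" "j \<le> b" for a b
    using diagram_down_closed[OF D, of s a b i j] that a(1-3) by blast
  consider "i' < i" | "i' = i" | "i < i'" by linarith
  then show False
  proof cases
    case 1
    then have "j' < j" using eqd eq by simp
    have "(s, i - 1, j) \<in> D" using a(4) b(1) 1 by linarith
    then have "(s, i', j') \<in> D"
      using diagram_down_closed[OF D, of s "i - 1" j i' j'] b(1,2) 1 \<open>j' < j\<close> by simp
    then show False using b(3) by simp
  next
    case 2
    then have "j' = j" using eqd eq by simp
    then show False using b(4) 2 by simp
  next
    case 3
    then have "j < j'" using eqd eq by simp
    have "(s, i' - 1, j') \<in> insert M (insert N D)" using b(5) 3 a(1) by linarith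
    then have "M = (s, i' - 1, j')" using up[of "i' - 1" j'] 3 \<open>j < j'\<close> eq by auto
    moreover have "(s, i', j' - 1) \<in> insert M (insert N D)" using b(6) \<open>j < j'\<close> a(2) by linarith
    then have "M = (s, i', j' - 1)" using up[of "i'" "j' - 1"] 3 \<open>j < j'\<close> eq by auto
    ultimately show False using 3 by auto
  qed
qed

section \<open>The seminormal representations\<close>

text \<open>Entries count from 1 and list positions from 0: this exchanges the nodes carrying k and
  k + 1.\<close>

definition swap_at :: "nat \<Rightarrow> 'b list \<Rightarrow> 'b list" where
  "swap_at k P = P[k - 1 := P ! k, k := P ! (k - 1)]"

lemma swap_at_append: "swap_at (Suc (length xs)) (xs @ N # M # ys) = xs @ M # N # ys"
  by (simp add: swap_at_def nth_append list_update_append)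

lemma length_swap_at [simp]: "length (swap_at k P) = length P"
  by (simp add: swap_at_def)

lemma list_split2:
  assumes "1 \<le> k" "k < length P"
  obtains xs N M ys where "P = xs @ N # M # ys" "k = Suc (length xs)"
proof -
  have "P = take (k - 1) P @ P ! (k - 1) # P ! k # drop (Suc k) P"
    using assms id_take_nth_drop[of "k - 1" P] Cons_nth_drop_Suc[of k P] by simp
  moreover have "k = Suc (length (take (k - 1) P))" using assms by simp
  ultimately show ?thesis using that by blast
qed

lemma list_split3:
  assumes "1 \<le> k" "k + 1 < length P"
  obtains xs N M K ys where "P = xs @ N # M # K # ys" "k = Suc (length xs)"
proof -
  obtain xs N M ys where 1: "P = xs @ N # M # ys" "k = Suc (length xs)"
    using list_split2[of k P thesis] assms by simp
  then obtain K zs where "ys = K # zs" using assms by (cases ys) auto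
  then show ?thesis using 1 that by blast
qed

lemma path_swap:
  assumes "xs @ N # M # ys \<in> paths l D" "\<not> in_line N M"
  shows "xs @ M # N # ys \<in> paths l D"
proof -
  have d: "diagram l (set xs)" "N \<in> addable l (set xs)" "M \<in> addable l (insert N (set xs))"
    using assms(1) path_from_diagram[OF diagram_empty, of l xs]
    by (auto simp: paths_def path_from_append)
  from addable_swap[OF this assms(2)] show ?thesis
    using assms(1) by (auto simp: paths_def path_from_append insert_commute)
qed

context ak_generic
begin

text \<open>The coefficient \<open>a\<close> of the seminormal form, with N carrying k and M
  carrying k + 1.\<close>

definition alpha :: "nat \<times> nat \<times> nat \<Rightarrow> nat \<times> nat \<times> nat \<Rightarrow> 'a" where
  "alpha N M = (x - 1) * res M / (res M - res N)"

text \<open>The action on coefficient functions. The off-diagonal coefficient at P belongs to the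
  image of the exchanged path, in which the two nodes have swapped places; hence the reversed
  arguments of \<open>alpha\<close>. The eigenvalues x and - 1 on a common row or column are values
  of \<open>alpha\<close> too, by \<open>alpha_in_line\<close>.\<close>

definition act :: "nat \<Rightarrow> ((nat \<times> nat \<times> nat) list \<Rightarrow> 'a) \<Rightarrow> (nat \<times> nat \<times> nat) list \<Rightarrow> 'a" where
  "act k v P = (if k = 0 then Q (fst (P ! 0)) * v P
     else alpha (P ! (k - 1)) (P ! k) * v P +
       (if in_line (P ! (k - 1)) (P ! k) then 0
        else (1 + alpha (P ! k) (P ! (k - 1))) * v (swap_at k P)))"

lemma act_append:
  "act (Suc (length xs)) v (xs @ N # M # ys) = alpha N M * v (xs @ N # M # ys) +
     (if in_line N M then 0 else (1 + alpha M N) * v (xs @ M # N # ys))"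
  by (simp add: act_def nth_append swap_at_append)

lemma act_append2:
  "act (Suc (Suc (length xs))) v (xs @ K # N # M # ys) = alpha N M * v (xs @ K # N # M # ys) +
     (if in_line N M then 0 else (1 + alpha M N) * v (xs @ K # M # N # ys))"
  using act_append[of "xs @ [K]" v N M ys] by simp

text \<open>The coefficients at paths of shape D depend only on paths of shape D, so relations may
  be checked shape by shape. The exchanged path has that shape by \<open>path_swap\<close>.\<close>

lemma act_cong:
  assumes "\<And>R. R \<in> paths l D \<Longrightarrow> v R = w R" "P \<in> paths l D" "k < card D"
  shows "act k v P = act k w P"
proof (cases "k = 0")
  case True then show ?thesis using assms by (simp add: act_def)
next
  case False
  then obtain xs N M ys where P: "P = xs @ N # M # ys" "k = Suc (length xs)"
    using list_split2[of k P thesis] assms(3) paths_length[OF assms(2)] by simp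
  show ?thesis
    unfolding P act_append using assms(1)[OF assms(2)[unfolded P]] assms(1)[OF path_swap[OF assms(2)[unfolded P]]]
    by simp
qed

lemma foldr_act_cong:
  assumes "set ks \<subseteq> {..<card D}" "\<And>R. R \<in> paths l D \<Longrightarrow> v R = w R" "P \<in> paths l D"
  shows "foldr act ks v P = foldr act ks w P"
  using assms by (induction ks arbitrary: P) (auto intro!: act_cong)

lemma act_sum: "act k (\<lambda>R. \<Sum>a\<in>Y. c a * v a R) P = (\<Sum>a\<in>Y. c a * act k (v a) P)"
  by (simp add: act_def sum_distrib_left sum_distrib_right sum.distrib algebra_simps)

lemma foldr_act_sum: "foldr act ks (\<lambda>R. \<Sum>a\<in>Y. c a * v a R) P = (\<Sum>a\<in>Y. c a * foldr act ks (v a) P)"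
proof (induction ks arbitrary: P)
  case (Cons k ks)
  have "foldr act ks (\<lambda>R. \<Sum>a\<in>Y. c a * v a R) = (\<lambda>R. \<Sum>a\<in>Y. c a * foldr act ks (v a) R)"
    using Cons by (intro ext)
  then show ?case by (simp add: act_sum)
qed simp

lemma foldr_act_zero: "foldr act ks (\<lambda>R. 0) = (\<lambda>R. 0)"
  using foldr_act_sum[of ks "\<lambda>_. 0" "\<lambda>_ _. 0" "{}"] by auto

section \<open>Identities of the seminormal coefficients\<close>

lemma alpha_sum: "res N \<noteq> res M \<Longrightarrow> alpha N M + alpha M N = x - 1"
  by (simp add: alpha_def divide_simps) (simp add: algebra_simps)

lemma alpha_res: "res N \<noteq> res M \<Longrightarrow> alpha N M * res N + alpha M N * res M = 0"
  by (simp add: alpha_def divide_simps) (simp add: algebra_simps)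

text \<open>The diagonal coefficient of T_k L_k T_k at a path with N and M in the places k and k +
  1; \<open>alpha_res\<close> gives the vanishing of the off-diagonal one.\<close>

lemma alpha_diag: "res N \<noteq> res M \<Longrightarrow>
    alpha N M * alpha N M * res N + (1 + alpha N M) * (1 + alpha M N) * res M = x * res M"
proof -
  assume ne: "res N \<noteq> res M"
  have 1: "alpha M N = x - 1 - alpha N M" using alpha_sum[OF ne] by (simp add: algebra_simps)
  have 2: "alpha N M * (res M - res N) = (x - 1) * res M" using ne by (simp add: alpha_def)
  show ?thesis unfolding 1 using 2 by Groebner_Basis.algebra
qed

text \<open>A partial fraction identity in three residues. The coefficients of the two sides of the
  braid relation are compared through it and through two consequences of it and
  \<open>alpha_sum\<close>, namely \<open>alpha_braid2\<close> and the fact \<open>b3\<close> in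
  \<open>act_braid\<close>.\<close>

lemma alpha_braid1:
  assumes "res N \<noteq> res M" "res M \<noteq> res K" "res N \<noteq> res K"
  shows "alpha N M * alpha M K + alpha N K * alpha M N = alpha M K * alpha N K"
proof -
  have 1: "alpha M N = x - 1 - alpha N M" using alpha_sum[OF assms(1)] by (simp add: algebra_simps)
  have 2: "alpha N M * (res M - res N) = (x - 1) * res M" using assms by (simp add: alpha_def)
  have 3: "alpha M K * (res K - res M) = (x - 1) * res K" using assms by (simp add: alpha_def)
  have 4: "alpha N K * (res K - res N) = (x - 1) * res K" using assms by (simp add: alpha_def)
  have "(alpha N M * alpha M K + alpha N K * alpha M N - alpha M K * alpha N K) *
     ((res M - res N) * (res K - res M) * (res K - res N)) = 0"
    unfolding 1 using 2 3 4 by Groebner_Basis.algebra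
  then show ?thesis using assms by simp
qed

lemma alpha_braid2:
  assumes "res N \<noteq> res M" "res M \<noteq> res K" "res N \<noteq> res K"
  shows "alpha N M * alpha M K * alpha N M + (1 + alpha N M) * (1 + alpha M N) * alpha N K =
    alpha M K * alpha N M * alpha M K + (1 + alpha M K) * (1 + alpha K M) * alpha N K"
proof -
  have 1: "alpha M N = x - 1 - alpha N M" using alpha_sum[OF assms(1)] by (simp add: algebra_simps)
  have 5: "alpha K M = x - 1 - alpha M K" using alpha_sum[OF assms(2)] by (simp add: algebra_simps)
  have 6: "alpha N M * alpha M K + alpha N K * (x - 1 - alpha N M) = alpha M K * alpha N K"
    using alpha_braid1[OF assms] unfolding 1 .
  show ?thesis unfolding 1 5 using 6 by Groebner_Basis.algebra
qed

text \<open>Neighbours have residues with quotient x, so \<open>alpha\<close> degenerates to the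
  eigenvalues of T_k. The last claim lets formulas derived for exchangeable nodes remain valid for
  neighbours, where the exchanged path does not exist.\<close>

lemma alpha_in_line:
  assumes D: "diagram l D" and N: "N \<in> addable l D" and M: "M \<in> addable l (insert N D)" and i: "in_line N M"
  shows "fst (snd M) = fst (snd N) \<Longrightarrow> alpha N M = x" "snd (snd M) = snd (snd N) \<Longrightarrow> alpha N M = - 1"
    "(1 + alpha N M) * (1 + alpha M N) = 0"
proof -
  have l: "fst N < l" using addable_fst[OF D N] .
  have nz: "res N \<noteq> 0" using res_nz[OF l] .
  note d = in_line_next[OF D N M i]
  have R: "res M = x * res N" if "fst (snd M) = fst (snd N)"
    using d(2)[OF that] d(1) x_nz by (simp add: res_def power_int_add_1')
  have C: "res N = x * res M" if "snd (snd M) = snd (snd N)"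
  proof -
    have "node_diff N = node_diff M + 1" using d(3)[OF that] by simp
    then show ?thesis using d(1) x_nz by (simp add: res_def power_int_add_1')
  qed
  show r: "alpha N M = x" if "fst (snd M) = fst (snd N)"
  proof -
    have "res M - res N = (x - 1) * res N" using R[OF that] by (simp add: algebra_simps)
    then show ?thesis using nz x_not_1 R[OF that] by (simp add: alpha_def)
  qed
  have c2: "alpha M N = x" if "snd (snd M) = snd (snd N)"
  proof -
    have "res N - res M = (x - 1) * res M" "res M \<noteq> 0" using C[OF that] nz by (auto simp: algebra_simps)
    then show ?thesis using x_not_1 C[OF that] by (simp add: alpha_def)
  qed
  have ne: "res N \<noteq> res M"
  proof
    assume e: "res N = res M"
    have "fst (snd M) = fst (snd N) \<or> snd (snd M) = snd (snd N)" using i unfolding in_line_def by metis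
    then show False
    proof
      assume "fst (snd M) = fst (snd N)"
      from R[OF this] e nz x_not_1 show False by simp
    next
      assume "snd (snd M) = snd (snd N)"
      from C[OF this] e nz x_not_1 show False by simp
    qed
  qed
  show c: "alpha N M = - 1" if "snd (snd M) = snd (snd N)"
    using alpha_sum[OF ne] c2[OF that] by Groebner_Basis.algebra
  have "fst (snd M) = fst (snd N) \<or> snd (snd M) = snd (snd N)" using i unfolding in_line_def by metis
  then show "(1 + alpha N M) * (1 + alpha M N) = 0"
  proof
    assume "fst (snd M) = fst (snd N)"
    from r[OF this] alpha_sum[OF ne] have "alpha M N = - 1" by (simp add: algebra_simps add_eq_0_iff)
    then show ?thesis by simp
  next
    assume "snd (snd M) = snd (snd N)"
    from c[OF this] show ?thesis by simp
  qed
qed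

lemma path_two:
  assumes "xs @ N # M # ys \<in> paths l D"
  shows "diagram l (set xs)" "N \<in> addable l (set xs)" "M \<in> addable l (insert N (set xs))" "res N \<noteq> res M"
    "in_line N M \<Longrightarrow> (1 + alpha N M) * (1 + alpha M N) = 0"
proof -
  show d: "diagram l (set xs)" "N \<in> addable l (set xs)" "M \<in> addable l (insert N (set xs))"
    using assms path_from_diagram[OF diagram_empty, of l xs]
    by (auto simp: paths_def path_from_append)
  have "diagram l (insert N (set xs))" using d(2) by (simp add: addable_def)
  then show "res N \<noteq> res M"
    using addable_next_diff[OF d] addable_fst[OF d(1,2)] addable_fst[OF _ d(3)] res_eq_iff by blast
  show "in_line N M \<Longrightarrow> (1 + alpha N M) * (1 + alpha M N) = 0" using alpha_in_line(3)[OF d] .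
qed

lemma path_three:
  assumes "xs @ N # M # K # ys \<in> paths l D"
  shows "res N \<noteq> res K"
proof -
  have d: "diagram l (set xs)" "N \<in> addable l (set xs)" "M \<in> addable l (insert N (set xs))"
    "K \<in> addable l (insert M (insert N (set xs)))"
    using assms path_from_diagram[OF diagram_empty, of l xs]
    by (auto simp: paths_def path_from_append)
  have "diagram l (insert M (insert N (set xs)))" using d(3) by (simp add: addable_def)
  then show "res N \<noteq> res K"
    using addable_next2_diff[OF d] addable_fst[OF d(1,2)] addable_fst[OF _ d(4)] res_eq_iff by blast
qed

section \<open>The defining relations and the Jucys-Murphy elements in the seminormal action\<close>

lemma act_quadratic:
  assumes P: "P \<in> paths l D" and k: "1 \<le> k" "k < card D"
  shows "act k (act k v) P = (x - 1) * act k v P + x * v P"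
proof -
  obtain xs N M ys where eq: "P = xs @ N # M # ys" "k = Suc (length xs)"
    using list_split2[of k P thesis] k paths_length[OF P] by simp
  note f = path_two[OF P[unfolded eq]]
  have 1: "alpha M N = x - 1 - alpha N M" using alpha_sum[OF f(4)] by (simp add: algebra_simps)
  show ?thesis
  proof (cases "in_line N M")
    case True
    have z: "(1 + alpha N M) * (1 + (x - 1 - alpha N M)) = 0" using f(5)[OF True] unfolding 1 .
    have "alpha N M * (alpha N M * v P) = (x - 1) * (alpha N M * v P) + x * v P"
      using z by Groebner_Basis.algebra
    then show ?thesis using True unfolding eq act_append by simp
  next
    case False
    then have "\<not> in_line M N" by (simp add: in_line_sym)
    then show ?thesis unfolding eq act_append using False by (simp add: 1 algebra_simps)
  qed
qed

lemma act_braid: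
  assumes P: "P \<in> paths l D" and k: "1 \<le> k" "k + 1 < card D"
  shows "act k (act (k + 1) (act k v)) P = act (k + 1) (act k (act (k + 1) v)) P"
proof -
  obtain xs N M K ys where eq: "P = xs @ N # M # K # ys" "k = Suc (length xs)"
    using list_split3[of k P thesis] k paths_length[OF P] by simp
  note f = path_two[OF P[unfolded eq]] and h = path_three[OF P[unfolded eq]]
  note g = path_two[of "xs @ [N]" M K ys D, simplified, OF P[unfolded eq]]
  have b1: "alpha N M * alpha M K + alpha N K * alpha M N = alpha M K * alpha N K"
    using alpha_braid1[OF f(4) g(4) h] .
  have b3: "alpha N M * alpha N K = alpha M K * alpha N M + alpha N K * alpha K M"
    using b1 alpha_sum[OF f(4)] alpha_sum[OF g(4)] by Groebner_Basis.algebra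
  \<comment> \<open>For nodes in line the guarded product is zero anyway, so the conditional form
    follows from the unconditional \<open>alpha_braid2\<close>.\<close>
  have b2: "alpha N M * alpha M K * alpha N M +
      (if in_line N M then 0 else (1 + alpha N M) * (1 + alpha M N) * alpha N K) =
    alpha M K * alpha N M * alpha M K +
      (if in_line M K then 0 else (1 + alpha M K) * (1 + alpha K M) * alpha N K)"
    using alpha_braid2[OF f(4) g(4) h] f(5) g(5) by auto
  show ?thesis
    unfolding eq Suc_eq_plus1[symmetric] act_append act_append2 in_line_sym[of M N] in_line_sym[of K M] in_line_sym[of K N]
    using b1 b2 b3 by (cases "in_line N M"; cases "in_line M K"; cases "in_line N K"; simp; Groebner_Basis.algebra)
qed


lemma act_commute:
  assumes P: "P \<in> paths l D" and k: "i + 1 < j" "j < card D"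
  shows "act i (act j v) P = act j (act i v) P"
proof -
  obtain zs N M ys where eq: "P = zs @ N # M # ys" "j = Suc (length zs)"
    using list_split2[of j P thesis] k paths_length[OF P] by simp
  show ?thesis
  proof (cases "i = 0")
    case True
    then obtain A as where zs: "zs = A # as" using k eq by (cases zs) auto
    show ?thesis unfolding eq act_append using True zs
      by (simp add: act_def[of 0] act_append[where xs = "A # as", simplified] algebra_simps)
  next
    case False
    then obtain xs N' M' ys' where zs: "zs = xs @ N' # M' # ys'" "i = Suc (length xs)"
      using list_split2[of i zs thesis] k eq by simp
    have j: "j = Suc (length (xs @ N' # M' # ys'))" using eq zs by simp
    have J: "act j w (xs @ A # B # ys' @ N # M # ys) = alpha N M * w (xs @ A # B # ys' @ N # M # ys) +
     (if in_line N M then 0 else (1 + alpha M N) * w (xs @ A # B # ys' @ M # N # ys))" for w A B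
      using act_append[of "xs @ A # B # ys'" w N M ys] j by simp
    show ?thesis unfolding eq(1) zs append_assoc append_Cons J act_append
      by (simp add: algebra_simps)
  qed
qed

text \<open>Induction along \<open>jm_word_Suc\<close>: conjugating the diagonal operator by T_k
  gives a diagonal operator again, by \<open>alpha_diag\<close> and \<open>alpha_res\<close>. The
  factor x ^ (k - 1) is the scalar by which \<open>jm_word k\<close> differs from L_k.\<close>

lemma foldr_jm_word:
  assumes "P \<in> paths l D" "1 \<le> k" "k \<le> card D"
  shows "foldr act (jm_word k) v P = x ^ (k - 1) * res (P ! (k - 1)) * v P"
  using assms(2,3,1)
proof (induction k arbitrary: v P rule: nat_induct_at_least)
  case base
  then obtain A R where P: "P = A # R" using paths_length[of P l D] by (cases P) auto
  have "A \<in> addable l {}" using base P by (simp add: paths_def)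
  then have "node_diff A = 0" using addable_iff[OF diagram_empty, of "fst A" "fst (snd A)" "snd (snd A)" l]
    by (cases A) auto
  then show ?case by (simp add: P act_def res_def)
next
  case (Suc k)
  obtain xs N M ys where eq: "P = xs @ N # M # ys" "k = Suc (length xs)"
    using list_split2[of k P thesis] Suc.hyps Suc.prems paths_length[of P l D] by simp
  have PD: "xs @ N # M # ys \<in> paths l D" using Suc.prems eq by simp
  note f = path_two[OF PD]
  define w where "w = foldr act (jm_word k) (act k v)"
  have w: "w R = x ^ (k - 1) * res (R ! (k - 1)) * act k v R" if "R \<in> paths l D" for R
    unfolding w_def using Suc.IH[OF _ that] Suc.prems by simp
  have "foldr act (jm_word (Suc k)) v P = act k w P"
    using Suc.hyps by (simp add: jm_word_Suc w_def)
  also have "\<dots> = x ^ (k - 1) * (x * res M * v P)"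
  proof (cases "in_line N M")
    case True
    have "alpha N M * (alpha N M * res N) = x * res M"
      using alpha_diag[OF f(4)] f(5)[OF True] by (simp add: mult.assoc)
    moreover have "act k w P = x ^ (k - 1) * ((alpha N M * (alpha N M * res N)) * v P)"
      unfolding eq act_append using True w[OF PD] by (simp add: eq act_append mult_ac)
    ultimately show ?thesis by simp
  next
    case False
    have PD': "xs @ M # N # ys \<in> paths l D" using path_swap[OF PD False] .
    have nl: "\<not> in_line M N" using False by (simp add: in_line_sym)
    have w1: "w (xs @ N # M # ys) = x ^ (k - 1) * res N * (alpha N M * v (xs @ N # M # ys) + (1 + alpha M N) * v (xs @ M # N # ys))"
      using w[OF PD] False unfolding eq act_append by simp
    have w2: "w (xs @ M # N # ys) = x ^ (k - 1) * res M * (alpha M N * v (xs @ M # N # ys) + (1 + alpha N M) * v (xs @ N # M # ys))"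
      using w[OF PD'] nl unfolding eq act_append by simp
    have "act k w P = x ^ (k - 1) * ((alpha N M * alpha N M * res N + (1 + alpha N M) * (1 + alpha M N) * res M) * v P +
       (1 + alpha M N) * (alpha N M * res N + alpha M N * res M) * v (xs @ M # N # ys))"
      unfolding eq act_append w1[unfolded eq] w2[unfolded eq] using False by (simp add: algebra_simps)
    then show ?thesis unfolding alpha_diag[OF f(4)] alpha_res[OF f(4)] by simp
  qed
  finally show ?case using Suc.hyps by (simp add: eq power_eq_if[of x k] nth_append mult_ac)
qed

definition jm_eigen :: "(nat \<Rightarrow> nat) \<Rightarrow> nat \<Rightarrow> (nat \<times> nat \<times> nat) list \<Rightarrow> 'a" where
  "jm_eigen c n P = (\<Prod>k=1..n. (x ^ (k - 1) * res (P ! (k - 1))) ^ c k)"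

lemma foldr_jm_powers:
  assumes "P \<in> paths l D" "m \<le> card D"
  shows "foldr act (jm_powers c m) v P = jm_eigen c m P * v P"
  using assms(2)
proof (induction m arbitrary: v)
  case (Suc m)
  have pw: "foldr act (concat (replicate e (jm_word (Suc m)))) v R =
      (x ^ m * res (R ! m)) ^ e * v R" if "R \<in> paths l D" for e v R
  proof (induction e)
    case (Suc e)
    show ?case using foldr_jm_word[OF that, of "Suc m"] \<open>Suc m \<le> card D\<close> Suc by simp
  qed simp
  have "jm_eigen c (Suc m) P = jm_eigen c m P * (x ^ m * res (P ! m)) ^ c (Suc m)"
    by (simp add: jm_eigen_def)
  then show ?case using Suc pw[OF assms(1)] by (simp add: jm_powers_Suc)
qed (simp add: jm_eigen_def)

definition delta :: "(nat \<times> nat \<times> nat) list \<Rightarrow> (nat \<times> nat \<times> nat) list \<Rightarrow> 'a" where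
  "delta P = (\<lambda>R. if R = P then 1 else 0)"

definition path_trace :: "(nat \<times> nat \<times> nat) set \<Rightarrow> nat list \<Rightarrow> 'a" where
  "path_trace D w = (\<Sum>P\<in>paths l D. foldr act w (delta P) P)"

lemma path_trace_functional:
  assumes "card D = n" "1 \<le> n"
  shows "ak_functional l n x Q (path_trace D)"
  unfolding ak_functional_def
proof (intro allI impI conjI, goal_cases)
  case (1 u v)
  let ?c = "coeff (\<Prod>j<l. [:- Q j, 1:])"
  have deg: "degree (\<Prod>j<l. [:- Q j, 1:]) = l"
    by (subst degree_prod_eq_sum_degree) auto
  have rep: "foldr act (replicate i 0) w R = Q (fst (R ! 0)) ^ i * w R" for i w R
    by (induction i) (auto simp: act_def)
  have "(\<Sum>i\<le>l. ?c i * path_trace D (u @ replicate i 0 @ v)) =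
      (\<Sum>P\<in>paths l D. \<Sum>i\<le>l. ?c i * foldr act (u @ replicate i 0 @ v) (delta P) P)"
    unfolding path_trace_def sum_distrib_left by (rule sum.swap)
  also have "\<dots> = (\<Sum>P\<in>paths l D. 0)"
  proof (rule sum.cong[OF refl])
    fix P assume P: "P \<in> paths l D"
    have "(\<Sum>i\<le>l. ?c i * foldr act (u @ replicate i 0 @ v) (delta P) P) =
        foldr act u (\<lambda>R. \<Sum>i\<le>l. ?c i * foldr act (replicate i 0) (foldr act v (delta P)) R) P"
      by (simp add: foldr_act_sum)
    also have "\<dots> = foldr act u (\<lambda>R. 0) P"
    proof (rule foldr_act_cong[of _ D])
      fix R assume R: "R \<in> paths l D"
      then obtain A R' where eq: "R = A # R'" using paths_length[of R l D] assms by (cases R) auto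
      have "A \<in> addable l {}" using R eq by (simp add: paths_def)
      then have A: "fst A < l" using addable_fst[OF diagram_empty] by blast
      have "(\<Sum>i\<le>l. ?c i * foldr act (replicate i 0) (foldr act v (delta P)) R) =
         (\<Sum>i\<le>l. ?c i * Q (fst A) ^ i) * foldr act v (delta P) R"
        unfolding rep eq by (simp add: sum_distrib_right mult.assoc)
      \<comment> \<open>A path begins at the corner of some component s < l, where T_0 acts by
        \<open>Q s\<close>, a root of the polynomial.\<close>
      also have "(\<Sum>i\<le>l. ?c i * Q (fst A) ^ i) = poly (\<Prod>j<l. [:- Q j, 1:]) (Q (fst A))"
        unfolding poly_altdef deg ..
      also have "\<dots> = 0" using A by (auto simp: poly_prod prod_zero_iff)
      finally show "(\<Sum>i\<le>l. ?c i * foldr act (replicate i 0) (foldr act v (delta P)) R) = 0" by simp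
    qed (use 1 P assms in auto)
    finally show "(\<Sum>i\<le>l. ?c i * foldr act (u @ replicate i 0 @ v) (delta P) P) = 0"
      by (simp add: foldr_act_zero)
  qed
  finally show ?case by simp
next
  case (2 u v i)
  have "foldr act (u @ [i, i] @ v) (delta P) P =
     (x - 1) * foldr act (u @ [i] @ v) (delta P) P + x * foldr act (u @ v) (delta P) P" if P: "P \<in> paths l D" for P
  proof -
    let ?z = "foldr act v (delta P)"
    \<comment> \<open>The two terms of the quadratic relation are written as a sum over
      \<open>bool\<close>, so that \<open>foldr_act_sum\<close> can move u inside.\<close>
    have "foldr act (u @ [i, i] @ v) (delta P) P =
       foldr act u (\<lambda>R. \<Sum>b\<in>UNIV. (if b then x - 1 else x) * (if b then act i ?z R else ?z R)) P"
      by (simp, rule foldr_act_cong[of _ D]) (use 2 P assms act_quadratic in \<open>auto simp: UNIV_bool add.commute\<close>)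
    also have "\<dots> = (x - 1) * foldr act u (act i ?z) P + x * foldr act u ?z P"
      unfolding foldr_act_sum by (simp add: UNIV_bool add.commute if_distrib[of "\<lambda>w. foldr act u w P"])
    finally show ?thesis by simp
  qed
  then show ?case by (simp add: path_trace_def sum.distrib sum_distrib_left)
next
  case (3 u v)
  have "foldr act (u @ [0, 1, 0, 1] @ v) (delta P) P = foldr act (u @ [1, 0, 1, 0] @ v) (delta P) P"
    if P: "P \<in> paths l D" for P
  proof -
    \<comment> \<open>The relation of length four needs no coefficients: T_1 T_0 T_1 is
      \<open>jm_word 2\<close>, which is diagonal and so commutes with the diagonal T_0.\<close>
    have j: "jm_word 2 = [1, 0, 1]" by (simp add: jm_word_def numeral_2_eq_2)
    have jm: "foldr act [1, 0, 1] w R = x * res (R ! 1) * w R" if "R \<in> paths l D" for w R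
      using foldr_jm_word[OF that, of 2 w] 3 assms unfolding j by simp
    have "foldr act [0, 1, 0, 1] w R = foldr act [1, 0, 1, 0] w R" if R: "R \<in> paths l D" for w R
    proof -
      have "foldr act [0, 1, 0, 1] w R = act 0 (foldr act [1, 0, 1] w) R" by simp
      also have "\<dots> = foldr act [1, 0, 1] (act 0 w) R" using jm[OF R] by (simp add: act_def[of 0])
      finally show ?thesis by simp
    qed
    then show ?thesis unfolding foldr_append comp_def
      by (intro foldr_act_cong[of _ D]) (use 3 P assms in auto)
  qed
  then show ?case by (simp add: path_trace_def)
next
  case (4 u v i)
  have "foldr act (u @ [i, i + 1, i] @ v) (delta P) P = foldr act (u @ [i + 1, i, i + 1] @ v) (delta P) P"
    if P: "P \<in> paths l D" for P
  proof -
    have "foldr act [i, i + 1, i] w R = foldr act [i + 1, i, i + 1] w R" if R: "R \<in> paths l D" for w R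
      using act_braid[OF R] 4 assms by simp
    then show ?thesis unfolding foldr_append comp_def
      by (intro foldr_act_cong[of _ D]) (use 4 P assms in auto)
  qed
  then show ?case by (simp add: path_trace_def)
next
  case (5 u v i j)
  have "foldr act (u @ [i, j] @ v) (delta P) P = foldr act (u @ [j, i] @ v) (delta P) P"
    if P: "P \<in> paths l D" for P
  proof -
    have "foldr act [i, j] w R = foldr act [j, i] w R" if R: "R \<in> paths l D" for w R
      using act_commute[OF R] 5 assms by simp
    then show ?thesis unfolding foldr_append comp_def
      by (intro foldr_act_cong[of _ D]) (use 5 P assms in auto)
  qed
  then show ?case by (simp add: path_trace_def)
qed

end

section \<open>Traces weighted by inverse hook products\<close>

context ak_generic
begin

lemma act_snoc: "k < length P \<Longrightarrow> act k v (P @ [A]) = act k (\<lambda>R. v (R @ [A])) P"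
  by (auto simp: act_def nth_append swap_at_def list_update_append)

text \<open>Letters smaller than the length of P never move the last node. The restriction to these
  letters therefore splits according to that node.\<close>

lemma foldr_act_snoc:
  "set ks \<subseteq> {..<length P} \<Longrightarrow> foldr act ks v (P @ [A]) = foldr act ks (\<lambda>R. v (R @ [A])) P"
proof (induction ks arbitrary: P)
  case (Cons k ks)
  have "foldr act (k # ks) v (P @ [A]) = act k (\<lambda>R. foldr act ks v (R @ [A])) P"
    using Cons.prems by (simp add: act_snoc)
  also have "\<dots> = act k (foldr act ks (\<lambda>R. v (R @ [A]))) P"
  proof -
    have "foldr act ks v (R @ [A]) = foldr act ks (\<lambda>R. v (R @ [A])) R" if "length R = length P" for R
      using Cons that by auto
    then show ?thesis by (auto simp: act_def)
  qed
  finally show ?case by simp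
qed simp

lemma delta_snoc: "(\<lambda>R. delta (P @ [A]) (R @ [B])) = (if A = B then delta P else (\<lambda>R. 0))"
  by (auto simp: delta_def)

text \<open>The candidate for \<open>ak_tau\<close> on \<open>jm_powers c n\<close> followed by w,
  with the diagonal part already evaluated. The sum runs over the paths of all shapes, so that the
  last node can be split off.\<close>

definition weighted_trace :: "nat \<Rightarrow> (nat \<Rightarrow> nat) \<Rightarrow> nat list \<Rightarrow> 'a" where
  "weighted_trace n c w =
     (\<Sum>P\<in>all_paths l n. 1 / schur (set P) * jm_eigen c n P * foldr act w (delta P) P)"

lemma jm_eigen_snoc: "length P = n \<Longrightarrow> jm_eigen c (Suc n) (P @ [A]) = jm_eigen c n P * (x ^ n * res A) ^ c (Suc n)"
proof -
  assume n: "length P = n"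
  have "jm_eigen c n (P @ [A]) = jm_eigen c n P"
    unfolding jm_eigen_def using n by (intro prod.cong) (auto simp: nth_append)
  then show ?thesis using n by (simp add: jm_eigen_def nth_append)
qed

text \<open>For w the last node A is a spectator. It enters only through the weight and the
  eigenvalue of L_(n+1), and the sum over A is \<open>schur_ratio_power_sum\<close>.\<close>

lemma weighted_trace_restrict:
  assumes "set w \<subseteq> {..<n}" "c (Suc n) < l"
  shows "weighted_trace (Suc n) c w = (if c (Suc n) = 0 then weighted_trace n c w else 0)"
proof -
  let ?c = "c (Suc n)"
  have "weighted_trace (Suc n) c w = (\<Sum>P\<in>all_paths l n. \<Sum>A\<in>addable l (set P).
     (1 / schur (set P) * jm_eigen c n P * foldr act w (delta P) P * (x ^ n) ^ ?c) *
     (schur (set P) / schur (insert A (set P)) * res A ^ ?c))"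
    unfolding weighted_trace_def sum_all_paths_Suc
  proof (intro sum.cong refl)
    fix P A assume P: "P \<in> all_paths l n" and A: "A \<in> addable l (set P)"
    have len: "length P = n" using P by (simp add: all_paths_def)
    have nz: "schur (set P) \<noteq> 0" using schur_nz all_paths_diagram[OF P] .
    have "foldr act w (delta (P @ [A])) (P @ [A]) = foldr act w (delta P) P"
      using assms len by (simp add: foldr_act_snoc delta_snoc)
    then show "1 / schur (set (P @ [A])) * jm_eigen c (Suc n) (P @ [A]) * foldr act w (delta (P @ [A])) (P @ [A]) =
      (1 / schur (set P) * jm_eigen c n P * foldr act w (delta P) P * (x ^ n) ^ ?c) *
      (schur (set P) / schur (insert A (set P)) * res A ^ ?c)"
      using nz by (simp add: jm_eigen_snoc[OF len] power_mult_distrib)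
  qed
  also have "\<dots> = (\<Sum>P\<in>all_paths l n. (1 / schur (set P) * jm_eigen c n P * foldr act w (delta P) P * (x ^ n) ^ ?c) *
     (if ?c = 0 then 1 else 0))"
    unfolding sum_distrib_left[symmetric] using schur_ratio_power_sum[OF all_paths_diagram assms(2)]
    by (intro sum.cong) auto
  also have "\<dots> = (if ?c = 0 then weighted_trace n c w else 0)"
    by (simp add: weighted_trace_def)
  finally show ?thesis .
qed

lemma paths_last_removable: "R \<in> paths l D \<Longrightarrow> R \<noteq> [] \<Longrightarrow> last R \<in> removable l D"
proof -
  assume R: "R \<in> paths l D" "R \<noteq> []"
  then obtain P B where eq: "R = P @ [B]" by (metis append_butlast_last_id)
  have p: "B \<in> addable l (set P)" "P \<in> paths l (set P)" "D = insert B (set P)"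
    using R(1) unfolding eq paths_snoc by auto
  have "D - {B} = set P" using p(1,3) by (auto simp: addable_def)
  then show ?thesis using paths_diagram[OF p(2)] p(3) eq by (simp add: removable_def)
qed

text \<open>The single letter n either keeps the last two nodes B and A or exchanges them. After an
  exchange B is last, and the letters of v, all below n, cannot bring A back; so only the diagonal
  coefficient \<open>alpha B A\<close> contributes. B is removable from the shape of P, and the sum
  over A vanishes by \<open>schur_ratio_removable_sum\<close>.\<close>

lemma weighted_trace_one_top_letter:
  assumes n: "1 \<le> n" and u: "set u \<subseteq> {..<n}" and v: "set v \<subseteq> {..<n}" and c: "c (Suc n) < l"
  shows "weighted_trace (Suc n) c (u @ [n] @ v) = 0"
proof -
  let ?c = "c (Suc n)"
  have key: "(\<Sum>A\<in>addable l (set P). 1 / schur (insert A (set P)) * res A ^ ?c *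
      foldr act (u @ [n] @ v) (delta (P @ [A])) (P @ [A])) = 0" if P: "P \<in> all_paths l n" for P
  proof -
    have PD: "P \<in> paths l (set P)" and len: "length P = n" using P by (auto simp: all_paths_iff)
    have D: "diagram l (set P)" using all_paths_diagram[OF P] .
    have cd: "card (set P) = n" using paths_length[OF PD] len by simp
    have diag: "foldr act (u @ [n] @ v) (delta (P @ [A])) (P @ [A]) =
        foldr act u (\<lambda>R. alpha (last R) A * foldr act v (delta P) R) P" if A: "A \<in> addable l (set P)" for A
    proof -
      have "foldr act (u @ [n] @ v) (delta (P @ [A])) (P @ [A]) =
          foldr act u (\<lambda>R. act n (foldr act v (delta (P @ [A]))) (R @ [A])) P"
        using u len by (simp add: foldr_act_snoc)
      also have "\<dots> = foldr act u (\<lambda>R. alpha (last R) A * foldr act v (delta P) R) P"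
      proof (rule foldr_act_cong[OF _ _ PD])
        fix R assume R: "R \<in> paths l (set P)"
        then have lR: "length R = n" and sR: "set R = set P" using paths_length[OF R] cd by (auto simp: paths_def)
        then obtain R0 B where eq: "R = R0 @ [B]" using n by (cases R rule: rev_cases) auto
        have neq: "A \<noteq> B" using A sR eq by (auto simp: addable_def)
        have n_eq: "n = Suc (length R0)" using lR eq by simp
        have v1: "foldr act v (delta (P @ [A])) (R @ [A]) = foldr act v (delta P) R"
          using v lR by (simp add: foldr_act_snoc delta_snoc)
        have v2: "foldr act v (delta (P @ [A])) ((R0 @ [A]) @ [B]) = 0"
          using v n_eq neq by (subst foldr_act_snoc) (auto simp: delta_snoc foldr_act_zero)
        show "act n (foldr act v (delta (P @ [A]))) (R @ [A]) = alpha (last R) A * foldr act v (delta P) R"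
          using act_append[of R0 "foldr act v (delta (P @ [A]))" B A "[]"] v1 v2
          by (simp add: eq n_eq)
      qed (use u cd in auto)
      finally show ?thesis .
    qed
    have "(\<Sum>A\<in>addable l (set P). 1 / schur (insert A (set P)) * res A ^ ?c *
        foldr act (u @ [n] @ v) (delta (P @ [A])) (P @ [A])) =
      foldr act u (\<lambda>R. \<Sum>A\<in>addable l (set P). (1 / schur (insert A (set P)) * res A ^ ?c) *
         (alpha (last R) A * foldr act v (delta P) R)) P"
      unfolding foldr_act_sum by (intro sum.cong refl) (simp only: diag)
    also have "\<dots> = foldr act u (\<lambda>R. 0) P"
    proof (rule foldr_act_cong[OF _ _ PD])
      fix R assume R: "R \<in> paths l (set P)"
      then have "R \<noteq> []" using paths_length[OF R] cd n by auto
      then have B: "last R \<in> removable l (set P)" using paths_last_removable[OF R] by simp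
      have "(\<Sum>A\<in>addable l (set P). (1 / schur (insert A (set P)) * res A ^ ?c) *
          (alpha (last R) A * foldr act v (delta P) R)) =
        foldr act v (delta P) R / schur (set P) * (\<Sum>A\<in>addable l (set P).
          schur (set P) / schur (insert A (set P)) * res A ^ ?c * ((x - 1) * res A / (res A - res (last R))))"
        unfolding sum_distrib_left using schur_nz[OF D] by (intro sum.cong) (auto simp: alpha_def)
      then show "(\<Sum>A\<in>addable l (set P). (1 / schur (insert A (set P)) * res A ^ ?c) *
          (alpha (last R) A * foldr act v (delta P) R)) = 0"
        unfolding schur_ratio_removable_sum[OF D c B] by simp
    qed (use u cd in auto)
    finally show ?thesis by (simp add: foldr_act_zero)
  qed
  have "weighted_trace (Suc n) c (u @ [n] @ v) = (\<Sum>P\<in>all_paths l n. jm_eigen c n P * (x ^ n) ^ ?c *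
     (\<Sum>A\<in>addable l (set P). 1 / schur (insert A (set P)) * res A ^ ?c *
      foldr act (u @ [n] @ v) (delta (P @ [A])) (P @ [A])))"
    unfolding weighted_trace_def sum_all_paths_Suc sum_distrib_left
    by (intro sum.cong refl) (auto simp: all_paths_def jm_eigen_snoc power_mult_distrib)
  then show ?thesis using key by simp
qed

lemma schur_empty: "schur {} = 1"
  by (simp add: schur_def col_stat_def)

lemma weighted_trace_down:
  assumes "set w \<subseteq> {..<m}" "m \<le> n" "\<And>k. m < k \<Longrightarrow> k \<le> n \<Longrightarrow> c k < l"
  shows "weighted_trace n c w = (if \<forall>k. m < k \<and> k \<le> n \<longrightarrow> c k = 0 then weighted_trace m c w else 0)"
  using assms(2,3)
proof (induction n rule: dec_induct)
  case base then show ?case by simp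
next
  case (step n)
  have "set w \<subseteq> {..<n}" using assms(1) step.hyps by auto
  then have "weighted_trace (Suc n) c w = (if c (Suc n) = 0 then weighted_trace n c w else 0)"
    using step by (intro weighted_trace_restrict) auto
  moreover have "weighted_trace n c w = (if \<forall>k. m < k \<and> k \<le> n \<longrightarrow> c k = 0 then weighted_trace m c w else 0)"
    using step by auto
  moreover have "(\<forall>k. m < k \<and> k \<le> Suc n \<longrightarrow> c k = 0) \<longleftrightarrow> c (Suc n) = 0 \<and> (\<forall>k. m < k \<and> k \<le> n \<longrightarrow> c k = 0)"
    using step.hyps by (auto simp: le_Suc_eq)
  ultimately show ?case by auto
qed

lemma weighted_trace_Nil:
  assumes "\<And>k. 1 \<le> k \<Longrightarrow> k \<le> n \<Longrightarrow> c k < l"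
  shows "weighted_trace n c [] = (if \<forall>k\<in>{1..n}. c k = 0 then 1 else 0)"
proof -
  have "weighted_trace 0 c [] = 1"
    by (simp add: weighted_trace_def all_paths_0 schur_empty jm_eigen_def delta_def)
  moreover have "(\<forall>k. 0 < k \<and> k \<le> n \<longrightarrow> c k = 0) \<longleftrightarrow> (\<forall>k\<in>{1..n}. c k = 0)" by auto
  ultimately show ?thesis using weighted_trace_down[of "[]" 0 n c] assms by auto
qed

text \<open>The letter m moves the nodes with entries m and m + 1, so the descent stops at paths of
  length m + 1, where m is the top letter.\<close>

lemma weighted_trace_vanish:
  assumes "1 \<le> m" "m < n" "set u \<subseteq> {..<m}" "set v \<subseteq> {..<m}" "\<And>k. 1 \<le> k \<Longrightarrow> k \<le> n \<Longrightarrow> c k < l"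
  shows "weighted_trace n c (u @ [m] @ v) = 0"
proof -
  have "set (u @ [m] @ v) \<subseteq> {..<Suc m}" using assms(3,4) by auto
  moreover have "weighted_trace (Suc m) c (u @ [m] @ v) = 0"
    using assms by (intro weighted_trace_one_top_letter) auto
  ultimately show ?thesis using weighted_trace_down[of "u @ [m] @ v" "Suc m" n c] assms by auto
qed

end

section \<open>Braid equivalence of words\<close>

text \<open>Generated by the homogeneous relations alone, without the quadratic and the order
  relation. Hence length and set of letters are invariant, and words can be compared independently
  of the parameters.\<close>

inductive braid :: "nat list \<Rightarrow> nat list \<Rightarrow> bool" where
  braid_refl: "braid w w"
| braid_sym: "braid w w' \<Longrightarrow> braid w' w"
| braid_trans [trans]: "braid w w' \<Longrightarrow> braid w' w'' \<Longrightarrow> braid w w''"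
| braid_context: "braid w w' \<Longrightarrow> braid (u @ w @ v) (u @ w' @ v)"
| braid_three: "1 \<le> i \<Longrightarrow> braid [i, i + 1, i] [i + 1, i, i + 1]"
| braid_four: "braid [0, 1, 0, 1] [1, 0, 1, 0]"
| braid_commute: "i + 1 < j \<Longrightarrow> braid [i, j] [j, i]"

lemma braid_append: "braid u u' \<Longrightarrow> braid v v' \<Longrightarrow> braid (u @ v) (u' @ v')"
  using braid_context[of u u' "[]" v] braid_context[of v v' u' "[]"] braid_trans by auto

lemma braid_set: "braid w w' \<Longrightarrow> set w = set w'"
  by (induction rule: braid.induct) auto

lemma braid_length: "braid w w' \<Longrightarrow> length w = length w'"
  by (induction rule: braid.induct) auto

lemma ak_functionalD:
  assumes "ak_functional l n x Q g" "set u \<subseteq> {..<n}" "set v \<subseteq> {..<n}"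
  shows "(\<Sum>i\<le>l. coeff (\<Prod>j<l. [:- Q j, 1:]) i * g (u @ replicate i 0 @ v)) = 0"
    "1 \<le> i \<Longrightarrow> i < n \<Longrightarrow> g (u @ [i, i] @ v) = (x - 1) * g (u @ [i] @ v) + x * g (u @ v)"
    "2 \<le> n \<Longrightarrow> g (u @ [0, 1, 0, 1] @ v) = g (u @ [1, 0, 1, 0] @ v)"
    "1 \<le> i \<Longrightarrow> i + 1 < n \<Longrightarrow> g (u @ [i, i + 1, i] @ v) = g (u @ [i + 1, i, i + 1] @ v)"
    "i + 1 < j \<Longrightarrow> j < n \<Longrightarrow> g (u @ [i, j] @ v) = g (u @ [j, i] @ v)"
  using assms unfolding ak_functional_def by blast+

lemma braid_functional:
  assumes "ak_functional l n x Q g"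
  shows "braid w w' \<Longrightarrow> set w \<subseteq> {..<n} \<Longrightarrow> set u \<subseteq> {..<n} \<Longrightarrow> set v \<subseteq> {..<n} \<Longrightarrow>
    g (u @ w @ v) = g (u @ w' @ v)"
proof (induction arbitrary: u v rule: braid.induct)
  case (braid_sym w w')
  then show ?case using braid_set[OF braid_sym.hyps] by simp
next
  case (braid_trans w w' w'')
  then show ?case using braid_set[OF braid_trans.hyps(1)] by simp
next
  case (braid_context w w' u' v')
  then show ?case using braid_context.IH[of "u @ u'" "v' @ v"] by simp
next
  case (braid_three i)
  then show ?case using ak_functionalD(4)[OF assms, of u v i] by auto
next
  case braid_four
  then show ?case using ak_functionalD(3)[OF assms, of u v] by auto
next
  case (braid_commute i j)
  then show ?case using ak_functionalD(5)[OF assms, of u v i j] by auto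
qed simp

lemma functional_braid_eq:
  assumes "ak_functional l n x Q g" "braid w w'" "set w \<subseteq> {..<n}"
  shows "g w = g w'"
  using braid_functional[OF assms, of "[]" "[]"] by simp

definition words_commute :: "nat list \<Rightarrow> nat list \<Rightarrow> bool" where
  "words_commute u v \<longleftrightarrow> braid (u @ v) (v @ u)"

lemma words_commute_sym: "words_commute u v \<Longrightarrow> words_commute v u"
  by (simp add: words_commute_def braid_sym)

lemma words_commute_Nil [simp]: "words_commute [] v" "words_commute v []"
  by (simp_all add: words_commute_def braid_refl)

lemma words_commute_append:
  assumes "words_commute u w" "words_commute v w"
  shows "words_commute (u @ v) w"
proof -
  have "braid ((u @ v) @ w) (u @ w @ v)"
    using braid_append[OF braid_refl[of u] assms(2)[unfolded words_commute_def]] by simp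
  also have "braid (u @ w @ v) (w @ u @ v)"
    using braid_append[OF assms(1)[unfolded words_commute_def] braid_refl[of v]] by simp
  finally show ?thesis by (simp add: words_commute_def)
qed

lemma words_commute_letters: "(\<And>i. i \<in> set u \<Longrightarrow> words_commute [i] w) \<Longrightarrow> words_commute u w"
proof (induction u)
  case (Cons i u)
  then show ?case using words_commute_append[of "[i]" w u] by simp
qed simp

lemma words_commute_far_letters: "i + 1 < j \<Longrightarrow> words_commute [i] [j]"
  using braid_commute by (simp add: words_commute_def)

lemma words_commute_power: "words_commute u w \<Longrightarrow> words_commute (concat (replicate k u)) w"
  by (induction k) (auto intro: words_commute_append)

lemma jm_word_less: "a \<in> set (jm_word k) \<Longrightarrow> 1 \<le> k \<Longrightarrow> a < k"
  by (auto simp: jm_word_def)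

lemma jm_commute_high:
  assumes "k < i" "1 \<le> k"
  shows "words_commute (jm_word k) [i]"
proof (rule words_commute_letters, rule words_commute_far_letters)
  fix a assume "a \<in> set (jm_word k)"
  then show "a + 1 < i" using jm_word_less[of a k] assms by linarith
qed

text \<open>For k = i + 2 the letter i passes the prefix i + 1, i and becomes i + 1, commutes with
  \<open>jm_word i\<close>, and turns back into i at the suffix. Larger k add only letters far from
  i. For i = 0 the base case is the relation of length four.\<close>

lemma jm_commute_low: "i + 2 \<le> k \<Longrightarrow> words_commute [i] (jm_word k)"
proof (induction k rule: dec_induct)
  case base
  show ?case
  proof (cases "i = 0")
    case True
    then show ?thesis using braid_four by (simp add: words_commute_def jm_word_def numeral_2_eq_2)
  next
    case False
    let ?W = "jm_word i"
    have J: "jm_word (i + 2) = [i + 1, i] @ ?W @ [i, i + 1]"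
      using False by (simp add: jm_word_Suc)
    have W: "words_commute ?W [i + 1]" using False by (intro jm_commute_high) auto
    have "braid ([i] @ jm_word (i + 2)) ([i, i + 1, i] @ ?W @ [i, i + 1])"
      unfolding J by (simp add: braid_refl)
    also have "braid \<dots> ([i + 1, i, i + 1] @ ?W @ [i, i + 1])"
      using False by (intro braid_append braid_three braid_refl) auto
    also have "braid \<dots> (([i + 1, i] @ ?W) @ [i + 1, i, i + 1])"
      using braid_append[OF braid_refl[of "[i + 1, i]"]
          braid_append[OF W[THEN words_commute_sym, unfolded words_commute_def] braid_refl[of "[i, i + 1]"]]]
      by simp
    also have "braid \<dots> (([i + 1, i] @ ?W) @ [i, i + 1, i])"
      using False by (intro braid_append braid_refl braid_sym[OF braid_three]) auto
    finally show ?thesis unfolding words_commute_def J by simp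
  qed
next
  case (step k)
  have "words_commute [i] [k]" using step by (intro words_commute_far_letters) auto
  then have "words_commute ([k] @ jm_word k @ [k]) [i]"
    using step by (intro words_commute_append) (auto intro: words_commute_sym)
  then show ?case using step by (simp add: jm_word_Suc words_commute_sym)
qed

lemma jm_commute:
  assumes "1 \<le> i" "i < k"
  shows "words_commute (jm_word i) (jm_word k)"
proof (rule words_commute_letters, rule jm_commute_low)
  fix a assume "a \<in> set (jm_word i)"
  then show "a + 2 \<le> k" using jm_word_less[of a i] assms by linarith
qed

section \<open>Canonical words of permutations\<close>

lemma word_perm_Nil [simp]: "word_perm [] = id"
  by (simp add: word_perm_def)

lemma word_perm_Cons: "word_perm (k # ks) = transpose k (Suc k) \<circ> word_perm ks"
  by (simp add: word_perm_def)

lemma word_perm_append: "word_perm (u @ v) = word_perm u \<circ> word_perm v"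
  by (induction u) (auto simp: word_perm_Cons o_assoc)

lemma word_perm_bij: "bij (word_perm ks)"
proof (induction ks)
  case (Cons k ks)
  then show ?case unfolding word_perm_Cons by (intro bij_comp bij_transpose)
qed (unfold word_perm_Nil, rule bij_id)

lemma word_perm_fix: "(\<And>k. k \<in> set ks \<Longrightarrow> i \<noteq> k \<and> i \<noteq> Suc k) \<Longrightarrow> word_perm ks i = i"
  by (induction ks) (auto simp: word_perm_Cons)

lemma word_perm_permutes: "set ks \<subseteq> {1..<n} \<Longrightarrow> word_perm ks permutes {1..n}"
proof (induction ks)
  case (Cons k ks)
  then show ?case unfolding word_perm_Cons
    by (intro permutes_compose permutes_swap_id) auto
qed (simp add: permutes_id)

lemma braid_word_perm: "braid w w' \<Longrightarrow> 0 \<notin> set w \<Longrightarrow> word_perm w = word_perm w'"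
proof (induction rule: braid.induct)
  case (braid_sym w w')
  then show ?case using braid_set[OF braid_sym.hyps] by simp
next
  case (braid_trans w w' w'')
  then show ?case using braid_set[OF braid_trans.hyps(1)] by simp
next
  case (braid_context w w' u v)
  then show ?case by (simp add: word_perm_append)
next
  case (braid_three i)
  then show ?case by (auto simp: word_perm_Cons fun_eq_iff transpose_def)
next
  case (braid_commute i j)
  then show ?case by (auto simp: word_perm_Cons fun_eq_iff transpose_def)
qed auto

text \<open>Normal forms along the tower of symmetric groups: the descending runs
  \<open>rev [k..<m + 2]\<close> represent the cosets at each level, with k = m + 2 for the empty
  run. The index m bounds the letters, so these words describe permutations of m + 1 points.\<close>

fun canonical :: "nat \<Rightarrow> nat list set" where
  "canonical 0 = {[]}"
| "canonical (Suc m) = {C @ rev [k..<m + 2] | C k. C \<in> canonical m \<and> 1 \<le> k \<and> k \<le> m + 2}"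

lemma canonical_letters: "C \<in> canonical m \<Longrightarrow> set C \<subseteq> {1..m}"
  by (induction m arbitrary: C) fastforce+

lemma canonical_split:
  assumes "C \<in> canonical m"
  obtains C' k where "C = C' @ rev [k..<Suc m]" "set C' \<subseteq> {1..<m}" "1 \<le> k" "k \<le> Suc m"
proof (cases m)
  case 0
  then show ?thesis using that[of "[]" 1] assms by auto
next
  case (Suc m')
  then show ?thesis using assms that canonical_letters[of _ m'] by fastforce
qed

text \<open>A certificate that a word is not reduced (\<open>square_not_reduced\<close>), and at the
  same time the place where the quadratic relation can shorten it
  (\<open>vanish_on_words\<close>).\<close>

definition has_square :: "nat list \<Rightarrow> bool" where
  "has_square w \<longleftrightarrow> (\<exists>u i v. braid w (u @ [i, i] @ v))"

lemma has_square_braid: "braid w w' \<Longrightarrow> has_square w' \<Longrightarrow> has_square w"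
  unfolding has_square_def using braid_trans by blast

lemma has_square_context: "has_square w \<Longrightarrow> has_square (u @ w @ v)"
proof -
  assume "has_square w"
  then obtain a i b where "braid w (a @ [i, i] @ b)" by (auto simp: has_square_def)
  then have "braid (u @ w @ v) ((u @ a) @ [i, i] @ (b @ v))" using braid_context[of w "a @ [i, i] @ b" u v] by simp
  then show ?thesis unfolding has_square_def by blast
qed

text \<open>Matsumoto's theorem in disguise: a word with two top letters either contains a square up to braid
  moves or can be rewritten with one top letter less.\<close>

lemma canonical_form:
  assumes "set w \<subseteq> {1..m}"
  shows "has_square w \<or> (\<exists>C\<in>canonical m. braid w C)"
  using assms
proof (induction m arbitrary: w)
  case 0
  then show ?case using braid_refl by auto
next
  case (Suc m)
  let ?M = "Suc m"
  have top: "words_commute [?M] C'" if "set C' \<subseteq> {1..<m}" for C'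
    by (rule words_commute_sym, rule words_commute_letters, rule words_commute_far_letters) (use that in auto)
  have one_top: "has_square w \<or> (\<exists>w'. set w' \<subseteq> {1..m} \<and> braid w w') \<or>
      (\<exists>u v. set u \<subseteq> {1..m} \<and> set v \<subseteq> {1..m} \<and> braid w (u @ [?M] @ v))" if "set w \<subseteq> {1..?M}" for w
    using that
  proof (induction w)
    case Nil
    then show ?case using braid_refl by force
  next
    case (Cons a w)
    have cons: "braid (a # w) (a # w')" if "braid w w'" for w'
      using braid_context[OF that, of "[a]" "[]"] by simp
    have a: "a \<in> {1..m} \<or> a = ?M" using Cons.prems by auto
    consider "has_square w" | w' where "set w' \<subseteq> {1..m}" "braid w w'"
      | u v where "set u \<subseteq> {1..m}" "set v \<subseteq> {1..m}" "braid w (u @ [?M] @ v)"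
      using Cons by auto
    then show ?case
    proof cases
      case 1
      then show ?thesis using has_square_context[of w "[a]" "[]"] by simp
    next
      case 2
      show ?thesis
      proof (cases "a = ?M")
        case True
        then have "braid (a # w) ([] @ [?M] @ w')" using cons[OF 2(2)] by simp
        moreover have "set [] \<subseteq> {1..m}" by simp
        ultimately show ?thesis using 2(1) by blast
      next
        case False
        then have "set (a # w') \<subseteq> {1..m}" using a 2(1) by auto
        then show ?thesis using cons[OF 2(2)] by blast
      qed
    next
      case 3
      show ?thesis
      proof (cases "a = ?M")
        case False
        then have "set (a # u) \<subseteq> {1..m}" using a 3(1) by auto
        moreover have "braid (a # w) ((a # u) @ [?M] @ v)" using cons[OF 3(3)] by simp
        ultimately show ?thesis using 3(2) by blast
      next
        case True
        have b: "braid (a # w) ([?M] @ u @ [?M] @ v)" using cons[OF 3(3)] True by simp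
        show ?thesis
        proof (cases "has_square u")
          case True
          then show ?thesis using has_square_braid[OF b] has_square_context[of u "[?M]" "[?M] @ v"] by simp
        next
          case False
          then obtain C where C: "C \<in> canonical m" "braid u C" using Suc.IH[OF 3(1)] by auto
          from C(1) obtain C' k where C': "C = C' @ rev [k..<?M]" "set C' \<subseteq> {1..<m}" "1 \<le> k" "k \<le> ?M"
            by (rule canonical_split)
          note b
          also have "braid ([?M] @ u @ [?M] @ v) ([?M] @ (C' @ rev [k..<?M]) @ [?M] @ v)"
            using braid_context[OF C(2), of "[?M]" "[?M] @ v"] C'(1) by simp
          also have "braid \<dots> (C' @ [?M] @ rev [k..<?M] @ [?M] @ v)"
            using braid_append[OF top[OF C'(2), unfolded words_commute_def] braid_refl[of "rev [k..<?M] @ [?M] @ v"]] by simp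
          finally have b2: "braid (a # w) (C' @ [?M] @ rev [k..<?M] @ [?M] @ v)" .
          \<comment> \<open>Between the two top letters only a descending run is left. If it is
            empty they form a square; otherwise it begins with m, and the braid relation leaves one
            top letter.\<close>
          show ?thesis
          proof (cases "k = ?M")
            case True
            then have "braid (a # w) (C' @ [?M, ?M] @ v)" using b2 by simp
            then show ?thesis unfolding has_square_def by blast
          next
            case False
            then have r: "rev [k..<?M] = m # rev [k..<m]" and m1: "1 \<le> m" using C'(3,4) by auto
            have "words_commute (rev [k..<m]) [?M]"
              by (rule words_commute_letters, rule words_commute_far_letters) auto
            then have e: "braid (rev [k..<m] @ [?M]) ([?M] @ rev [k..<m])" by (simp add: words_commute_def)
            have "braid (C' @ [?M] @ rev [k..<?M] @ [?M] @ v) ((C' @ [?M, m]) @ ([?M] @ rev [k..<m]) @ v)"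
              using braid_context[OF e, of "C' @ [?M, m]" v] unfolding r by simp
            also have "braid \<dots> (C' @ [m, ?M, m] @ rev [k..<m] @ v)"
              using braid_context[OF braid_sym[OF braid_three[OF m1]], of C' "rev [k..<m] @ v"] by simp
            finally have "braid (a # w) ((C' @ [m]) @ [?M] @ (m # rev [k..<m] @ v))"
              using braid_trans[OF b2] by simp
            moreover have "set (C' @ [m]) \<subseteq> {1..m}" "set (m # rev [k..<m] @ v) \<subseteq> {1..m}"
              using C'(2,3) m1 3(2) by auto
            ultimately show ?thesis by blast
          qed
        qed
      qed
    qed
  qed
  have sub: "C @ rev [k..<m + 2] \<in> canonical ?M" if "C \<in> canonical m" "1 \<le> k" "k \<le> m + 2" for C k
    using that by auto
  consider "has_square w" | w' where "set w' \<subseteq> {1..m}" "braid w w'"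
      | u v where "set u \<subseteq> {1..m}" "set v \<subseteq> {1..m}" "braid w (u @ [?M] @ v)"
    using one_top[OF Suc.prems] by blast
  then show ?case
  proof cases
    case 2
    show ?thesis
    proof (cases "has_square w'")
      case True then show ?thesis using has_square_braid[OF 2(2)] by blast
    next
      case False
      then obtain C where C: "C \<in> canonical m" "braid w' C" using Suc.IH[OF 2(1)] by blast
      have "C \<in> canonical ?M" using sub[OF C(1), of "m + 2"] by simp
      moreover have "braid w C" using braid_trans[OF 2(2) C(2)] .
      ultimately show ?thesis by blast
    qed
  next
    case 3
    show ?thesis
    proof (cases "has_square v")
      case True
      then show ?thesis using has_square_braid[OF 3(3)] has_square_context[of v "u @ [?M]" "[]"] by simp
    next
      case False
      then obtain C where C: "C \<in> canonical m" "braid v C" using Suc.IH[OF 3(2)] by auto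
      from C(1) obtain C' k where C': "C = C' @ rev [k..<?M]" "set C' \<subseteq> {1..<m}" "1 \<le> k" "k \<le> ?M"
        by (rule canonical_split)
      note 3(3)
      also have "braid (u @ [?M] @ v) ((u @ [?M]) @ (C' @ rev [k..<?M]) @ [])"
        using braid_context[OF C(2), of "u @ [?M]" "[]"] C'(1) by simp
      also have "braid \<dots> (u @ (C' @ [?M]) @ rev [k..<?M])"
        using braid_context[OF top[OF C'(2), unfolded words_commute_def], of u "rev [k..<?M]"] by simp
      also have "u @ (C' @ [?M]) @ rev [k..<?M] = (u @ C') @ rev [k..<m + 2]" using C'(4) by simp
      finally have b: "braid w ((u @ C') @ rev [k..<m + 2])" .
      have uC: "set (u @ C') \<subseteq> {1..m}" using 3(1) C'(2) by auto
      show ?thesis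
      proof (cases "has_square (u @ C')")
        case True
        then show ?thesis using has_square_braid[OF b] has_square_context[of "u @ C'" "[]" "rev [k..<m + 2]"] by simp
      next
        case False
        then obtain C2 where C2: "C2 \<in> canonical m" "braid (u @ C') C2" using Suc.IH[OF uC] by auto
        have "braid w (C2 @ rev [k..<m + 2])"
          by (rule braid_trans[OF b braid_append[OF C2(2) braid_refl]])
        moreover have "C2 @ rev [k..<m + 2] \<in> canonical ?M" using sub[OF C2(1) C'(3)] C'(4) by simp
        ultimately show ?thesis by blast
      qed
    qed
  qed auto
qed

lemma word_perm_descending: "k \<le> m \<Longrightarrow> word_perm (rev [k..<m]) k = m"
proof (induction m rule: dec_induct)
  case (step m)
  then show ?case by (simp add: word_perm_Cons)
qed simp

text \<open>The start k of the last run is the preimage of m + 2, since the run carries k to m + 2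
  and the letters before it fix m + 2. Cancelling the run reduces to the previous level.\<close>

lemma canonical_inj: "C \<in> canonical m \<Longrightarrow> C' \<in> canonical m \<Longrightarrow> word_perm C = word_perm C' \<Longrightarrow> C = C'"
proof (induction m arbitrary: C C')
  case (Suc m)
  obtain A k where C: "C = A @ rev [k..<m + 2]" "A \<in> canonical m" "1 \<le> k" "k \<le> m + 2" using Suc.prems(1) by auto
  obtain A' k' where C': "C' = A' @ rev [k'..<m + 2]" "A' \<in> canonical m" "1 \<le> k'" "k' \<le> m + 2" using Suc.prems(2) by auto
  have fixed: "word_perm B (m + 2) = m + 2" if "B \<in> canonical m" for B
    using canonical_letters[OF that] by (intro word_perm_fix) auto
  have "word_perm C k = m + 2" "word_perm C' k' = m + 2"
    unfolding C C' word_perm_append o_apply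
    using word_perm_descending C(4) C'(4) fixed[OF C(2)] fixed[OF C'(2)] by (auto simp del: upt_Suc)
  then have "k = k'" using Suc.prems(3) bij_is_inj[OF word_perm_bij] by (metis injD)
  have "word_perm A = word_perm A'"
  proof
    fix i
    obtain j where j: "i = word_perm (rev [k..<m + 2]) j"
      using bij_is_surj[OF word_perm_bij] by (metis surjD)
    have "word_perm C j = word_perm C' j" using Suc.prems(3) by simp
    then show "word_perm A i = word_perm A' i"
      unfolding C(1) C'(1) \<open>k = k'\<close>[symmetric] word_perm_append o_apply j .
  qed
  then show ?case using Suc.IH[OF C(2) C'(2)] C(1) C'(1) \<open>k = k'\<close> by simp
qed simp

text \<open>The first letter of the last nonempty run exceeds every other letter of the word. This
  is the shape to which \<open>weighted_trace_vanish\<close> applies.\<close>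

lemma canonical_single_top:
  assumes "C \<in> canonical m" "C \<noteq> []"
  shows "\<exists>p u v. 1 \<le> p \<and> p \<le> m \<and> C = u @ [p] @ v \<and> set u \<subseteq> {1..<p} \<and> set v \<subseteq> {1..<p}"
  using assms
proof (induction m arbitrary: C)
  case (Suc m)
  obtain A k where C: "C = A @ rev [k..<m + 2]" "A \<in> canonical m" "1 \<le> k" "k \<le> m + 2" using Suc.prems(1) by auto
  show ?case
  proof (cases "k = m + 2")
    case True
    then have "C = A" using C by simp
    then show ?thesis using Suc.IH[OF C(2)] Suc.prems by fastforce
  next
    case False
    then have "C = A @ [Suc m] @ rev [k..<Suc m]" using C by simp
    moreover have "set A \<subseteq> {1..<Suc m}" using canonical_letters[OF C(2)] by auto
    moreover have "set (rev [k..<Suc m]) \<subseteq> {1..<Suc m}" using C(3) by auto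
    ultimately show ?thesis by (intro exI[of _ "Suc m"] exI[of _ A] exI[of _ "rev [k..<Suc m]"]) auto
  qed
qed simp


section \<open>Reduced expressions\<close>

lemma permutation_has_word: "p permutes {1..n} \<Longrightarrow> \<exists>ks. set ks \<subseteq> {1..<n} \<and> word_perm ks = p"
proof (induction n arbitrary: p)
  case 0
  then show ?case by (intro exI[of _ "[]"]) (simp add: permutes_empty id_def[symmetric])
next
  case (Suc n)
  have "Suc n \<in> p ` {1..Suc n}" using permutes_image[OF Suc.prems] by simp
  then obtain k where k: "k \<in> {1..Suc n}" "p k = Suc n" by auto
  define q where "q = word_perm (rev [k..<Suc n])"
  have q: "q permutes {1..Suc n}" unfolding q_def using k by (intro word_perm_permutes) auto
  have qk: "q k = Suc n" unfolding q_def using k by (intro word_perm_descending) auto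
  have p': "p \<circ> inv_into UNIV q permutes {1..Suc n}"
    using Suc.prems q by (intro permutes_compose permutes_inv)
  have "(p \<circ> inv_into UNIV q) (Suc n) = Suc n"
    using permutes_inverses(2)[OF q, of k] qk k by simp
  then have "p \<circ> inv_into UNIV q permutes {1..n}"
    using p' by (intro permutes_superset[OF p']) (auto simp: le_Suc_eq)
  then obtain ks where ks: "set ks \<subseteq> {1..<n}" "word_perm ks = p \<circ> inv_into UNIV q" using Suc.IH by blast
  have "word_perm (ks @ rev [k..<Suc n]) = p"
    unfolding word_perm_append ks(2) q_def[symmetric] comp_assoc permutes_inv_o(2)[OF q] by simp
  moreover have "set (ks @ rev [k..<Suc n]) \<subseteq> {1..<Suc n}" using ks(1) k by auto
  ultimately show ?case by blast
qed

lemma reduced_expr_exists: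
  assumes "set ks \<subseteq> {1..<n}"
  shows "\<exists>ks'. reduced_expr n (word_perm ks) ks'"
proof -
  let ?S = "\<lambda>ks'. set ks' \<subseteq> {1..<n} \<and> word_perm ks' = word_perm ks"
  obtain ks' where "?S ks'" "\<And>ks''. ?S ks'' \<Longrightarrow> length ks' \<le> length ks''"
    using ex_has_least_nat[of ?S ks length] assms by auto
  then show ?thesis by (auto simp: reduced_expr_def)
qed

lemma square_not_reduced:
  assumes "has_square ks" "set ks \<subseteq> {1..<n}"
  shows "\<not> reduced_expr n (word_perm ks) ks"
proof -
  obtain u i v where b: "braid ks (u @ [i, i] @ v)" using assms by (auto simp: has_square_def)
  have s: "set (u @ [i, i] @ v) \<subseteq> {1..<n}" using braid_set[OF b] assms by simp
  have "0 \<notin> set ks" using assms by auto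
  then have "word_perm ks = word_perm (u @ [i, i] @ v)" using braid_word_perm[OF b] by simp
  also have "\<dots> = word_perm (u @ v)"
    by (simp add: word_perm_append word_perm_Cons fun_eq_iff)
  finally have "word_perm (u @ v) = word_perm ks" ..
  moreover have "set (u @ v) \<subseteq> {1..<n}" using s by simp
  moreover have "length (u @ v) < length ks" using braid_length[OF b] by simp
  ultimately show ?thesis unfolding reduced_expr_def by (meson not_less)
qed

lemma reduced_canonical:
  assumes "reduced_expr n w ks" "1 \<le> n"
  shows "\<exists>C\<in>canonical (n - 1). braid ks C"
proof -
  have ks: "set ks \<subseteq> {1..<n}" "word_perm ks = w" using assms(1) by (auto simp: reduced_expr_def)
  then have "\<not> has_square ks" using square_not_reduced[OF _ ks(1)] assms(1) by auto
  moreover have "set ks \<subseteq> {1..n - 1}" by (rule subset_trans[OF ks(1)]) auto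
  ultimately show ?thesis using canonical_form by blast
qed

text \<open>Two words without squares reach canonical words, and these coincide as soon as the
  permutations do. In particular the arbitrary choice of a reduced expression in the definition of
  T_w can be controlled.\<close>

lemma reduced_or_square:
  assumes "reduced_expr n w ks0" "1 \<le> n" "set ks \<subseteq> {1..<n}" "word_perm ks = w"
  shows "braid ks ks0 \<or> has_square ks"
proof (cases "has_square ks")
  case False
  have "set ks \<subseteq> {1..n - 1}" by (rule subset_trans[OF assms(3)]) auto
  then obtain C where C: "C \<in> canonical (n - 1)" "braid ks C" using canonical_form False by blast
  obtain C0 where C0: "C0 \<in> canonical (n - 1)" "braid ks0 C0" using reduced_canonical[OF assms(1,2)] by blast
  have ks0: "set ks0 \<subseteq> {1..<n}" "word_perm ks0 = w" using assms(1) by (auto simp: reduced_expr_def)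
  have z: "0 \<notin> set ks" "0 \<notin> set ks0" using assms(3) ks0(1) by auto
  have "word_perm C = word_perm C0"
    using braid_word_perm[OF C(2) z(1)] braid_word_perm[OF C0(2) z(2)] assms(4) ks0(2) by simp
  then have "C = C0" using canonical_inj[OF C(1) C0(1)] by simp
  then show ?thesis using braid_trans[OF C(2) braid_sym[OF C0(2)[folded \<open>C = C0\<close>]]] by simp
qed simp

section \<open>Functionals are determined by their values on the Ariki-Koike basis\<close>

abbreviation wpow :: "nat list \<Rightarrow> nat \<Rightarrow> nat list" where
  "wpow w k \<equiv> concat (replicate k w)"

lemma wpow_add: "wpow w (a + b) = wpow w a @ wpow w b"
  by (simp add: replicate_add)

lemma set_wpow: "set w \<subseteq> A \<Longrightarrow> set (wpow w k) \<subseteq> A"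
  by auto

lemma jm_powers_split:
  assumes "1 \<le> i" "i < n"
  shows "jm_powers c n = jm_powers c (i - 1) @ wpow (jm_word i) (c i) @ wpow (jm_word (Suc i)) (c (Suc i)) @
     concat (map (\<lambda>k. wpow (jm_word k) (c k)) [i + 2..<Suc n])"
proof -
  have "[1..<Suc n] = [1..<i] @ [i, Suc i] @ [i + 2..<Suc n]"
    using assms upt_add_eq_append[of 1 i "Suc n - i"] upt_conv_Cons[of i "Suc n"] upt_conv_Cons[of "Suc i" "Suc n"]
    by simp
  then show ?thesis using assms by (simp add: jm_powers_def)
qed

lemma jm_word_letters_less: "1 \<le> k \<Longrightarrow> k \<le> n \<Longrightarrow> set (jm_word k) \<subseteq> {..<n}"
  using jm_word_less by fastforce

lemma jm_concat_letters:
  "(\<And>k. k \<in> set js \<Longrightarrow> 1 \<le> k \<and> k \<le> n) \<Longrightarrow>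
    set (concat (map (\<lambda>k. wpow (jm_word k) (c k)) js)) \<subseteq> {..<n}"
proof (induction js)
  case (Cons j js)
  have "set (wpow (jm_word j) (c j)) \<subseteq> {..<n}"
    using Cons.prems[of j] by (intro set_wpow jm_word_letters_less) auto
  then show ?case using Cons by simp
qed simp

lemma jm_powers_letters: "m \<le> n \<Longrightarrow> set (jm_powers c m) \<subseteq> {..<n}"
  unfolding jm_powers_def by (rule jm_concat_letters) auto

locale functional =
  fixes l n :: nat and x :: "'a::field" and Q :: "nat \<Rightarrow> 'a" and g :: "nat list \<Rightarrow> 'a"
  assumes functional: "ak_functional l n x Q g" and x_ne: "x \<noteq> 0"
begin

lemma braid_eq: "braid w w' \<Longrightarrow> set w \<subseteq> {..<n} \<Longrightarrow> g w = g w'"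
  using functional_braid_eq[OF functional] .

text \<open>With J_i for \<open>jm_word i\<close>: expand the square of T_i in J_(i+1) T_i = T_i J_i
  T_i T_i and in T_i J_(i+1) = T_i T_i J_i T_i.\<close>

lemma push_jm:
  assumes "1 \<le> i" "i < n" "set u \<subseteq> {..<n}" "set v \<subseteq> {..<n}"
  shows "g (u @ [i] @ jm_word i @ v) = (g (u @ jm_word (Suc i) @ [i] @ v) - (x - 1) * g (u @ jm_word (Suc i) @ v)) / x"
    "g (u @ [i] @ jm_word (Suc i) @ v) = (x - 1) * g (u @ jm_word (Suc i) @ v) + x * g (u @ jm_word i @ [i] @ v)"
proof -
  have J: "jm_word (Suc i) = [i] @ jm_word i @ [i]" using assms(1) by (rule jm_word_Suc)
  have Ji: "set (jm_word i) \<subseteq> {..<n}" using assms by (intro jm_word_letters_less) auto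
  show "g (u @ [i] @ jm_word (Suc i) @ v) = (x - 1) * g (u @ jm_word (Suc i) @ v) + x * g (u @ jm_word i @ [i] @ v)"
    using ak_functionalD(2)[OF functional assms(3), of "jm_word i @ [i] @ v" i] assms Ji unfolding J by simp
  have "g (u @ jm_word (Suc i) @ [i] @ v) = (x - 1) * g (u @ jm_word (Suc i) @ v) + x * g (u @ [i] @ jm_word i @ v)"
    using ak_functionalD(2)[OF functional _ assms(4), of "u @ [i] @ jm_word i" i] assms Ji unfolding J by simp
  then show "g (u @ [i] @ jm_word i @ v) = (g (u @ jm_word (Suc i) @ [i] @ v) - (x - 1) * g (u @ jm_word (Suc i) @ v)) / x"
    using x_ne by simp
qed

context
  fixes i :: nat
  assumes i: "1 \<le> i" "i < n"
begin

lemma jm_i_letters: "set (jm_word i) \<subseteq> {..<n}" "set (jm_word (Suc i)) \<subseteq> {..<n}"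
  using i jm_word_letters_less[of i n] jm_word_letters_less[of "Suc i" n] by simp_all

lemma jm_pair_commute: "words_commute (wpow (jm_word i) a) (wpow (jm_word (Suc i)) b)"
  using jm_commute[of i "Suc i"] i by (metis lessI words_commute_power words_commute_sym)

lemma jm_sort:
  assumes "set u \<subseteq> {..<n}" "set v \<subseteq> {..<n}"
  shows "g (u @ wpow (jm_word (Suc i)) b @ wpow (jm_word i) a @ v) = g (u @ wpow (jm_word i) a @ wpow (jm_word (Suc i)) b @ v)"
proof (rule braid_eq)
  show "braid (u @ wpow (jm_word (Suc i)) b @ wpow (jm_word i) a @ v) (u @ wpow (jm_word i) a @ wpow (jm_word (Suc i)) b @ v)"
    using braid_context[OF words_commute_sym[OF jm_pair_commute[of a b], unfolded words_commute_def], of u v] by simp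
  show "set (u @ wpow (jm_word (Suc i)) b @ wpow (jm_word i) a @ v) \<subseteq> {..<n}"
    using assms set_wpow[OF jm_i_letters(1), of a] set_wpow[OF jm_i_letters(2), of b] by simp
qed

text \<open>Each passage of the letter i turns one \<open>jm_word i\<close> into
  \<open>jm_word (Suc i)\<close>, and every correction term is a product of powers of the two with
  total exponent d. The hypotheses list these terms and the final one.\<close>

lemma push_first_power:
  assumes "set u \<subseteq> {..<n}" "set v \<subseteq> {..<n}"
    and "\<And>p. p \<le> d \<Longrightarrow> g (u @ wpow (jm_word i) p @ wpow (jm_word (Suc i)) (d - p) @ v) = 0"
    and "g (u @ wpow (jm_word (Suc i)) d @ [i] @ v) = 0"
  shows "g (u @ [i] @ wpow (jm_word i) d @ v) = 0"
  using assms
proof (induction d arbitrary: u)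
  case (Suc d)
  let ?A = "jm_word i" and ?B = "jm_word (Suc i)"
  have v': "set (wpow ?A d @ v) \<subseteq> {..<n}" using Suc.prems(2) set_wpow[OF jm_i_letters(1), of d] by simp
  have u': "set (u @ ?B) \<subseteq> {..<n}" using Suc.prems(1) jm_i_letters(2) by simp
  have "g ((u @ ?B) @ [i] @ wpow ?A d @ v) = 0"
  proof (rule Suc.IH[OF u' Suc.prems(2)])
    fix p assume p: "p \<le> d"
    have "g ((u @ ?B) @ wpow ?A p @ wpow ?B (d - p) @ v) = g (u @ wpow ?A p @ wpow ?B (Suc d - p) @ v)"
      using jm_sort[OF Suc.prems(1), of "wpow ?B (d - p) @ v" 1 p] Suc.prems(2) p
        set_wpow[OF jm_i_letters(2), of "d - p"] by (simp add: Suc_diff_le)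
    then show "g ((u @ ?B) @ wpow ?A p @ wpow ?B (d - p) @ v) = 0" using Suc.prems(3)[of p] p by simp
  next
    show "g ((u @ ?B) @ wpow ?B d @ [i] @ v) = 0" using Suc.prems(4) by simp
  qed
  moreover have "g (u @ ?B @ wpow ?A d @ v) = 0"
    using jm_sort[OF Suc.prems(1,2), of 1 d] Suc.prems(3)[of d] by simp
  ultimately show ?case using push_jm(1)[OF i Suc.prems(1) v'] by simp
qed simp

lemma push_second_power:
  assumes "set u \<subseteq> {..<n}" "set v \<subseteq> {..<n}"
    and "\<And>p. p \<le> d \<Longrightarrow> g (u @ wpow (jm_word i) p @ wpow (jm_word (Suc i)) (d - p) @ v) = 0"
    and "g (u @ wpow (jm_word i) d @ [i] @ v) = 0"
  shows "g (u @ [i] @ wpow (jm_word (Suc i)) d @ v) = 0"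
  using assms
proof (induction d arbitrary: u)
  case (Suc d)
  let ?A = "jm_word i" and ?B = "jm_word (Suc i)"
  have v': "set (wpow ?B d @ v) \<subseteq> {..<n}" using Suc.prems(2) set_wpow[OF jm_i_letters(2), of d] by simp
  have u': "set (u @ ?A) \<subseteq> {..<n}" using Suc.prems(1) jm_i_letters(1) by simp
  have "g ((u @ ?A) @ [i] @ wpow ?B d @ v) = 0"
  proof (rule Suc.IH[OF u' Suc.prems(2)])
    fix p assume p: "p \<le> d"
    show "g ((u @ ?A) @ wpow ?A p @ wpow ?B (d - p) @ v) = 0" using Suc.prems(3)[of "Suc p"] p by simp
  next
    show "g ((u @ ?A) @ wpow ?A d @ [i] @ v) = 0" using Suc.prems(4) by simp
  qed
  moreover have "g (u @ ?B @ wpow ?B d @ v) = 0"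
    using Suc.prems(3)[of 0] by simp
  ultimately show ?case using push_jm(2)[OF i Suc.prems(1) v'] by simp
qed simp

text \<open>Pulling out the symmetric part \<open>(L\<^sub>i L\<^bsub>i+1\<^esub>)\<^sup>m\<close> first keeps all exponents at most \<open>max a b\<close> in
  \<open>push_letter\<close>.\<close>

lemma symmetric_commute: "words_commute [i] (wpow (jm_word i) m @ wpow (jm_word (Suc i)) m)"
proof (induction m)
  case (Suc m)
  let ?A = "jm_word i" and ?B = "jm_word (Suc i)"
  have J: "?B = [i] @ ?A @ [i]" using i(1) by (rule jm_word_Suc)
  have AB: "braid (?B @ ?A) (?A @ ?B)" using jm_pair_commute[of 1 1] by (simp add: words_commute_def braid_sym)
  have "words_commute [i] (?A @ ?B)"
  proof -
    have "braid ([i] @ ?A @ ?B) (?B @ ?A @ [i])" unfolding J by (simp add: braid_refl)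
    also have "braid (?B @ ?A @ [i]) ((?A @ ?B) @ [i])" using braid_context[OF AB, of "[]" "[i]"] by simp
    finally show ?thesis by (simp add: words_commute_def)
  qed
  with Suc have c: "words_commute ((?A @ ?B) @ (wpow ?A m @ wpow ?B m)) [i]"
    by (rule words_commute_append[OF words_commute_sym words_commute_sym, rotated])
  have b: "braid (wpow ?A (Suc m) @ wpow ?B (Suc m)) ((?A @ ?B) @ (wpow ?A m @ wpow ?B m))"
  proof -
    have "braid (wpow ?A m @ ?B) (?B @ wpow ?A m)" using jm_pair_commute[of m 1] by (simp add: words_commute_def)
    from braid_context[OF this, of ?A "wpow ?B m"] show ?thesis by simp
  qed
  have "braid ([i] @ (wpow ?A (Suc m) @ wpow ?B (Suc m))) ([i] @ ((?A @ ?B) @ (wpow ?A m @ wpow ?B m)))"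
    by (rule braid_append[OF braid_refl b])
  also have "braid \<dots> (((?A @ ?B) @ (wpow ?A m @ wpow ?B m)) @ [i])"
    using c unfolding words_commute_def by (rule braid_sym)
  also have "braid \<dots> ((wpow ?A (Suc m) @ wpow ?B (Suc m)) @ [i])"
    by (rule braid_append[OF braid_sym[OF b] braid_refl])
  finally show ?case unfolding words_commute_def .
qed simp

text \<open>With the symmetric part of exponent m = min a b removed, a power of one
  \<open>jm_word\<close> with exponent |a - b| remains. Distributing it over both factors gives
  exponents at most m + |a - b| = max a b, which stays below l when a and b do.\<close>

lemma push_letter:
  assumes u: "set u \<subseteq> {..<n}" and v: "set v \<subseteq> {..<n}"
    and "\<And>p q. p \<le> max a b \<Longrightarrow> q \<le> max a b \<Longrightarrow> g (u @ wpow (jm_word i) p @ wpow (jm_word (Suc i)) q @ v) = 0"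
    and "\<And>p q. p \<le> max a b \<Longrightarrow> q \<le> max a b \<Longrightarrow> g (u @ wpow (jm_word i) p @ wpow (jm_word (Suc i)) q @ [i] @ v) = 0"
  shows "g (u @ [i] @ wpow (jm_word i) a @ wpow (jm_word (Suc i)) b @ v) = 0"
proof -
  let ?A = "jm_word i" and ?B = "jm_word (Suc i)"
  define m where "m = min a b"
  let ?u = "u @ wpow ?A m @ wpow ?B m"
  have lA: "set (wpow ?A k) \<subseteq> {..<n}" and lB: "set (wpow ?B k) \<subseteq> {..<n}" for k
    using set_wpow[OF jm_i_letters(1)] set_wpow[OF jm_i_letters(2)] by blast+
  have u': "set ?u \<subseteq> {..<n}" using u lA lB by simp
  have mv: "g (?u @ wpow ?A p @ wpow ?B q @ w) = g (u @ wpow ?A (m + p) @ wpow ?B (m + q) @ w)"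
    if "set w \<subseteq> {..<n}" for p q w
    using jm_sort[of "u @ wpow ?A m" "wpow ?B q @ w" m p] that u lA lB by (simp add: replicate_add)
  have out: "g (u @ [i] @ wpow ?A m @ wpow ?B m @ w) = g (?u @ [i] @ w)" if "set w \<subseteq> {..<n}" for w
  proof (rule braid_eq)
    show "braid (u @ [i] @ wpow ?A m @ wpow ?B m @ w) (?u @ [i] @ w)"
      using braid_context[OF symmetric_commute[of m, unfolded words_commute_def], of u w] by simp
    show "set (u @ [i] @ wpow ?A m @ wpow ?B m @ w) \<subseteq> {..<n}" using that u lA lB i by simp
  qed
  show ?thesis
  proof (cases "a \<le> b")
    case True
    then have m: "m = a" "max a b = b" by (auto simp: m_def)
    have "g (u @ [i] @ wpow ?A a @ wpow ?B b @ v) = g (u @ [i] @ wpow ?A m @ wpow ?B m @ (wpow ?B (b - a) @ v))"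
      using True wpow_add[of a "b - a" ?B] by (simp add: m)
    also have "\<dots> = g (?u @ [i] @ wpow ?B (b - a) @ v)" by (rule out) (use lB v in simp)
    also have "\<dots> = 0"
    proof (rule push_second_power[OF u' v])
      fix p assume "p \<le> b - a"
      then show "g (?u @ wpow ?A p @ wpow ?B (b - a - p) @ v) = 0"
        unfolding mv[OF v] using m True by (intro assms(3)) auto
    next
      show "g (?u @ wpow ?A (b - a) @ [i] @ v) = 0"
        using mv[of "[i] @ v" "b - a" 0] assms(4)[of b a] v i True m by simp
    qed
    finally show ?thesis .
  next
    case False
    then have m: "m = b" "max a b = a" by (auto simp: m_def)
    have "g (u @ [i] @ wpow ?A a @ wpow ?B b @ v) = g ((u @ [i] @ wpow ?A m) @ wpow ?A (a - b) @ wpow ?B m @ v)"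
      using False wpow_add[of b "a - b" ?A] by (simp add: m)
    also have "\<dots> = g ((u @ [i] @ wpow ?A m) @ wpow ?B m @ wpow ?A (a - b) @ v)"
      by (rule jm_sort[symmetric]) (use u v lA i in auto)
    also have "\<dots> = g (?u @ [i] @ wpow ?A (a - b) @ v)" using out[of "wpow ?A (a - b) @ v"] lA v by simp
    also have "\<dots> = 0"
    proof (rule push_first_power[OF u' v])
      fix p assume "p \<le> a - b"
      then show "g (?u @ wpow ?A p @ wpow ?B (a - b - p) @ v) = 0"
        unfolding mv[OF v] using m False by (intro assms(3)) auto
    next
      show "g (?u @ wpow ?B (a - b) @ [i] @ v) = 0"
        using mv[of "[i] @ v" 0 "a - b"] assms(4)[of b a] v i False m by simp
    qed
    finally show ?thesis .
  qed
qed

end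


text \<open>Strong induction on the length: the word is braid equivalent to the chosen reduced
  expression, or it contains a square, which the quadratic relation replaces by shorter
  words.\<close>

lemma vanish_on_words:
  assumes n: "1 \<le> n"
    and van: "\<And>w. w permutes {1..n} \<Longrightarrow> g (u @ (SOME ks. reduced_expr n w ks)) = 0"
    and u: "set u \<subseteq> {..<n}" and ks: "set ks \<subseteq> {1..<n}"
  shows "g (u @ ks) = 0"
  using ks
proof (induction "length ks" arbitrary: ks rule: less_induct)
  case less
  let ?w = "word_perm ks"
  define ks0 where "ks0 = (SOME ks. reduced_expr n ?w ks)"
  have red: "reduced_expr n ?w ks0"
    unfolding ks0_def using reduced_expr_exists[OF less.prems] by (rule someI_ex)
  have sub: "set ks \<subseteq> {..<n}" by (rule subset_trans[OF less.prems]) auto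
  from reduced_or_square[OF red n less.prems refl] show ?case
  proof
    assume "braid ks ks0"
    then have "g (u @ ks) = g (u @ ks0)"
      using braid_functional[OF functional, of ks ks0 u "[]"] sub u by simp
    then show ?thesis using van[OF word_perm_permutes[OF less.prems]] by (simp add: ks0_def)
  next
    assume "has_square ks"
    then obtain a i b where b: "braid ks (a @ [i, i] @ b)" by (auto simp: has_square_def)
    have s: "set (a @ [i, i] @ b) \<subseteq> {1..<n}" using braid_set[OF b] less.prems by simp
    then have i: "1 \<le> i" "i < n" and ab: "set a \<subseteq> {1..<n}" "set b \<subseteq> {1..<n}" by auto
    have "{1..<n} \<subseteq> {..<n}" by auto
    then have ab': "set a \<subseteq> {..<n}" "set b \<subseteq> {..<n}" using ab by blast+
    have "g (u @ ks) = g (u @ a @ [i, i] @ b)"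
      using braid_functional[OF functional b sub u, of "[]"] by simp
    also have "\<dots> = (x - 1) * g (u @ (a @ [i] @ b)) + x * g (u @ (a @ b))"
      using ak_functionalD(2)[OF functional _ ab'(2) i, of "u @ a"] u ab'(1) by simp
    also have "g (u @ (a @ [i] @ b)) = 0"
      using braid_length[OF b] s by (intro less.hyps) auto
    also have "g (u @ (a @ b)) = 0"
      using braid_length[OF b] s by (intro less.hyps) auto
    finally show ?thesis by simp
  qed
qed

text \<open>A letter i > 0 commutes with all factors except those of L_i and L_(i+1), where
  \<open>push_letter\<close> applies; what emerges on the right joins \<open>ks\<close>. The letter
  0 raises the exponent of L_1 by one, and the order relation brings it back if it reaches
  l.\<close>

lemma vanish_translate:
  assumes n: "1 \<le> n" and l: "1 \<le> l" and i: "i < n"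
    and van: "\<And>c ks. (\<And>k. k \<in> {1..n} \<Longrightarrow> c k < l) \<Longrightarrow> set ks \<subseteq> {1..<n} \<Longrightarrow> g (jm_powers c n @ ks) = 0"
    and c: "\<And>k. k \<in> {1..n} \<Longrightarrow> c k < l" and ks: "set ks \<subseteq> {1..<n}"
  shows "g (i # jm_powers c n @ ks) = 0"
proof -
  have ks': "set ks \<subseteq> {..<n}" by (rule subset_trans[OF ks]) auto
  show ?thesis
  proof (cases "i = 0")
    case True
    define rest where "rest = concat (map (\<lambda>k. wpow (jm_word k) (c k)) [2..<Suc n]) @ ks"
    have rep: "wpow [0::nat] e = replicate e 0" for e by (induction e) auto
    have sp: "jm_powers (c(1 := e)) n @ ks = replicate e 0 @ rest" for e
    proof -
      have upt: "[1..<Suc n] = 1 # [2..<Suc n]" using n upt_conv_Cons[of 1 "Suc n"] by (simp add: numeral_2_eq_2)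
      have m: "map (\<lambda>k. wpow (jm_word k) ((c(1 := e)) k)) [2..<Suc n] = map (\<lambda>k. wpow (jm_word k) (c k)) [2..<Suc n]"
        by (intro map_cong) auto
      have "jm_powers (c(1 := e)) n =
          wpow (jm_word 1) e @ concat (map (\<lambda>k. wpow (jm_word k) ((c(1 := e)) k)) [2..<Suc n])"
        unfolding jm_powers_def upt by (simp del: upt_Suc)
      then show ?thesis unfolding m rest_def by (simp add: rep del: upt_Suc)
    qed
    have z: "g (replicate e 0 @ rest) = 0" if "e < l" for e
      unfolding sp[symmetric] using c that by (intro van ks) auto
    have sr: "set rest \<subseteq> {..<n}"
      unfolding rest_def set_append by (intro Un_least ks' jm_concat_letters) auto
    have eq: "i # jm_powers c n @ ks = replicate (Suc (c 1)) 0 @ rest"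
      using sp[of "c 1"] True by simp
    show ?thesis
    proof (cases "Suc (c 1) < l")
      case True then show ?thesis unfolding eq by (rule z)
    next
      case False
      then have cl: "Suc (c 1) = l" using c[of 1] n by auto
      \<comment> \<open>The polynomial of the order relation is monic of degree l, so the value at
        exponent l is a combination of values at smaller exponents.\<close>
      let ?p = "\<Prod>j<l. [:- Q j, 1:]"
      have "degree ?p = l" by (subst degree_prod_eq_sum_degree) auto
      moreover have "lead_coeff ?p = 1" by (simp add: lead_coeff_prod)
      ultimately have lc: "coeff ?p l = 1" by simp
      have "(\<Sum>j\<le>l. coeff ?p j * g (replicate j 0 @ rest)) = 0"
        using ak_functionalD(1)[OF functional _ sr, of "[]"] by simp
      moreover have "(\<Sum>j\<le>l. coeff ?p j * g (replicate j 0 @ rest)) =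
          g (replicate l 0 @ rest) + (\<Sum>j<l. coeff ?p j * g (replicate j 0 @ rest))"
        unfolding lessThan_Suc_atMost[symmetric] by (simp add: lc)
      ultimately have "g (replicate l 0 @ rest) = 0" using z by simp
      then show ?thesis unfolding eq cl .
    qed
  next
    case False
    then have i1: "1 \<le> i" by simp
    let ?A = "jm_word i" and ?B = "jm_word (Suc i)"
    define pre where "pre = jm_powers c (i - 1)"
    define post where "post = concat (map (\<lambda>k. wpow (jm_word k) (c k)) [i + 2..<Suc n])"
    have sp: "jm_powers (c(i := p, Suc i := q)) n = pre @ wpow ?A p @ wpow ?B q @ post" for p q
    proof -
      have "jm_powers (c(i := p, Suc i := q)) (i - 1) = pre"
        unfolding pre_def jm_powers_def by (intro arg_cong[of _ _ concat] map_cong) auto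
      moreover have "concat (map (\<lambda>k. wpow (jm_word k) ((c(i := p, Suc i := q)) k)) [i + 2..<Suc n]) = post"
        unfolding post_def by (intro arg_cong[of _ _ concat] map_cong) auto
      ultimately show ?thesis unfolding jm_powers_split[OF i1 i] by simp
    qed
    have pre: "set pre \<subseteq> {..<n}" unfolding pre_def using i by (intro jm_powers_letters) auto
    have post: "set post \<subseteq> {..<n}" unfolding post_def by (rule jm_concat_letters) auto
    have cpre: "words_commute [i] pre"
      unfolding pre_def jm_powers_def
    proof (rule words_commute_sym, rule words_commute_letters)
      fix a assume "a \<in> set (concat (map (\<lambda>k. wpow (jm_word k) (c k)) [1..<Suc (i - 1)]))"
      then obtain k where k: "1 \<le> k" "k < i" "a \<in> set (jm_word k)" using i1 by auto
      show "words_commute [a] [i]" by (rule words_commute_far_letters) (use jm_word_less[OF k(3,1)] k in linarith)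
    qed
    have cpost: "words_commute post [i]"
    proof -
      have js: "words_commute (concat (map (\<lambda>k. wpow (jm_word k) (c k)) js)) [i]" if "\<And>j. j \<in> set js \<Longrightarrow> i + 2 \<le> j" for js
        using that
      proof (induction js)
        case (Cons j js)
        have "words_commute (wpow (jm_word j) (c j)) [i]"
          using Cons.prems by (intro words_commute_power words_commute_sym[OF jm_commute_low]) auto
        then show ?case using Cons words_commute_append[of "wpow (jm_word j) (c j)" "[i]"] by simp
      qed simp
      show ?thesis unfolding post_def by (rule js) auto
    qed
    have lA: "set (wpow ?A k) \<subseteq> {..<n}" and lB: "set (wpow ?B k) \<subseteq> {..<n}" for k
      using set_wpow[OF jm_i_letters(1)[OF i1 i]] set_wpow[OF jm_i_letters(2)[OF i1 i]] by blast+
    have "g (i # jm_powers c n @ ks) = g ([i] @ pre @ (wpow ?A (c i) @ wpow ?B (c (Suc i)) @ post @ ks))"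
      using sp[of "c i" "c (Suc i)"] by simp
    also have "\<dots> = g (pre @ [i] @ (wpow ?A (c i) @ wpow ?B (c (Suc i)) @ post @ ks))"
      using braid_functional[OF functional cpre[unfolded words_commute_def], of "[]"
          "wpow ?A (c i) @ wpow ?B (c (Suc i)) @ post @ ks"] pre post lA lB ks' i by simp
    also have "\<dots> = 0"
    proof (rule push_letter[OF i1 i pre])
      show "set (post @ ks) \<subseteq> {..<n}" using post ks' by simp
      fix p q assume pq: "p \<le> max (c i) (c (Suc i))" "q \<le> max (c i) (c (Suc i))"
      have bd: "(c(i := p, Suc i := q)) k < l" if "k \<in> {1..n}" for k
        using c[OF that] c[of i] c[of "Suc i"] pq i i1 by auto
      have "g (jm_powers (c(i := p, Suc i := q)) n @ ks) = 0" using bd ks by (rule van)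
      then show "g (pre @ wpow ?A p @ wpow ?B q @ post @ ks) = 0" unfolding sp by simp
      have "g (jm_powers (c(i := p, Suc i := q)) n @ (i # ks)) = 0" using bd ks i i1 by (intro van) auto
      then have z: "g ((pre @ wpow ?A p @ wpow ?B q) @ (post @ [i]) @ ks) = 0" unfolding sp by simp
      have "g ((pre @ wpow ?A p @ wpow ?B q) @ ([i] @ post) @ ks) = g ((pre @ wpow ?A p @ wpow ?B q) @ (post @ [i]) @ ks)"
        by (rule braid_functional[OF functional braid_sym[OF cpost[unfolded words_commute_def]]])
          (use pre post lA lB ks' i in auto)
      then show "g (pre @ wpow ?A p @ wpow ?B q @ [i] @ post @ ks) = 0" using z by simp
    qed
    finally show ?thesis .
  qed
qed

end

lemma functional_translate:
  assumes "ak_functional l n x Q g" "i < n"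
  shows "ak_functional l n x Q (\<lambda>w. g (i # w))"
proof -
  have u: "set (i # u) \<subseteq> {..<n}" if "set u \<subseteq> {..<n}" for u using that assms(2) by simp
  show ?thesis
    using ak_functionalD[OF assms(1) u] unfolding ak_functional_def append_Cons append_Nil by blast
qed

text \<open>Peeling the first letter off w replaces g by a left translate, which is again a
  functional and still vanishes on all spanning elements. At the empty word the exponents c = 0 give
  g [] = 0.\<close>

lemma functional_zero:
  assumes g: "ak_functional l n x Q g" and x: "x \<noteq> 0" and n: "1 \<le> n" and l: "1 \<le> l"
    and van: "\<And>c w. (\<And>k. k \<in> {1..n} \<Longrightarrow> c k < l) \<Longrightarrow> w permutes {1..n} \<Longrightarrow>
      g (jm_powers c n @ (SOME ks. reduced_expr n w ks)) = 0"
    and w: "set w \<subseteq> {..<n}"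
  shows "g w = 0"
proof -
  have all: "g (jm_powers c n @ ks) = 0" if "\<And>k. k \<in> {1..n} \<Longrightarrow> c k < l" "set ks \<subseteq> {1..<n}" for c ks
    by (rule functional.vanish_on_words[OF _ n]) (use g x van that jm_powers_letters[of n n] functional_def in blast)+
  show ?thesis
    using w g all
  proof (induction w arbitrary: g)
    case Nil
    have "jm_powers (\<lambda>_. 0) n = []" by (simp add: jm_powers_def)
    then show ?case using Nil(3)[of "\<lambda>_. 0" "[]"] l by simp
  next
    case (Cons i w)
    have i: "i < n" using Cons.prems(1) by simp
    have f: "functional l n x Q g" using Cons.prems(2) x by (simp add: functional_def)
    have "(\<lambda>w. g (i # w)) w = 0"
    proof (rule Cons.IH)
      show "ak_functional l n x Q (\<lambda>w. g (i # w))" using Cons.prems(2) i by (rule functional_translate)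
      show "g (i # jm_powers c n @ ks) = 0" if "\<And>k. k \<in> {1..n} \<Longrightarrow> c k < l" "set ks \<subseteq> {1..<n}" for c ks
        by (rule functional.vanish_translate[OF f n l i]) (use Cons.prems(3) that in blast)+
    qed (use Cons.prems(1) in simp)
    then show ?case .
  qed
qed

section \<open>The free algebra and its quotient\<close>

definition conv :: "(nat list \<Rightarrow> 'a::field) \<Rightarrow> (nat list \<Rightarrow> 'a) \<Rightarrow> nat list \<Rightarrow> 'a" where
  "conv f g w = (\<Sum>k\<le>length w. f (take k w) * g (drop k w))"

lemma conv_Nil [simp]: "conv f g [] = f [] * g []"
  by (simp add: conv_def)

text \<open>Recursion on the first letter, with f replaced by its left derivative. Associativity
  then becomes an induction on the word.\<close>

lemma conv_Cons: "conv f g (a # w) = f [] * g (a # w) + conv (\<lambda>v. f (a # v)) g w"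
  unfolding conv_def length_Cons sum.atMost_Suc_shift by simp

lemma conv_zero [simp]: "conv (\<lambda>_. 0) g w = 0"
  by (simp add: conv_def)

lemma conv_linear_left: "conv (\<lambda>w. c * f w + h w) g w = c * conv f g w + conv h g w"
  by (simp add: conv_def sum_distrib_left sum.distrib algebra_simps)

lemma conv_assoc: "conv (conv f g) h w = conv f (conv g h) w"
proof (induction w arbitrary: f)
  case (Cons a w)
  have "conv (conv f g) h (a # w) =
      f [] * g [] * h (a # w) + conv (\<lambda>v. f [] * g (a # v) + conv (\<lambda>v. f (a # v)) g v) h w"
    by (simp add: conv_Cons[of "conv f g"] conv_Cons[of f g])
  also have "\<dots> = f [] * (g [] * h (a # w) + conv (\<lambda>v. g (a # v)) h w) + conv (conv (\<lambda>v. f (a # v)) g) h w"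
    unfolding conv_linear_left by (simp add: algebra_simps)
  also have "\<dots> = conv f (conv g h) (a # w)"
    unfolding Cons conv_Cons[of f "conv g h"] conv_Cons[of g h] ..
  finally show ?case .
qed simp

lemma conv_support: "{w. conv f g w \<noteq> 0} \<subseteq> (\<lambda>(u, v). u @ v) ` ({w. f w \<noteq> 0} \<times> {w. g w \<noteq> 0})"
proof
  fix w assume "w \<in> {w. conv f g w \<noteq> 0}"
  then have "(\<Sum>k\<le>length w. f (take k w) * g (drop k w)) \<noteq> 0" by (simp add: conv_def)
  then obtain k where "f (take k w) * g (drop k w) \<noteq> 0"
    by (rule sum.not_neutral_contains_not_neutral)
  then have "f (take k w) \<noteq> 0" "g (drop k w) \<noteq> 0" by auto
  then show "w \<in> (\<lambda>(u, v). u @ v) ` ({w. f w \<noteq> 0} \<times> {w. g w \<noteq> 0})"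
    by (intro image_eqI[of _ _ "(take k w, drop k w)"]) auto
qed

definition ev :: "(nat list \<Rightarrow> 'a::field) \<Rightarrow> (nat list \<Rightarrow> 'a) \<Rightarrow> 'a" where
  "ev g f = (\<Sum>w | f w \<noteq> 0. f w * g w)"

lemma ev_superset: "finite A \<Longrightarrow> {w. f w \<noteq> 0} \<subseteq> A \<Longrightarrow> ev g f = (\<Sum>w\<in>A. f w * g w)"
  unfolding ev_def by (rule sum.mono_neutral_left) auto

lemma ev_add:
  assumes "finite {w. f w \<noteq> 0}" "finite {w. h w \<noteq> 0}"
  shows "ev g (\<lambda>w. f w + h w) = ev g f + ev g h"
proof -
  let ?A = "{w. f w \<noteq> 0} \<union> {w. h w \<noteq> 0}"
  have fin: "finite ?A" using assms by simp
  have "ev g (\<lambda>w. f w + h w) = (\<Sum>w\<in>?A. (f w + h w) * g w)" by (rule ev_superset[OF fin]) auto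
  moreover have "ev g f = (\<Sum>w\<in>?A. f w * g w)" by (rule ev_superset[OF fin]) auto
  moreover have "ev g h = (\<Sum>w\<in>?A. h w * g w)" by (rule ev_superset[OF fin]) auto
  ultimately show ?thesis by (simp add: sum.distrib algebra_simps)
qed

lemma ev_uminus: "ev g (\<lambda>w. - f w) = - ev g f"
  by (simp add: ev_def sum_negf)

text \<open>The common form of \<open>word_elt\<close> and \<open>scalar_elt\<close>, closed under
  products by \<open>monom_mult\<close>.\<close>

definition monom_elt :: "'a::field \<Rightarrow> nat list \<Rightarrow> nat list \<Rightarrow> 'a" where
  "monom_elt c v = (\<lambda>w. if w = v then c else 0)"

lemma word_elt_monom: "word_elt v = monom_elt 1 v" and scalar_elt_monom: "scalar_elt c = monom_elt c []"
  by (auto simp: word_elt_def scalar_elt_def monom_elt_def)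

lemma ev_monom: "ev g (monom_elt c v) = c * g v"
proof -
  have "{w. monom_elt c v w \<noteq> 0} \<subseteq> {v}" by (auto simp: monom_elt_def split: if_splits)
  then show ?thesis using ev_superset[of "{v}" "monom_elt c v" g] by (simp add: monom_elt_def)
qed

lemma conv_monom_left: "conv (monom_elt c []) h = (\<lambda>w. c * h w)"
proof
  fix w show "conv (monom_elt c []) h w = c * h w"
    by (cases w) (simp_all add: conv_Cons monom_elt_def)
qed

text \<open>The sum over the splittings of a word is regrouped as a sum over pairs of words from the
  two supports. Evaluating a product thus becomes an iterated evaluation, and in this form relations
  are translated by words.\<close>

lemma ev_conv:
  assumes f: "finite {w. f w \<noteq> 0}" and h: "finite {w. h w \<noteq> 0}"
  shows "ev g (conv f h) = ev (\<lambda>u. ev (\<lambda>v. g (u @ v)) h) f"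
proof -
  let ?A = "{w. f w \<noteq> 0}" and ?B = "{w. h w \<noteq> 0}"
  let ?W = "(\<lambda>(u, v). u @ v) ` (?A \<times> ?B)"
  have fin: "finite ?W" "finite (?A \<times> ?B)" using f h by auto
  have conv_eq: "conv f h w = (\<Sum>(u, v)\<in>{p \<in> ?A \<times> ?B. (\<lambda>(u, v). u @ v) p = w}. f u * h v)" for w
  proof -
    have "conv f h w = (\<Sum>(u, v)\<in>(\<lambda>k. (take k w, drop k w)) ` {..length w}. f u * h v)"
      unfolding conv_def by (subst sum.reindex) (auto simp: inj_on_def min_def split: if_splits dest!: arg_cong[of _ _ length])
    also have "\<dots> = (\<Sum>(u, v)\<in>{p \<in> ?A \<times> ?B. (\<lambda>(u, v). u @ v) p = w}. f u * h v)"
    proof (rule sum.mono_neutral_right)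
      show "{p \<in> ?A \<times> ?B. (\<lambda>(u, v). u @ v) p = w} \<subseteq> (\<lambda>k. (take k w, drop k w)) ` {..length w}"
      proof
        fix p assume "p \<in> {p \<in> ?A \<times> ?B. (\<lambda>(u, v). u @ v) p = w}"
        then obtain u v where "p = (u, v)" "u @ v = w" by auto
        then show "p \<in> (\<lambda>k. (take k w, drop k w)) ` {..length w}"
          by (intro image_eqI[of _ _ "length u"]) auto
      qed
    qed auto
    finally show ?thesis .
  qed
  have "ev g (conv f h) = (\<Sum>w\<in>?W. conv f h w * g w)"
    by (rule ev_superset[OF fin(1) conv_support])
  also have "\<dots> = (\<Sum>w\<in>?W. \<Sum>p\<in>{p \<in> ?A \<times> ?B. (\<lambda>(u, v). u @ v) p = w}. (case p of (u, v) \<Rightarrow> f u * h v * g (u @ v)))"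
    unfolding conv_eq sum_distrib_right by (intro sum.cong refl) auto
  also have "\<dots> = (\<Sum>p\<in>?A \<times> ?B. (case p of (u, v) \<Rightarrow> f u * h v * g (u @ v)))"
    by (rule sum.group[OF fin(2,1)]) auto
  also have "\<dots> = (\<Sum>u\<in>?A. \<Sum>v\<in>?B. f u * h v * g (u @ v))"
    by (rule sum.cartesian_product[symmetric])
  also have "\<dots> = ev (\<lambda>u. ev (\<lambda>v. g (u @ v)) h) f"
    unfolding ev_def by (simp add: sum_distrib_left mult.assoc)
  finally show ?thesis .
qed

locale free_over =
  fixes F :: "'a::field set" and n :: nat
  assumes F0: "0 \<in> F" and F1: "1 \<in> F" and Fadd: "a \<in> F \<Longrightarrow> b \<in> F \<Longrightarrow> a + b \<in> F"
    and Fmult: "a \<in> F \<Longrightarrow> b \<in> F \<Longrightarrow> a * b \<in> F" and Fneg: "a \<in> F \<Longrightarrow> - a \<in> F"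
begin

abbreviation R where "R \<equiv> free_algebra F n"

lemma Fsum: "(\<And>i. i \<in> A \<Longrightarrow> f i \<in> F) \<Longrightarrow> sum f A \<in> F"
  by (induction A rule: infinite_finite_induct) (auto intro: F0 Fadd)

lemma R_simps:
  "carrier R = {f. finite {w. f w \<noteq> 0} \<and> (\<forall>w. f w \<in> F) \<and> (\<forall>w. f w \<noteq> 0 \<longrightarrow> set w \<subseteq> {..<n})}"
  "f \<otimes>\<^bsub>R\<^esub> g = conv f g" "\<one>\<^bsub>R\<^esub> = monom_elt 1 []" "\<zero>\<^bsub>R\<^esub> = (\<lambda>w. 0)" "f \<oplus>\<^bsub>R\<^esub> g = (\<lambda>w. f w + g w)"
  by (auto simp: free_algebra_def conv_def monom_elt_def fun_eq_iff)

lemma R_fin: "f \<in> carrier R \<Longrightarrow> finite {w. f w \<noteq> 0}"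
  by (simp add: R_simps)

lemma R_ring: "ring R"
proof (rule ringI)
  show "abelian_group R"
  proof (rule abelian_groupI)
    fix f g assume fg: "f \<in> carrier R" "g \<in> carrier R"
    have "{w. f w + g w \<noteq> 0} \<subseteq> {w. f w \<noteq> 0} \<union> {w. g w \<noteq> 0}" by auto
    then have "finite {w. f w + g w \<noteq> 0}" using fg finite_subset R_fin by blast
    moreover have "set w \<subseteq> {..<n}" if "f w + g w \<noteq> 0" for w
    proof -
      have "f w \<noteq> 0 \<or> g w \<noteq> 0" using that by auto
      then show ?thesis using fg by (auto simp: R_simps)
    qed
    ultimately show "f \<oplus>\<^bsub>R\<^esub> g \<in> carrier R" using fg by (auto simp: R_simps intro: Fadd)
  next
    fix f assume "f \<in> carrier R"
    then show "\<exists>g\<in>carrier R. g \<oplus>\<^bsub>R\<^esub> f = \<zero>\<^bsub>R\<^esub>"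
      by (intro bexI[of _ "\<lambda>w. - f w"]) (auto simp: R_simps intro: Fneg)
  qed (auto simp: R_simps F0 add_ac)
  show "Group.monoid R"
  proof (rule monoidI)
    fix f g assume fg: "f \<in> carrier R" "g \<in> carrier R"
    have "finite {w. conv f g w \<noteq> 0}"
      by (rule finite_subset[OF conv_support]) (use fg R_fin in auto)
    moreover have "conv f g w \<in> F" for w
      unfolding conv_def using fg by (intro Fsum Fmult) (auto simp: R_simps)
    moreover have "set w \<subseteq> {..<n}" if "conv f g w \<noteq> 0" for w
    proof -
      have "w \<in> (\<lambda>(u, v). u @ v) ` ({w. f w \<noteq> 0} \<times> {w. g w \<noteq> 0})" using conv_support that by blast
      then obtain u v where "w = u @ v" "f u \<noteq> 0" "g v \<noteq> 0" by auto
      then show ?thesis using fg by (auto simp: R_simps)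
    qed
    ultimately show "f \<otimes>\<^bsub>R\<^esub> g \<in> carrier R" by (auto simp: R_simps)
  next
    show "\<one>\<^bsub>R\<^esub> \<in> carrier R" by (auto simp: R_simps monom_elt_def F0 F1)
  next
    fix f show "\<one>\<^bsub>R\<^esub> \<otimes>\<^bsub>R\<^esub> f = f" by (simp add: R_simps conv_monom_left)
    show "f \<otimes>\<^bsub>R\<^esub> \<one>\<^bsub>R\<^esub> = f"
    proof
      fix w
      have "conv f (monom_elt 1 []) w = (\<Sum>k\<le>length w. if k = length w then f w else 0)"
        unfolding conv_def by (intro sum.cong) (auto simp: monom_elt_def)
      then show "(f \<otimes>\<^bsub>R\<^esub> \<one>\<^bsub>R\<^esub>) w = f w" by (simp add: R_simps)
    qed
  next
    fix f g h show "f \<otimes>\<^bsub>R\<^esub> g \<otimes>\<^bsub>R\<^esub> h = f \<otimes>\<^bsub>R\<^esub> (g \<otimes>\<^bsub>R\<^esub> h)"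
      unfolding R_simps(2) by (rule ext) (rule conv_assoc)
  qed
next
  fix f g h show "(f \<oplus>\<^bsub>R\<^esub> g) \<otimes>\<^bsub>R\<^esub> h = f \<otimes>\<^bsub>R\<^esub> h \<oplus>\<^bsub>R\<^esub> g \<otimes>\<^bsub>R\<^esub> h"
    unfolding R_simps(2,5) conv_def by (simp add: sum.distrib algebra_simps)
  show "h \<otimes>\<^bsub>R\<^esub> (f \<oplus>\<^bsub>R\<^esub> g) = h \<otimes>\<^bsub>R\<^esub> f \<oplus>\<^bsub>R\<^esub> h \<otimes>\<^bsub>R\<^esub> g"
    unfolding R_simps(2,5) conv_def by (simp add: sum.distrib algebra_simps)
qed

sublocale R: ring R
  by (rule R_ring)

lemma R_minus: "f \<in> carrier R \<Longrightarrow> g \<in> carrier R \<Longrightarrow> f \<ominus>\<^bsub>R\<^esub> g = (\<lambda>w. f w - g w)"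
proof -
  assume fg: "f \<in> carrier R" "g \<in> carrier R"
  have neg: "(\<lambda>w. - g w) \<in> carrier R" using fg by (auto simp: R_simps intro: Fneg)
  have "\<ominus>\<^bsub>R\<^esub> g = (\<lambda>w. - g w)"
    by (rule R.minus_equality) (use fg neg in \<open>auto simp: R_simps\<close>)
  then show ?thesis unfolding a_minus_def by (simp add: R_simps)
qed

lemma R_neg: "f \<in> carrier R \<Longrightarrow> \<ominus>\<^bsub>R\<^esub> f = (\<lambda>w. - f w)"
  using R_minus[of "\<zero>\<^bsub>R\<^esub>" f] R.zero_closed by (simp add: a_minus_def R_simps)

lemma monom_carrier: "c \<in> F \<Longrightarrow> set v \<subseteq> {..<n} \<Longrightarrow> monom_elt c v \<in> carrier R"
  by (auto simp: R_simps monom_elt_def F0)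

lemma ev_minus: "f \<in> carrier R \<Longrightarrow> h \<in> carrier R \<Longrightarrow> ev g (f \<ominus>\<^bsub>R\<^esub> h) = ev g f - ev g h"
proof -
  assume fh: "f \<in> carrier R" "h \<in> carrier R"
  have "finite {w. - h w \<noteq> 0}" using R_fin[OF fh(2)] by simp
  then have "ev g (\<lambda>w. f w + - h w) = ev g f - ev g h"
    using ev_add[of f "\<lambda>w. - h w" g] R_fin[OF fh(1)] by (simp add: ev_uminus)
  then show ?thesis using R_minus[OF fh] by simp
qed

lemma ev_plus: "f \<in> carrier R \<Longrightarrow> h \<in> carrier R \<Longrightarrow> ev g (f \<oplus>\<^bsub>R\<^esub> h) = ev g f + ev g h"
  unfolding R_simps(5) by (rule ev_add[OF R_fin R_fin])

lemma ev_mult: "f \<in> carrier R \<Longrightarrow> h \<in> carrier R \<Longrightarrow> ev g (f \<otimes>\<^bsub>R\<^esub> h) = ev (\<lambda>u. ev (\<lambda>v. g (u @ v)) h) f"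
  unfolding R_simps(2) by (rule ev_conv[OF R_fin R_fin])

lemma ev_cong: "f \<in> carrier R \<Longrightarrow> (\<And>w. set w \<subseteq> {..<n} \<Longrightarrow> g w = g' w) \<Longrightarrow> ev g f = ev g' f"
  unfolding ev_def by (intro sum.cong refl) (auto simp: R_simps(1))

lemma monom_mult: "c \<in> F \<Longrightarrow> d \<in> F \<Longrightarrow> set u \<subseteq> {..<n} \<Longrightarrow> set v \<subseteq> {..<n} \<Longrightarrow>
  monom_elt c u \<otimes>\<^bsub>R\<^esub> monom_elt d v = monom_elt (c * d) (u @ v)"
proof -
  assume a: "c \<in> F" "d \<in> F" "set u \<subseteq> {..<n}" "set v \<subseteq> {..<n}"
  show ?thesis
  proof
    fix w
    \<comment> \<open>A finitely supported function is recovered from its evaluations at indicator functionals.\<close>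
    have pick: "ev (\<lambda>z. if z = w then 1 else 0) f = f w" if "finite {z. f z \<noteq> 0}" for f :: "nat list \<Rightarrow> 'a"
    proof -
      have "ev (\<lambda>z. if z = w then 1 else 0) f = (\<Sum>z\<in>insert w {z. f z \<noteq> 0}. f z * (if z = w then 1 else 0))"
        using that by (intro ev_superset) auto
      then show ?thesis using that by (simp add: if_distrib[of "\<lambda>t. _ * t"] sum.delta cong: if_cong)
    qed
    have cc: "monom_elt c u \<in> carrier R" "monom_elt d v \<in> carrier R" using a by (auto intro: monom_carrier)
    have "(monom_elt c u \<otimes>\<^bsub>R\<^esub> monom_elt d v) w = ev (\<lambda>z. if z = w then 1 else 0) (monom_elt c u \<otimes>\<^bsub>R\<^esub> monom_elt d v)"
      using R_fin[OF R.m_closed[OF cc]] by (rule pick[symmetric])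
    also have "\<dots> = monom_elt (c * d) (u @ v) w"
      unfolding ev_mult[OF cc] ev_monom by (auto simp: monom_elt_def)
    finally show "(monom_elt c u \<otimes>\<^bsub>R\<^esub> monom_elt d v) w = monom_elt (c * d) (u @ v) w" .
  qed
qed

end

section \<open>Linear forms on the quotient algebra\<close>

lemma functional_diff:
  assumes "ak_functional l n x Q g" "ak_functional l n x Q h"
  shows "ak_functional l n x Q (\<lambda>w. g w - h w)"
proof -
  show ?thesis
    unfolding ak_functional_def
  proof (intro allI impI conjI)
    fix u v assume uv: "set u \<subseteq> {..<n}" "set v \<subseteq> {..<n}"
    note a = ak_functionalD[OF assms(1) uv] and b = ak_functionalD[OF assms(2) uv]
    show "(\<Sum>i\<le>l. coeff (\<Prod>j<l. [:- Q j, 1:]) i * (g (u @ replicate i 0 @ v) - h (u @ replicate i 0 @ v))) = 0"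
      using a(1) b(1) by (simp add: right_diff_distrib sum_subtractf)
    show "g (u @ [i, i] @ v) - h (u @ [i, i] @ v) =
        (x - 1) * (g (u @ [i] @ v) - h (u @ [i] @ v)) + x * (g (u @ v) - h (u @ v))" if "1 \<le> i" "i < n" for i
      unfolding a(2)[OF that] b(2)[OF that] by (simp add: algebra_simps)
    show "g (u @ [0, 1, 0, 1] @ v) - h (u @ [0, 1, 0, 1] @ v) = g (u @ [1, 0, 1, 0] @ v) - h (u @ [1, 0, 1, 0] @ v)"
      if "2 \<le> n" unfolding a(3)[OF that] b(3)[OF that] ..
    show "g (u @ [i, i + 1, i] @ v) - h (u @ [i, i + 1, i] @ v) =
        g (u @ [i + 1, i, i + 1] @ v) - h (u @ [i + 1, i, i + 1] @ v)" if "1 \<le> i" "i + 1 < n" for i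
      unfolding a(4)[OF that] b(4)[OF that] ..
    show "g (u @ [i, j] @ v) - h (u @ [i, j] @ v) = g (u @ [j, i] @ v) - h (u @ [j, i] @ v)"
      if "i + 1 < j" "j < n" for i j
      unfolding a(5)[OF that] b(5)[OF that] ..
  qed
qed

locale ak_over = free_over F n for F :: "'a::field set" and n :: nat +
  fixes l :: nat and x :: 'a and Q :: "nat \<Rightarrow> 'a"
  assumes n_pos: "1 \<le> n" and l_ge_1: "1 \<le> l" and xF: "x \<in> F" and QF: "j < l \<Longrightarrow> Q j \<in> F"
    and Finv: "a \<in> F \<Longrightarrow> inverse a \<in> F" and x_nonzero: "x \<noteq> 0"
begin

abbreviation "Rel \<equiv> ak_relations F l n x Q"
abbreviation "J \<equiv> ak_ideal F l n x Q"
abbreviation "H \<equiv> ak_algebra F l n x Q"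
abbreviation "cls \<equiv> ak_class F l n x Q"

lemma word_carrier: "set v \<subseteq> {..<n} \<Longrightarrow> word_elt v \<in> carrier R"
  unfolding word_elt_monom by (rule monom_carrier[OF F1])

lemma scalar_carrier: "c \<in> F \<Longrightarrow> scalar_elt c \<in> carrier R"
  unfolding scalar_elt_monom by (rule monom_carrier) auto

lemma ev_word: "ev g (word_elt v) = g v" and ev_scalar: "ev g (scalar_elt c) = c * g []"
  and ev_one: "ev g \<one>\<^bsub>R\<^esub> = g []"
  by (simp_all add: word_elt_monom scalar_elt_monom ev_monom R_simps(3))

text \<open>The factors T_0 - Q_j multiply like the polynomials [:- Q_j, 1:], with
  \<open>replicate i 0\<close> in the role of the i-th power of the variable.\<close>

lemma order_relation:
  assumes "set js \<subseteq> {..<l}"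
  defines "r \<equiv> list_prod R (map (\<lambda>j. word_elt [0] \<ominus>\<^bsub>R\<^esub> scalar_elt (Q j)) js)"
  shows "r \<in> carrier R"
    "ev g r = (\<Sum>i\<le>length js. coeff (prod_list (map (\<lambda>j. [:- Q j, 1:]) js)) i * g (replicate i 0))"
proof -
  have "r \<in> carrier R \<and>
      ev g r = (\<Sum>i\<le>length js. coeff (prod_list (map (\<lambda>j. [:- Q j, 1:]) js)) i * g (replicate i 0))"
    using assms(1) unfolding r_def
  proof (induction js arbitrary: g)
    case Nil
    then show ?case using ev_one by (simp add: list_prod_def)
  next
    case (Cons j js)
    let ?r = "list_prod R (map (\<lambda>j. word_elt [0] \<ominus>\<^bsub>R\<^esub> scalar_elt (Q j)) js)"
    let ?p = "prod_list (map (\<lambda>j. [:- Q j, 1:]) js)"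
    let ?a = "word_elt [0] \<ominus>\<^bsub>R\<^esub> scalar_elt (Q j)"
    have c: "word_elt [0] \<in> carrier R" "scalar_elt (Q j) \<in> carrier R" "?r \<in> carrier R"
      using Cons n_pos by (auto intro!: word_carrier scalar_carrier QF)
    then have a: "?a \<in> carrier R" by (intro R.minus_closed)
    have eq: "list_prod R (map (\<lambda>j. word_elt [0] \<ominus>\<^bsub>R\<^esub> scalar_elt (Q j)) (j # js)) = ?a \<otimes>\<^bsub>R\<^esub> ?r"
      by (simp add: list_prod_def)
    have deg: "degree ?p \<le> length js"
    proof -
      have "degree ?p \<le> sum_list (map degree (map (\<lambda>j. [:- Q j, 1:]) js))" by (rule degree_prod_list_le)
      also have "\<dots> = length js" by (induction js) auto
      finally show ?thesis .
    qed
    have "ev g (?a \<otimes>\<^bsub>R\<^esub> ?r) = ev (\<lambda>v. g (0 # v)) ?r - Q j * ev g ?r"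
      unfolding ev_mult[OF a c(3)] ev_minus[OF c(1,2)] ev_word ev_scalar by simp
    also have "\<dots> = (\<Sum>i\<le>length js. coeff ?p i * g (replicate (Suc i) 0)) -
        Q j * (\<Sum>i\<le>length js. coeff ?p i * g (replicate i 0))"
      using Cons by simp
    also have "\<dots> = (\<Sum>i\<le>Suc (length js). coeff (pCons 0 ?p) i * g (replicate i 0)) +
        (\<Sum>i\<le>Suc (length js). coeff (Polynomial.smult (- Q j) ?p) i * g (replicate i 0))"
    proof -
      have "(\<Sum>i\<le>Suc (length js). coeff (pCons 0 ?p) i * g (replicate i 0)) =
          (\<Sum>i\<le>length js. coeff ?p i * g (replicate (Suc i) 0))"
        unfolding sum.atMost_Suc_shift by simp
      moreover have "coeff ?p (Suc (length js)) = 0" using deg by (simp add: coeff_eq_0)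
      ultimately show ?thesis by (simp add: sum_distrib_left sum_negf mult.assoc)
    qed
    also have "\<dots> = (\<Sum>i\<le>Suc (length js). coeff ([:- Q j, 1:] * ?p) i * g (replicate i 0))"
      unfolding sum.distrib[symmetric] by (intro sum.cong) (simp_all add: algebra_simps)
    finally show ?case unfolding eq using R.m_closed[OF a c(3)] by simp
  qed
  then show "r \<in> carrier R"
    "ev g r = (\<Sum>i\<le>length js. coeff (prod_list (map (\<lambda>j. [:- Q j, 1:]) js)) i * g (replicate i 0))" by auto
qed

lemma prod_list_upt: "prod_list (map f [0..<m]) = (\<Prod>j<m. f j :: 'b::comm_monoid_mult)"
  by (induction m) (auto simp: mult.commute)

definition "rel_order = list_prod R (map (\<lambda>j. word_elt [0] \<ominus>\<^bsub>R\<^esub> scalar_elt (Q j)) [0..<l])"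
definition "rel_quad i = (word_elt [i] \<ominus>\<^bsub>R\<^esub> scalar_elt x) \<otimes>\<^bsub>R\<^esub> (word_elt [i] \<oplus>\<^bsub>R\<^esub> \<one>\<^bsub>R\<^esub>)"
definition "rel_word u v = word_elt u \<ominus>\<^bsub>R\<^esub> word_elt v"

lemma Rel_eq: "Rel = {rel_order} \<union> {rel_quad i | i. 1 \<le> i \<and> i < n} \<union>
    (if n \<ge> 2 then {rel_word [0, 1, 0, 1] [1, 0, 1, 0]} else {}) \<union>
    {rel_word [i, i + 1, i] [i + 1, i, i + 1] | i. 1 \<le> i \<and> i + 1 < n} \<union>
    {rel_word [i, j] [j, i] | i j. i + 1 < j \<and> j < n}"
  unfolding ak_relations_def Let_def rel_order_def rel_quad_def rel_word_def ..

lemma rel_order: "rel_order \<in> carrier R"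
  "ev g rel_order = (\<Sum>i\<le>l. coeff (\<Prod>j<l. [:- Q j, 1:]) i * g (replicate i 0))"
  using order_relation[of "[0..<l]"] unfolding rel_order_def prod_list_upt
  by (auto simp: lessThan_atLeast0)

lemma rel_quad: "i < n \<Longrightarrow> rel_quad i \<in> carrier R"
  "i < n \<Longrightarrow> ev g (rel_quad i) = g [i, i] - ((x - 1) * g [i] + x * g [])"
proof -
  assume i: "i < n"
  have c: "word_elt [i] \<in> carrier R" "scalar_elt x \<in> carrier R"
    using i xF by (auto intro!: word_carrier scalar_carrier)
  have a: "word_elt [i] \<ominus>\<^bsub>R\<^esub> scalar_elt x \<in> carrier R" and b: "word_elt [i] \<oplus>\<^bsub>R\<^esub> \<one>\<^bsub>R\<^esub> \<in> carrier R"
    using c by (auto intro: R.minus_closed)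
  show "rel_quad i \<in> carrier R" unfolding rel_quad_def by (rule R.m_closed[OF a b])
  show "ev g (rel_quad i) = g [i, i] - ((x - 1) * g [i] + x * g [])"
    unfolding rel_quad_def ev_mult[OF a b] ev_minus[OF c] ev_plus[OF c(1) R.one_closed] ev_word ev_scalar ev_one
    by (simp add: algebra_simps)
qed

lemma rel_word: "set u \<subseteq> {..<n} \<Longrightarrow> set v \<subseteq> {..<n} \<Longrightarrow> rel_word u v \<in> carrier R"
  "set u \<subseteq> {..<n} \<Longrightarrow> set v \<subseteq> {..<n} \<Longrightarrow> ev g (rel_word u v) = g u - g v"
  unfolding rel_word_def by (auto intro!: R.minus_closed word_carrier simp: ev_minus word_carrier ev_word)

lemma Rel_carrier: "Rel \<subseteq> carrier R"
  unfolding Rel_eq using rel_order(1) rel_quad(1) by (auto intro!: rel_word(1) split: if_splits)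

text \<open>Connects the explicit clauses with the generators of the ideal: a clause says that
  \<open>ev\<close> kills one generator inside a context u, v.\<close>

lemma functional_iff:
  "ak_functional l n x Q g \<longleftrightarrow> (\<forall>r\<in>Rel. \<forall>u v. set u \<subseteq> {..<n} \<longrightarrow> set v \<subseteq> {..<n} \<longrightarrow> ev (\<lambda>w. g (u @ w @ v)) r = 0)"
proof
  assume f: "ak_functional l n x Q g"
  show "\<forall>r\<in>Rel. \<forall>u v. set u \<subseteq> {..<n} \<longrightarrow> set v \<subseteq> {..<n} \<longrightarrow> ev (\<lambda>w. g (u @ w @ v)) r = 0"
  proof (intro ballI allI impI)
    fix r u v assume r: "r \<in> Rel" and u: "set u \<subseteq> {..<n}" and v: "set v \<subseteq> {..<n}"
    note d = ak_functionalD[OF f u v]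
    consider "r = rel_order" | i where "r = rel_quad i" "1 \<le> i" "i < n"
      | "2 \<le> n" "r = rel_word [0, 1, 0, 1] [1, 0, 1, 0]"
      | i where "r = rel_word [i, i + 1, i] [i + 1, i, i + 1]" "1 \<le> i" "i + 1 < n"
      | i j where "r = rel_word [i, j] [j, i]" "i + 1 < j" "j < n"
      using r unfolding Rel_eq by (auto split: if_splits)
    then show "ev (\<lambda>w. g (u @ w @ v)) r = 0"
    proof cases
      case 1 then show ?thesis using d(1) by (simp add: rel_order)
    next
      case 2 then show ?thesis using d(2) by (simp add: rel_quad)
    next
      case 3 then show ?thesis using d(3) by (simp add: rel_word)
    next
      case 4 then show ?thesis using d(4) by (simp add: rel_word)
    next
      case 5 then show ?thesis using d(5)[OF 5(2,3)] by (simp add: rel_word)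
    qed
  qed
next
  assume a: "\<forall>r\<in>Rel. \<forall>u v. set u \<subseteq> {..<n} \<longrightarrow> set v \<subseteq> {..<n} \<longrightarrow> ev (\<lambda>w. g (u @ w @ v)) r = 0"
  show "ak_functional l n x Q g"
    unfolding ak_functional_def
  proof (intro allI impI conjI)
    fix u v assume uv: "set u \<subseteq> {..<n}" "set v \<subseteq> {..<n}"
    have z: "ev (\<lambda>w. g (u @ w @ v)) r = 0" if "r \<in> Rel" for r using a that uv by blast
    show "(\<Sum>i\<le>l. coeff (\<Prod>j<l. [:- Q j, 1:]) i * g (u @ replicate i 0 @ v)) = 0"
      using z[of rel_order] unfolding rel_order Rel_eq by simp
    show "g (u @ [i, i] @ v) = (x - 1) * g (u @ [i] @ v) + x * g (u @ v)" if "1 \<le> i" "i < n" for i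
    proof -
      have "rel_quad i \<in> Rel" unfolding Rel_eq using that by blast
      from z[OF this] show ?thesis unfolding rel_quad(2)[OF that(2)] by simp
    qed
    show "g (u @ [0, 1, 0, 1] @ v) = g (u @ [1, 0, 1, 0] @ v)" if "2 \<le> n"
    proof -
      have "rel_word [0, 1, 0, 1] [1, 0, 1, 0] \<in> Rel" unfolding Rel_eq using that by simp
      from z[OF this] show ?thesis using that by (simp add: rel_word)
    qed
    show "g (u @ [i, i + 1, i] @ v) = g (u @ [i + 1, i, i + 1] @ v)" if "1 \<le> i" "i + 1 < n" for i
    proof -
      have "rel_word [i, i + 1, i] [i + 1, i, i + 1] \<in> Rel" unfolding Rel_eq using that by blast
      from z[OF this] show ?thesis using that by (simp add: rel_word)
    qed
    show "g (u @ [i, j] @ v) = g (u @ [j, i] @ v)" if "i + 1 < j" "j < n" for i j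
    proof -
      have "rel_word [i, j] [j, i] \<in> Rel" unfolding Rel_eq using that by blast
      from z[OF this] show ?thesis using that by (simp add: rel_word)
    qed
  qed
qed

lemma J_ideal: "ideal J R"
  unfolding ak_ideal_def by (rule R.genideal_ideal[OF Rel_carrier])

sublocale J: ideal J R
  by (rule J_ideal)

text \<open>The elements killed in every context u, v form an ideal, because multiplication by a
  further element only enlarges the context. This ideal contains the relations, hence J.\<close>

lemma J_kernel:
  assumes g: "ak_functional l n x Q g" and f: "f \<in> J" and "set u \<subseteq> {..<n}" "set v \<subseteq> {..<n}"
  shows "ev (\<lambda>w. g (u @ w @ v)) f = 0"
proof -
  define K where "K = {f \<in> carrier R. \<forall>u v. set u \<subseteq> {..<n} \<longrightarrow> set v \<subseteq> {..<n} \<longrightarrow> ev (\<lambda>w. g (u @ w @ v)) f = 0}"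
  have ev0: "ev h f = 0" if "f \<in> carrier R" "\<And>w. set w \<subseteq> {..<n} \<Longrightarrow> h w = 0" for h f
    using ev_cong[OF that(1), of h "\<lambda>_. 0"] that(2) by (simp add: ev_def)
  have "ideal K R"
  proof (rule idealI[OF R_ring])
    show "subgroup K (add_monoid R)"
    proof (rule group.subgroupI[OF R.a_group])
      show "K \<subseteq> carrier (add_monoid R)" by (auto simp: K_def)
      have "\<zero>\<^bsub>R\<^esub> \<in> K" unfolding K_def using R.zero_closed by (simp add: ev_def R_simps(4))
      then show "K \<noteq> {}" by auto
      fix a b assume a: "a \<in> K" and b: "b \<in> K"
      have ca: "a \<in> carrier R" "b \<in> carrier R" using a b by (auto simp: K_def)
      have "\<ominus>\<^bsub>R\<^esub> a \<in> K"
        using a R.a_inv_closed[OF ca(1)] unfolding R_neg[OF ca(1)] K_def by (auto simp: ev_uminus)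
      then show "inv\<^bsub>add_monoid R\<^esub> a \<in> K" by (simp add: a_inv_def)
      have "a \<oplus>\<^bsub>R\<^esub> b \<in> K" using a b R.a_closed[OF ca] unfolding K_def by (auto simp: ev_plus[OF ca])
      then show "a \<otimes>\<^bsub>add_monoid R\<^esub> b \<in> K" by simp
    qed
  next
    fix a y assume a: "a \<in> K" and y: "y \<in> carrier R"
    have ca: "a \<in> carrier R" using a by (simp add: K_def)
    have za: "ev (\<lambda>w. g (u @ w @ v)) a = 0" if "set u \<subseteq> {..<n}" "set v \<subseteq> {..<n}" for u v
      using a that unfolding K_def by blast
    have "ev (\<lambda>w. g (u @ w @ v)) (y \<otimes>\<^bsub>R\<^esub> a) = 0" if "set u \<subseteq> {..<n}" "set v \<subseteq> {..<n}" for u v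
      unfolding ev_mult[OF y ca] by (rule ev0[OF y]) (use za[of "u @ _" v] that in simp)
    then show "y \<otimes>\<^bsub>R\<^esub> a \<in> K" unfolding K_def using R.m_closed[OF y ca] by simp
    have "ev (\<lambda>w. g (u @ w @ v)) (a \<otimes>\<^bsub>R\<^esub> y) = 0" if uv: "set u \<subseteq> {..<n}" "set v \<subseteq> {..<n}" for u v
    proof -
      have fin: "finite {w. y w \<noteq> 0}" "finite {w. a w \<noteq> 0}" using R_fin y ca by auto
      have "ev (\<lambda>w. g (u @ w @ v)) (a \<otimes>\<^bsub>R\<^esub> y) = (\<Sum>w' | a w' \<noteq> 0. \<Sum>w | y w \<noteq> 0. y w * (a w' * g (u @ w' @ w @ v)))"
        unfolding ev_mult[OF ca y] unfolding ev_def by (simp add: sum_distrib_left mult_ac)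
      also have "\<dots> = (\<Sum>w | y w \<noteq> 0. y w * ev (\<lambda>w'. g (u @ w' @ w @ v)) a)"
        unfolding ev_def sum_distrib_left by (rule sum.swap)
      also have "\<dots> = 0"
      proof (rule sum.neutral, rule ballI)
        fix w assume "w \<in> {w. y w \<noteq> 0}"
        then have "set (w @ v) \<subseteq> {..<n}" using y uv by (auto simp: R_simps(1))
        then show "y w * ev (\<lambda>w'. g (u @ w' @ w @ v)) a = 0" using za[OF uv(1)] by simp
      qed
      finally show ?thesis .
    qed
    then show "a \<otimes>\<^bsub>R\<^esub> y \<in> K" unfolding K_def using R.m_closed[OF ca y] by simp
  qed
  moreover have "Rel \<subseteq> K"
  proof
    fix r assume r: "r \<in> Rel"
    have "\<forall>u v. set u \<subseteq> {..<n} \<longrightarrow> set v \<subseteq> {..<n} \<longrightarrow> ev (\<lambda>w. g (u @ w @ v)) r = 0"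
      using g[unfolded functional_iff] r by (rule bspec)
    then show "r \<in> K" unfolding K_def using Rel_carrier r by blast
  qed
  ultimately have "J \<subseteq> K" unfolding ak_ideal_def by (rule R.genideal_minimal)
  then show ?thesis using f assms(3,4) unfolding K_def by blast
qed


lemma cls_hom: "cls \<in> ring_hom R H"
proof -
  have "cls = (+>\<^bsub>R\<^esub>) J" by (rule ext) (simp add: ak_class_def)
  then show ?thesis unfolding ak_algebra_def using J.rcos_ring_hom by simp
qed

lemma H_ring: "ring H"
  unfolding ak_algebra_def by (rule J.quotient_is_ring)

lemma H_carrier: "carrier H = cls ` carrier R"
  unfolding ak_algebra_def FactRing_def A_RCOSETS_def' ak_class_def by auto

lemma cls_closed: "f \<in> carrier R \<Longrightarrow> cls f \<in> carrier H"
  unfolding H_carrier by (rule imageI)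

lemma cls_mult: "f \<in> carrier R \<Longrightarrow> h \<in> carrier R \<Longrightarrow> cls f \<otimes>\<^bsub>H\<^esub> cls h = cls (f \<otimes>\<^bsub>R\<^esub> h)"
  using ring_hom_mult[OF cls_hom] by simp

lemma cls_add: "f \<in> carrier R \<Longrightarrow> h \<in> carrier R \<Longrightarrow> cls f \<oplus>\<^bsub>H\<^esub> cls h = cls (f \<oplus>\<^bsub>R\<^esub> h)"
  using ring_hom_add[OF cls_hom] by simp

lemma cls_one: "\<one>\<^bsub>H\<^esub> = cls \<one>\<^bsub>R\<^esub>"
  using ring_hom_one[OF cls_hom] by simp

lemma cls_J: "f \<in> J \<Longrightarrow> cls f = \<zero>\<^bsub>H\<^esub>"
  unfolding ak_class_def ak_algebra_def FactRing_def
  using R.a_coset_join2[OF J.Icarr J.a_subgroup] by simp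

text \<open>Two representatives of a class differ by an element of J, on which g vanishes, so the
  image is a singleton. Used both for the form induced by the candidate and for the
  characters.\<close>

lemma class_value:
  assumes g: "ak_functional l n x Q g" and f: "f \<in> carrier R"
    and phi: "\<And>h. h \<in> carrier R \<Longrightarrow> phi h = ev g h"
  shows "the_elem (phi ` cls f) = ev g f"
proof -
  have "phi h = ev g f" if h: "h \<in> cls f" for h
  proof -
    obtain i where i: "i \<in> J" "h = i \<oplus>\<^bsub>R\<^esub> f" using h unfolding ak_class_def a_r_coset_def' by auto
    have ci: "i \<in> carrier R" using i(1) by (rule J.Icarr)
    have "ev g i = 0" using J_kernel[OF g i(1), of "[]" "[]"] by simp
    then show ?thesis using ev_plus[OF ci f, of g] phi[OF R.a_closed[OF ci f]] i(2) by simp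
  qed
  moreover have "f \<in> cls f" unfolding ak_class_def using R.a_rcosI[of "\<zero>\<^bsub>R\<^esub>" J f] f J.a_subset J.zero_closed by simp
  ultimately have "phi ` cls f = {ev g f}" by auto
  then show ?thesis by simp
qed

text \<open>Additivity and homogeneity recover the form from its values on words, by induction on a
  finite set containing the support. The functional equations hold because the form is constant on
  classes and translated relations lie in J.\<close>

lemma linear_form_functional:
  assumes phi: "ak_linear_form F l n x Q phi"
  defines "g \<equiv> \<lambda>w. phi (cls (word_elt w))"
  shows "h \<in> carrier R \<Longrightarrow> phi (cls h) = ev g h" "ak_functional l n x Q g"
proof -
  have add: "phi (cls a \<oplus>\<^bsub>H\<^esub> cls b) = phi (cls a) + phi (cls b)" if "a \<in> carrier R" "b \<in> carrier R" for a b
    using phi cls_closed that unfolding ak_linear_form_def by blast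
  have scale: "phi (cls (scalar_elt c) \<otimes>\<^bsub>H\<^esub> cls a) = c * phi (cls a)" if "c \<in> F" "a \<in> carrier R" for c a
    using phi cls_closed that unfolding ak_linear_form_def by blast
  have ev: "phi (cls h) = ev g h" if h: "h \<in> carrier R" for h
  proof -
    have "\<forall>h. h \<in> carrier R \<longrightarrow> {w. h w \<noteq> 0} \<subseteq> A \<longrightarrow> phi (cls h) = ev g h" if "finite A" for A
      using that
    proof (induction A rule: finite_induct)
      case empty
      show ?case
      proof (intro allI impI)
        fix h assume h: "h \<in> carrier R" "{w. h w \<noteq> 0} \<subseteq> {}"
        then have h0: "h = \<zero>\<^bsub>R\<^esub>" by (auto simp: R_simps(4))
        have "phi (cls h) = phi (cls h) + phi (cls h)"
          using add[OF h(1) h(1)] cls_add[OF h(1) h(1)] R.r_zero[OF R.zero_closed] h0 by simp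
        then have "phi (cls h) = 0" by (simp only: add_cancel_right_right)
        moreover have "ev g h = 0" unfolding h0 by (simp add: ev_def R_simps(4))
        ultimately show "phi (cls h) = ev g h" by simp
      qed
    next
      case (insert a A)
      show ?case
      proof (intro allI impI)
        fix h assume h: "h \<in> carrier R" "{w. h w \<noteq> 0} \<subseteq> insert a A"
        show "phi (cls h) = ev g h"
        proof (cases "h a = 0")
          case True
          then have "{w. h w \<noteq> 0} \<subseteq> A" using h(2) by auto
          then show ?thesis using insert.IH h(1) by blast
        next
          case False
          have sa: "set a \<subseteq> {..<n}" and ha: "h a \<in> F" using h(1) False by (auto simp: R_simps(1))
          define h' where "h' = h(a := 0)"
          have fin: "finite {w. h' w \<noteq> 0}"
            by (rule finite_subset[of _ "{w. h w \<noteq> 0}"]) (use R_fin[OF h(1)] in \<open>auto simp: h'_def\<close>)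
          have h': "h' \<in> carrier R" using h(1) fin by (auto simp: R_simps(1) h'_def F0)
          have m: "scalar_elt (h a) \<otimes>\<^bsub>R\<^esub> word_elt a = monom_elt (h a) a"
            unfolding scalar_elt_monom word_elt_monom using monom_mult[OF ha F1 _ sa, of "[]"] by simp
          have mc: "monom_elt (h a) a \<in> carrier R" using ha sa by (rule monom_carrier)
          have "h = monom_elt (h a) a \<oplus>\<^bsub>R\<^esub> h'"
            unfolding R_simps(5) by (auto simp: h'_def monom_elt_def)
          then have "phi (cls h) = phi (cls (monom_elt (h a) a)) + phi (cls h')" "ev g h = h a * g a + ev g h'"
            using add[OF mc h'] cls_add[OF mc h'] ev_plus[OF mc h', of g] ev_monom[of g "h a" a] by simp_all
          moreover have "phi (cls (monom_elt (h a) a)) = h a * g a"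
            using scale[OF ha word_carrier[OF sa]] cls_mult[OF scalar_carrier[OF ha] word_carrier[OF sa]] m
            by (simp add: g_def)
          moreover have "{w. h' w \<noteq> 0} \<subseteq> A" using h(2) by (auto simp: h'_def)
          then have "phi (cls h') = ev g h'" using insert.IH h' by blast
          ultimately show ?thesis by simp
        qed
      qed
    qed
    then show ?thesis using h R_fin[OF h] by blast
  qed
  then show "h \<in> carrier R \<Longrightarrow> phi (cls h) = ev g h" .
  show "ak_functional l n x Q g"
    unfolding functional_iff
  proof (intro ballI allI impI)
    fix r u v assume r: "r \<in> Rel" and u: "set u \<subseteq> {..<n}" and v: "set v \<subseteq> {..<n}"
    have rc: "r \<in> carrier R" using Rel_carrier r by auto
    have c: "word_elt u \<in> carrier R" "word_elt v \<in> carrier R" using u v word_carrier by auto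
    have rv: "r \<otimes>\<^bsub>R\<^esub> word_elt v \<in> carrier R" using rc c by simp
    have "r \<in> J" unfolding ak_ideal_def using R.genideal_self[OF Rel_carrier] r by auto
    then have "word_elt u \<otimes>\<^bsub>R\<^esub> (r \<otimes>\<^bsub>R\<^esub> word_elt v) \<in> J"
      using c by (intro J.I_l_closed J.I_r_closed)
    then have "cls (word_elt u \<otimes>\<^bsub>R\<^esub> (r \<otimes>\<^bsub>R\<^esub> word_elt v)) = cls \<zero>\<^bsub>R\<^esub>"
      using cls_J J.zero_closed by simp
    then have "ev g (word_elt u \<otimes>\<^bsub>R\<^esub> (r \<otimes>\<^bsub>R\<^esub> word_elt v)) = ev g \<zero>\<^bsub>R\<^esub>"
      using ev[OF R.m_closed[OF c(1) rv]] ev[OF R.zero_closed] by simp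
    also have "ev g \<zero>\<^bsub>R\<^esub> = 0" by (simp add: ev_def R_simps(4))
    also have "ev g (word_elt u \<otimes>\<^bsub>R\<^esub> (r \<otimes>\<^bsub>R\<^esub> word_elt v)) = ev (\<lambda>w. g (u @ w @ v)) r"
      unfolding ev_mult[OF c(1) rv] ev_word ev_mult[OF rc c(2)] ..
    finally show "ev (\<lambda>w. g (u @ w @ v)) r = 0" .
  qed
qed

text \<open>The powers of x in the L_k that \<open>jm_powers\<close> leaves out. The product is
  nonzero, and it is 1 when all exponents are 0, so the prescribed values 0 and 1 are the same with
  or without it.\<close>

definition jm_scalar :: "(nat \<Rightarrow> nat) \<Rightarrow> nat \<Rightarrow> 'a" where
  "jm_scalar c m = (\<Prod>k=1..m. (x powi (1 - int k)) ^ c k)"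

lemma Fpower: "a \<in> F \<Longrightarrow> a ^ k \<in> F"
  by (induction k) (auto intro: F1 Fmult)

lemma Fpowi: "a \<in> F \<Longrightarrow> a powi k \<in> F"
  by (auto simp: power_int_def intro: Fpower Finv)

lemma Fprod: "(\<And>i. i \<in> A \<Longrightarrow> f i \<in> F) \<Longrightarrow> prod f A \<in> F"
  by (induction A rule: infinite_finite_induct) (auto intro: F1 Fmult)

lemma jm_scalar_F: "jm_scalar c m \<in> F"
  unfolding jm_scalar_def by (intro Fprod Fpower Fpowi xF)

lemma jucys_murphy_cls:
  assumes "1 \<le> k" "k \<le> n"
  shows "jucys_murphy F l n x Q k = cls (monom_elt (x powi (1 - int k)) (jm_word k))"
proof -
  have s: "x powi (1 - int k) \<in> F" by (rule Fpowi[OF xF])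
  have w: "set (jm_word k) \<subseteq> {..<n}" using jm_word_letters_less[OF assms] .
  show ?thesis
    unfolding jucys_murphy_def jm_word_def[symmetric]
    using cls_mult[OF scalar_carrier[OF s] word_carrier[OF w]] monom_mult[OF s F1 _ w, of "[]"]
    by (simp add: scalar_elt_monom word_elt_monom)
qed

lemma cls_monom_power:
  assumes "s \<in> F" "set w \<subseteq> {..<n}"
  shows "cls (monom_elt s w) [^]\<^bsub>H\<^esub> (e::nat) = cls (monom_elt (s ^ e) (concat (replicate e w)))"
proof (induction e)
  case 0
  interpret H: ring H by (rule H_ring)
  show ?case using cls_one by (simp add: R_simps(3))
next
  case (Suc e)
  interpret H: ring H by (rule H_ring)
  have w: "set (concat (replicate e w)) \<subseteq> {..<n}" using assms(2) by (rule set_wpow)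
  have "concat (replicate (Suc e) w) = concat (replicate e w) @ w"
    using replicate_add[of e 1 w] by (metis Suc_eq_plus1 append_Nil2 concat.simps concat_append replicate.simps One_nat_def)
  then show ?case
    using Suc cls_mult[OF monom_carrier[OF Fpower[OF assms(1)] w] monom_carrier[OF assms], of e]
      monom_mult[OF Fpower[OF assms(1)] assms(1) w assms(2), of e]
    by (simp add: mult.commute)
qed

text \<open>The fold starts from an arbitrary monomial because the list grows at its right end,
  which changes the starting value of \<open>foldr\<close>.\<close>

lemma cls_jm_powers:
  assumes "m \<le> n" "s \<in> F" "set w \<subseteq> {..<n}"
  shows "foldr (monoid.mult H) (map (\<lambda>k. jucys_murphy F l n x Q k [^]\<^bsub>H\<^esub> c k) [1..<Suc m]) (cls (monom_elt s w)) =
    cls (monom_elt (jm_scalar c m * s) (jm_powers c m @ w))"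
  using assms
proof (induction m arbitrary: s w)
  case 0
  then show ?case by (simp add: jm_scalar_def)
next
  case (Suc m)
  let ?p = "x powi (1 - int (Suc m))" and ?W = "concat (replicate (c (Suc m)) (jm_word (Suc m)))"
  have p: "?p ^ c (Suc m) \<in> F" by (intro Fpower Fpowi xF)
  have jw: "set (jm_word (Suc m)) \<subseteq> {..<n}" using Suc.prems by (intro jm_word_letters_less) auto
  have W: "set ?W \<subseteq> {..<n}" using jw by (rule set_wpow)
  have "jucys_murphy F l n x Q (Suc m) [^]\<^bsub>H\<^esub> c (Suc m) = cls (monom_elt (?p ^ c (Suc m)) ?W)"
    using jucys_murphy_cls[of "Suc m"] cls_monom_power[OF Fpowi[OF xF] jw] Suc.prems by simp
  then have step: "jucys_murphy F l n x Q (Suc m) [^]\<^bsub>H\<^esub> c (Suc m) \<otimes>\<^bsub>H\<^esub> cls (monom_elt s w) =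
      cls (monom_elt (?p ^ c (Suc m) * s) (?W @ w))"
    using cls_mult[OF monom_carrier[OF p W] monom_carrier[OF Suc.prems(2,3)]] monom_mult[OF p Suc.prems(2) W Suc.prems(3)]
    by simp
  have sF: "?p ^ c (Suc m) * s \<in> F" using p Suc.prems by (intro Fmult)
  have wl: "set (?W @ w) \<subseteq> {..<n}" using W Suc.prems(3) unfolding set_append by (rule Un_least)
  have "[1..<Suc (Suc m)] = [1..<Suc m] @ [Suc m]" by simp
  then have "foldr (monoid.mult H) (map (\<lambda>k. jucys_murphy F l n x Q k [^]\<^bsub>H\<^esub> c k) [1..<Suc (Suc m)]) (cls (monom_elt s w)) =
     foldr (monoid.mult H) (map (\<lambda>k. jucys_murphy F l n x Q k [^]\<^bsub>H\<^esub> c k) [1..<Suc m])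
       (jucys_murphy F l n x Q (Suc m) [^]\<^bsub>H\<^esub> c (Suc m) \<otimes>\<^bsub>H\<^esub> cls (monom_elt s w))"
    by (simp del: upt_Suc)
  also have "\<dots> = cls (monom_elt (jm_scalar c m * (?p ^ c (Suc m) * s)) (jm_powers c m @ (?W @ w)))"
    unfolding step using Suc.IH[OF _ sF wl] Suc.prems by simp
  also have "jm_scalar c m * (?p ^ c (Suc m) * s) = jm_scalar c (Suc m) * s" by (simp add: jm_scalar_def mult.assoc)
  finally show ?case by (simp only: jm_powers_Suc append_assoc)
qed

lemma basis_elt_cls:
  assumes "w permutes {1..n}"
  shows "ak_basis_elt F l n x Q c w =
    cls (monom_elt (jm_scalar c n) (jm_powers c n @ (SOME ks. reduced_expr n w ks)))"
    and "set (SOME ks. reduced_expr n w ks) \<subseteq> {..<n}" "reduced_expr n w (SOME ks. reduced_expr n w ks)"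
proof -
  obtain ks0 where "set ks0 \<subseteq> {1..<n}" "word_perm ks0 = w" using permutation_has_word[OF assms] by blast
  then have "\<exists>ks. reduced_expr n w ks" using reduced_expr_exists by blast
  then show red: "reduced_expr n w (SOME ks. reduced_expr n w ks)" by (rule someI_ex)
  define ks where "ks = (SOME ks. reduced_expr n w ks)"
  have "set ks \<subseteq> {1..<n}" using red unfolding ks_def reduced_expr_def by blast
  then have k: "set ks \<subseteq> {..<n}" by (rule subset_trans) auto
  then show "set (SOME ks. reduced_expr n w ks) \<subseteq> {..<n}" unfolding ks_def .
  interpret H: ring H by (rule H_ring)
  have one: "monom_elt 1 [] \<in> carrier R" by (rule monom_carrier[OF F1]) simp
  have jp: "set (jm_powers c n) \<subseteq> {..<n}" by (rule jm_powers_letters) simp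
  have "list_prod H (map (\<lambda>k. jucys_murphy F l n x Q k [^]\<^bsub>H\<^esub> c k) [1..<Suc n]) =
      cls (monom_elt (jm_scalar c n) (jm_powers c n))"
    unfolding list_prod_def cls_one R_simps(3) using cls_jm_powers[OF order_refl F1, of "[]"] by simp
  then show "ak_basis_elt F l n x Q c w =
    cls (monom_elt (jm_scalar c n) (jm_powers c n @ (SOME ks. reduced_expr n w ks)))"
    unfolding ak_basis_elt_def T_perm_def ks_def[symmetric] word_elt_monom
    using cls_mult[OF monom_carrier[OF jm_scalar_F jp] monom_carrier[OF F1 k]] monom_mult[OF jm_scalar_F F1 jp k]
    by simp
qed

text \<open>The form induced by g satisfies the description. A second one differs from it by a
  functional vanishing on all L^c T_w, hence by zero according to \<open>functional_zero\<close>;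
  being extensional, both also agree outside the carrier.\<close>

lemma ak_tau_value:
  assumes g: "ak_functional l n x Q g" and gF: "\<And>w. set w \<subseteq> {..<n} \<Longrightarrow> g w \<in> F"
    and val: "\<And>c w. (\<And>k. k \<in> {1..n} \<Longrightarrow> c k < l) \<Longrightarrow> w permutes {1..n} \<Longrightarrow>
      g (jm_powers c n @ (SOME ks. reduced_expr n w ks)) = (if (\<forall>k\<in>{1..n}. c k = 0) \<and> w = id then 1 else 0)"
    and f: "f \<in> carrier R"
  shows "ak_tau F l n x Q (cls f) = ev g f"
proof -
  define P where "P \<phi> \<longleftrightarrow> ak_linear_form F l n x Q \<phi> \<and>
     (\<forall>c w. (\<forall>k\<in>{1..n}. c k < l) \<and> w permutes {1..n} \<longrightarrow>
        \<phi> (ak_basis_elt F l n x Q c w) = (if (\<forall>k\<in>{1..n}. c k = 0) \<and> w = id then 1 else 0))" for \<phi>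
  define \<phi> where "\<phi> = restrict (\<lambda>h. the_elem (ev g ` h)) (carrier H)"
  have \<phi>_cls: "\<phi> (cls h) = ev g h" if "h \<in> carrier R" for h
    unfolding \<phi>_def using class_value[OF g that, of "ev g"] cls_closed[OF that] by simp
  have sc: "jm_scalar c n \<noteq> 0" for c unfolding jm_scalar_def using x_nonzero by (simp add: prod_zero_iff)
  have sc1: "jm_scalar c n = 1" if "\<forall>k\<in>{1..n}. c k = 0" for c
    unfolding jm_scalar_def using that by (intro prod.neutral) auto
  have wl: "set (jm_powers c n @ (SOME ks. reduced_expr n w ks)) \<subseteq> {..<n}" if "w permutes {1..n}" for c w
    unfolding set_append by (intro Un_least jm_powers_letters basis_elt_cls(2)[OF that]) simp
  have "P \<phi>"
    unfolding P_def
  proof (intro conjI allI impI)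
    have evF: "ev g h \<in> F" if "h \<in> carrier R" for h
      unfolding ev_def using that by (intro Fsum Fmult gF) (auto simp: R_simps(1))
    show "ak_linear_form F l n x Q \<phi>"
      unfolding ak_linear_form_def
    proof (intro conjI ballI)
      show "\<phi> \<in> carrier H \<rightarrow>\<^sub>E F"
        using \<phi>_cls evF by (auto simp: \<phi>_def H_carrier)
      fix a b assume "a \<in> carrier H" "b \<in> carrier H"
      then obtain f h where fh: "f \<in> carrier R" "h \<in> carrier R" "a = cls f" "b = cls h" by (auto simp: H_carrier)
      show "\<phi> (a \<oplus>\<^bsub>H\<^esub> b) = \<phi> a + \<phi> b"
        unfolding fh(3,4) cls_add[OF fh(1,2)] \<phi>_cls[OF R.a_closed[OF fh(1,2)]] \<phi>_cls[OF fh(1)] \<phi>_cls[OF fh(2)]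
        by (rule ev_plus[OF fh(1,2)])
    next
      fix c a assume c: "c \<in> F" and "a \<in> carrier H"
      then obtain f where fh: "f \<in> carrier R" "a = cls f" by (auto simp: H_carrier)
      have sc: "scalar_elt c \<in> carrier R" using c by (rule scalar_carrier)
      show "\<phi> (cls (scalar_elt c) \<otimes>\<^bsub>H\<^esub> a) = c * \<phi> a"
        unfolding fh(2) cls_mult[OF sc fh(1)] \<phi>_cls[OF R.m_closed[OF sc fh(1)]] \<phi>_cls[OF fh(1)] ev_mult[OF sc fh(1)] ev_scalar
        by simp
    qed
    fix c w assume cw: "(\<forall>k\<in>{1..n}. c k < l) \<and> w permutes {1..n}"
    then have w: "w permutes {1..n}" by blast
    have "\<phi> (ak_basis_elt F l n x Q c w) = jm_scalar c n * g (jm_powers c n @ (SOME ks. reduced_expr n w ks))"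
      unfolding basis_elt_cls(1)[OF w] \<phi>_cls[OF monom_carrier[OF jm_scalar_F wl[OF w]]] ev_monom ..
    then show "\<phi> (ak_basis_elt F l n x Q c w) = (if (\<forall>k\<in>{1..n}. c k = 0) \<and> w = id then 1 else 0)"
      using val[of c w] cw sc1[of c] by simp
  qed
  moreover have "\<psi> = \<phi>" if "P \<psi>" for \<psi>
  proof -
    have lf: "ak_linear_form F l n x Q \<psi>" using that by (simp add: P_def)
    define h where "h = (\<lambda>w. \<psi> (cls (word_elt w)))"
    note hf = linear_form_functional[OF lf, folded h_def]
    have eq: "h w - g w = 0" if "set w \<subseteq> {..<n}" for w
    proof (rule functional_zero[OF functional_diff[OF hf(2) g] x_nonzero n_pos l_ge_1 _ that])
      fix c w assume c: "\<And>k. k \<in> {1..n} \<Longrightarrow> c k < l" and w: "w permutes {1..n}"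
      let ?v = "if (\<forall>k\<in>{1..n}. c k = 0) \<and> w = id then 1 else (0::'a)"
      have "\<psi> (ak_basis_elt F l n x Q c w) = ?v" using \<open>P \<psi>\<close> c w unfolding P_def by blast
      moreover have "\<psi> (ak_basis_elt F l n x Q c w) = jm_scalar c n * h (jm_powers c n @ (SOME ks. reduced_expr n w ks))"
        unfolding basis_elt_cls(1)[OF w] hf(1)[OF monom_carrier[OF jm_scalar_F wl[OF w]]] ev_monom ..
      ultimately have "h (jm_powers c n @ (SOME ks. reduced_expr n w ks)) = ?v"
        using sc[of c] sc1[of c] by (auto split: if_splits)
      then show "h (jm_powers c n @ (SOME ks. reduced_expr n w ks)) - g (jm_powers c n @ (SOME ks. reduced_expr n w ks)) = 0"
        using val[OF c w] by simp
    qed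
    have "\<psi> a = \<phi> a" if "a \<in> carrier H" for a
    proof -
      obtain f where f: "f \<in> carrier R" "a = cls f" using \<open>a \<in> carrier H\<close> by (auto simp: H_carrier)
      have "ev h f = ev g f" by (rule ev_cong[OF f(1)]) (use eq in simp)
      then show ?thesis unfolding f(2) hf(1)[OF f(1)] \<phi>_cls[OF f(1)] .
    qed
    moreover have "\<psi> \<in> extensional (carrier H)" using lf unfolding ak_linear_form_def PiE_def by blast
    moreover have "\<phi> \<in> extensional (carrier H)" by (simp add: \<phi>_def)
    ultimately show ?thesis by (intro extensionalityI[of _ "carrier H"])
  qed
  ultimately have "(THE \<phi>. P \<phi>) = \<phi>" by (rule the_equality)
  then have "ak_tau F l n x Q = \<phi>" unfolding ak_tau_def P_def .
  then show ?thesis using \<phi>_cls[OF f] by simp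
qed

end

section \<open>Multipartitions and diagrams\<close>

lemma finite_partition_support: "is_partition p \<Longrightarrow> finite {i. i \<ge> 1 \<and> p i \<noteq> 0}"
  unfolding is_partition_def by (elim conjE) (erule finite_subset[rotated], auto)

lemma nodes_Sigma: "nodes p = (SIGMA i:{i. i \<ge> 1 \<and> p i \<noteq> 0}. {1..p i})"
  by (auto simp: nodes_def)

lemma nodes_finite: "is_partition p \<Longrightarrow> finite (nodes p)"
  unfolding nodes_Sigma by (intro finite_SigmaI finite_partition_support) auto

lemma card_nodes: "is_partition p \<Longrightarrow> card (nodes p) = psize p"
  unfolding nodes_Sigma psize_def using finite_partition_support by (subst card_SigmaI) auto

lemma partition_antimono:
  assumes "is_partition p" "1 \<le> i" "i \<le> i'"
  shows "p i' \<le> p i"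
  using assms(3,2,1) by (induction i' rule: dec_induct) (auto simp: is_partition_def intro: order_trans)

lemma mnodes_Sigma: "mnodes lam = (SIGMA s:{..<length lam}. nodes (lam ! s))"
  by (auto simp: mnodes_def)

lemma mem_mnodes: "(s, i, j) \<in> mnodes lam \<longleftrightarrow> s < length lam \<and> 1 \<le> i \<and> 1 \<le> j \<and> j \<le> (lam ! s) i"
  by (auto simp: mnodes_def nodes_def)

lemma multipartitionsD:
  assumes "lam \<in> multipartitions l n"
  shows "length lam = l" "s < l \<Longrightarrow> is_partition (lam ! s)" "(\<Sum>s<l. psize (lam ! s)) = n"
  using assms by (auto simp: multipartitions_def)

lemma mnodes_card:
  assumes "lam \<in> multipartitions l n"
  shows "finite (mnodes lam)" "card (mnodes lam) = n"
proof -
  note m = multipartitionsD[OF assms]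
  show "finite (mnodes lam)" unfolding mnodes_Sigma m(1) by (intro finite_SigmaI) (auto intro: nodes_finite m(2))
  have "card (mnodes lam) = (\<Sum>s<l. card (nodes (lam ! s)))"
    unfolding mnodes_Sigma m(1) using m(2) nodes_finite by (subst card_SigmaI) auto
  then show "card (mnodes lam) = n" using m(2,3) card_nodes by simp
qed

lemma mnodes_diagram:
  assumes "lam \<in> multipartitions l n"
  shows "diagram l (mnodes lam)"
  unfolding diagram_def
proof (intro conjI ballI, rule mnodes_card(1)[OF assms])
  fix N assume N: "N \<in> mnodes lam"
  obtain s i j where eq: "N = (s, i, j)" by (cases N)
  note m = multipartitionsD[OF assms]
  have d: "s < l" "1 \<le> i" "1 \<le> j" "j \<le> (lam ! s) i" using N unfolding eq mem_mnodes m(1) by auto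
  have "(lam ! s) i \<le> (lam ! s) (i - 1)" if "1 < i"
    using partition_antimono[OF m(2)[OF d(1)], of "i - 1" i] that by auto
  then show "case N of (s, i, j) \<Rightarrow> s < l \<and> 1 \<le> i \<and> 1 \<le> j \<and>
      (1 < i \<longrightarrow> (s, i - 1, j) \<in> mnodes lam) \<and> (1 < j \<longrightarrow> (s, i, j - 1) \<in> mnodes lam)"
    using d unfolding eq prod.case mem_mnodes m(1) by auto
qed

lemma row_len_mnodes: "s < length lam \<Longrightarrow> 1 \<le> i \<Longrightarrow> row_len (mnodes lam) s i = (lam ! s) i"
proof -
  assume a: "s < length lam" "1 \<le> i"
  have "{j. (s, i, j) \<in> mnodes lam} = {1..(lam ! s) i}" unfolding mem_mnodes using a by auto
  then show ?thesis by (simp add: row_len_def)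
qed

lemma col_len_mnodes: "s < length lam \<Longrightarrow> 1 \<le> j \<Longrightarrow> col_len (mnodes lam) s j = conjugate (lam ! s) j"
proof -
  assume a: "s < length lam" "1 \<le> j"
  have "{i. (s, i, j) \<in> mnodes lam} = {i. i \<ge> 1 \<and> (lam ! s) i \<ge> j}" unfolding mem_mnodes using a by auto
  then show ?thesis by (simp add: col_len_def conjugate_def)
qed

lemma bij_mnodes: "bij_betw mnodes (multipartitions l n) {D. diagram l D \<and> card D = n}"
  unfolding bij_betw_def
proof
  show "inj_on mnodes (multipartitions l n)"
  proof (rule inj_onI)
    fix lam mu assume lam: "lam \<in> multipartitions l n" and mu: "mu \<in> multipartitions l n"
      and eq: "mnodes lam = mnodes mu"
    note a = multipartitionsD[OF lam] and b = multipartitionsD[OF mu]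
    show "lam = mu"
    proof (rule nth_equalityI)
      show "length lam = length mu" using a(1) b(1) by simp
      fix s assume s: "s < length lam"
      then have s': "s < l" "s < length mu" using a(1) b(1) by auto
      show "lam ! s = mu ! s"
      proof
        fix i
        show "(lam ! s) i = (mu ! s) i"
        proof (cases "i = 0")
          case True
          then show ?thesis using a(2)[OF s'(1)] b(2)[OF s'(1)] by (simp add: is_partition_def)
        next
          case False
          then show ?thesis using row_len_mnodes[OF s, of i] row_len_mnodes[OF s'(2), of i] eq by simp
        qed
      qed
    qed
  qed
  show "mnodes ` multipartitions l n = {D. diagram l D \<and> card D = n}"
  proof
    show "mnodes ` multipartitions l n \<subseteq> {D. diagram l D \<and> card D = n}"
      using mnodes_diagram mnodes_card by auto
    show "{D. diagram l D \<and> card D = n} \<subseteq> mnodes ` multipartitions l n"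
    proof
      fix D assume "D \<in> {D. diagram l D \<and> card D = n}"
      then have D: "diagram l D" "card D = n" by auto
      define lam where "lam = map (\<lambda>s i. row_len D s i) [0..<l]"
      have len: "length lam = l" by (simp add: lam_def)
      have nth: "lam ! s = row_len D s" if "s < l" for s using that by (simp add: lam_def fun_eq_iff)
      have row0: "row_len D s 0 = 0" for s
      proof -
        have "{j. (s, 0, j) \<in> D} = {}" using diagram_memD(2)[OF D(1)] by fastforce
        then show ?thesis by (simp add: row_len_def)
      qed
      have part: "is_partition (row_len D s)" for s
        unfolding is_partition_def
      proof (intro conjI allI impI)
        show "row_len D s 0 = 0" by (rule row0)
        fix i :: nat assume "1 \<le> i"
        then show "row_len D s (Suc i) \<le> row_len D s i" using row_len_antimono[OF D(1)] by simp
      next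
        have "{i. row_len D s i \<noteq> 0} \<subseteq> (\<lambda>N. fst (snd N)) ` D"
        proof
          fix i assume "i \<in> {i. row_len D s i \<noteq> 0}"
          then have "(s, i, 1) \<in> D" using mem_diagram_row[OF D(1), of s i 1] by simp
          then show "i \<in> (\<lambda>N. fst (snd N)) ` D" by force
        qed
        then show "finite {i. row_len D s i \<noteq> 0}" using diagram_finite[OF D(1)] finite_subset by blast
      qed
      have mn: "mnodes lam = D"
      proof (intro Set.set_eqI iffI)
        fix N :: "nat \<times> nat \<times> nat"
        obtain s i j where N: "N = (s, i, j)" by (cases N)
        show "N \<in> D" if "N \<in> mnodes lam"
        proof -
          have "s < l" "1 \<le> j" "j \<le> (lam ! s) i" using that unfolding N mem_mnodes len by auto
          then show ?thesis unfolding N mem_diagram_row[OF D(1)] using nth by simp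
        qed
        show "N \<in> mnodes lam" if "N \<in> D"
        proof -
          have m: "s < l" "1 \<le> i" using diagram_memD(1,2)[OF D(1) that[unfolded N]] .
          then show ?thesis using that mem_diagram_row[OF D(1), of s i j] nth[OF m(1)] unfolding N mem_mnodes len by simp
        qed
      qed
      have "finite (nodes (lam ! s))" if "s < l" for s using nodes_finite[OF part] nth that by simp
      then have "card (mnodes lam) = (\<Sum>s<l. card (nodes (lam ! s)))"
        unfolding mnodes_Sigma len by (subst card_SigmaI) auto
      then have "(\<Sum>s<l. psize (lam ! s)) = n" using D(2) mn card_nodes[OF part] nth by simp
      then have "lam \<in> multipartitions l n" using len nth part by (simp add: multipartitions_def)
      then show "D \<in> mnodes ` multipartitions l n" using mn by blast
    qed
  qed
qed

text \<open>A node for which row plus column is maximal has no neighbour below or to the right, so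
  it can serve as the last node of a path.\<close>

lemma diagram_has_path: "diagram l D \<Longrightarrow> \<exists>P. P \<in> paths l D"
proof (induction "card D" arbitrary: D)
  case 0
  then have "D = {}" using diagram_finite by auto
  then show ?case by (auto simp: paths_def intro!: exI[of _ "[]"])
next
  case (Suc m)
  have fin: "finite D" using Suc.prems by (rule diagram_finite)
  have ne: "D \<noteq> {}" using Suc.hyps(2) by auto
  define w where "w N = fst (snd N) + snd (snd N)" for N :: "nat \<times> nat \<times> nat"
  have "Max (w ` D) \<in> w ` D" using fin ne by (intro Max_in) auto
  then obtain B where B: "B \<in> D" "w B = Max (w ` D)" by auto
  obtain s i j where eq: "B = (s, i, j)" by (cases B)
  have mx: "w N \<le> w B" if "N \<in> D" for N using that B fin by simp
  have "diagram l (D - {B})"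
    unfolding diagram_def
  proof (intro conjI ballI)
    show "finite (D - {B})" using fin by simp
    fix N assume N: "N \<in> D - {B}"
    obtain s' i' j' where N_eq: "N = (s', i', j')" by (cases N)
    have ND: "(s', i', j') \<in> D" using N N_eq by simp
    note d = diagram_memD[OF Suc.prems ND]
    have "i' + j' \<le> i + j" using mx[OF ND] by (simp add: w_def eq)
    then have "1 < i' \<longrightarrow> (s', i' - 1, j') \<noteq> B" "1 < j' \<longrightarrow> (s', i', j' - 1) \<noteq> B" by (auto simp: eq)
    then show "case N of (s, i, j) \<Rightarrow> s < l \<and> 1 \<le> i \<and> 1 \<le> j \<and>
      (1 < i \<longrightarrow> (s, i - 1, j) \<in> D - {B}) \<and> (1 < j \<longrightarrow> (s, i, j - 1) \<in> D - {B})"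
      using d unfolding N_eq by simp
  qed
  moreover have "m = card (D - {B})" using Suc.hyps(2) B(1) fin by simp
  ultimately obtain P where P: "P \<in> paths l (D - {B})" using Suc.hyps(1) by blast
  have sP: "set P = D - {B}" using P by (simp add: paths_def)
  have "insert B (D - {B}) = D" using B(1) by auto
  then have "P @ [B] \<in> paths l D" using P Suc.prems B(1) unfolding paths_snoc sP by (simp add: addable_def)
  then show ?case by blast
qed

lemma set_all_paths: "set ` all_paths l n = {D. diagram l D \<and> card D = n}"
proof
  show "set ` all_paths l n \<subseteq> {D. diagram l D \<and> card D = n}"
  proof
    fix D assume "D \<in> set ` all_paths l n"
    then obtain P where P: "P \<in> all_paths l n" "D = set P" by blast
    then have "P \<in> paths l D" "length P = n" by (auto simp: all_paths_iff)
    then show "D \<in> {D. diagram l D \<and> card D = n}" using paths_diagram paths_length by auto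
  qed
  show "{D. diagram l D \<and> card D = n} \<subseteq> set ` all_paths l n"
  proof
    fix D assume "D \<in> {D. diagram l D \<and> card D = n}"
    then have D: "diagram l D" "card D = n" by auto
    obtain P where P: "P \<in> paths l D" using diagram_has_path[OF D(1)] by blast
    then have "P \<in> all_paths l n" "set P = D" using paths_length[OF P] D(2) by (auto simp: all_paths_def paths_def)
    then show "D \<in> set ` all_paths l n" by blast
  qed
qed

lemma diagrams_finite: "finite {D. diagram l D \<and> card D = n}"
  unfolding set_all_paths[symmetric] by (rule finite_imageI[OF all_paths_finite])

text \<open>Each path of length n has one shape. This trades the sum over the characters for a sum
  from which the last node can be split off.\<close>

lemma sum_paths_by_shape:
  fixes f :: "_ \<Rightarrow> 'b::comm_monoid_add"
  shows "(\<Sum>lam\<in>multipartitions l n. \<Sum>P\<in>paths l (mnodes lam). f P) = (\<Sum>P\<in>all_paths l n. f P)"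
proof -
  have "(\<Sum>lam\<in>multipartitions l n. \<Sum>P\<in>paths l (mnodes lam). f P) =
      (\<Sum>D\<in>{D. diagram l D \<and> card D = n}. \<Sum>P\<in>paths l D. f P)"
    by (rule sum.reindex_bij_betw[OF bij_mnodes])
  also have "\<dots> = (\<Sum>D\<in>{D. diagram l D \<and> card D = n}. \<Sum>P\<in>{P \<in> all_paths l n. set P = D}. f P)"
  proof (rule sum.cong[OF refl])
    fix D assume "D \<in> {D. diagram l D \<and> card D = n}"
    then have "paths l D = {P \<in> all_paths l n. set P = D}" using paths_length by (auto simp: all_paths_def paths_def)
    then show "(\<Sum>P\<in>paths l D. f P) = (\<Sum>P\<in>{P \<in> all_paths l n. set P = D}. f P)" by simp
  qed
  also have "\<dots> = (\<Sum>P\<in>all_paths l n. f P)"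
    by (rule sum.group[OF all_paths_finite diagrams_finite]) (simp add: set_all_paths)
  finally show ?thesis .
qed

section \<open>Standard tableaux and paths\<close>

lemma std_tableau_zero: "T \<in> std_tableaux lam \<Longrightarrow> N \<notin> mnodes lam \<Longrightarrow> T N = 0"
  unfolding std_tableaux_def by blast

lemma path_from_nth: "path_from l {} P \<longleftrightarrow> (\<forall>k<length P. P ! k \<in> addable l (set (take k P)))"
proof (induction P rule: rev_induct)
  case (snoc A P)
  have "(\<forall>k<length (P @ [A]). (P @ [A]) ! k \<in> addable l (set (take k (P @ [A])))) \<longleftrightarrow>
      (\<forall>k<length P. P ! k \<in> addable l (set (take k P))) \<and> A \<in> addable l (set P)"
    by (auto simp: less_Suc_eq all_conj_distrib nth_append)
  then show ?case using snoc by (simp add: path_from_append)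
qed simp

context
  fixes l n :: nat and lam :: "(nat \<Rightarrow> nat) list"
  assumes lam: "lam \<in> multipartitions l n"
begin

definition tableau_path :: "tableau \<Rightarrow> (nat \<times> nat \<times> nat) list" where
  "tableau_path T = map (node_of lam T) [1..<Suc n]"

lemma length_tableau_path [simp]: "length (tableau_path T) = n"
  by (simp add: tableau_path_def)

lemma nth_tableau_path: "k < n \<Longrightarrow> tableau_path T ! k = node_of lam T (Suc k)"
  unfolding tableau_path_def by (subst nth_map) (auto simp del: upt_Suc)

lemma std_bij: "T \<in> std_tableaux lam \<Longrightarrow> bij_betw T (mnodes lam) {1..n}"
  using mnodes_card(2)[OF lam] by (simp add: std_tableaux_def)

lemma node_of_bij: "T \<in> std_tableaux lam \<Longrightarrow> bij_betw (node_of lam T) {1..n} (mnodes lam)"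
  unfolding node_of_def[abs_def] by (rule bij_betw_inv_into[OF std_bij])

lemma T_node_of: "T \<in> std_tableaux lam \<Longrightarrow> k \<in> {1..n} \<Longrightarrow> T (node_of lam T k) = k"
  unfolding node_of_def by (rule f_inv_into_f) (use std_bij bij_betw_imp_surj_on in blast)

lemma node_of_T: "T \<in> std_tableaux lam \<Longrightarrow> N \<in> mnodes lam \<Longrightarrow> node_of lam T (T N) = N"
  unfolding node_of_def by (rule inv_into_f_f) (use std_bij bij_betw_imp_inj_on in blast)+

lemma set_take_tableau_path:
  assumes T: "T \<in> std_tableaux lam" and k: "k \<le> n"
  shows "set (take k (tableau_path T)) = {N \<in> mnodes lam. T N \<le> k}"
proof -
  have "take k (tableau_path T) = map (node_of lam T) [1..<Suc k]"
    unfolding tableau_path_def take_map using k by (simp add: take_upt del: upt_Suc)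
  then have s: "set (take k (tableau_path T)) = node_of lam T ` {1..k}" by (simp add: atLeastLessThanSuc_atLeastAtMost del: upt_Suc)
  show ?thesis
  proof (intro Set.set_eqI iffI)
    fix N assume "N \<in> set (take k (tableau_path T))"
    then obtain m where m: "m \<in> {1..k}" "N = node_of lam T m" unfolding s by blast
    then have "m \<in> {1..n}" using k by simp
    then show "N \<in> {N \<in> mnodes lam. T N \<le> k}"
      using T_node_of[OF T] m bij_betwE[OF node_of_bij[OF T]] by simp
  next
    fix N assume "N \<in> {N \<in> mnodes lam. T N \<le> k}"
    then have N: "N \<in> mnodes lam" "T N \<le> k" by auto
    have "T N \<in> {1..n}" using bij_betwE[OF std_bij[OF T]] N(1) by blast
    then show "N \<in> set (take k (tableau_path T))" unfolding s using node_of_T[OF T N(1)] N(2) by (intro image_eqI[of _ _ "T N"]) auto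
  qed
qed

text \<open>Standardness says that the nodes with entries at most k form a diagram for every k; the
  node with entry k + 1 is then addable to it.\<close>

lemma tableau_path_in_paths:
  assumes T: "T \<in> std_tableaux lam"
  shows "tableau_path T \<in> paths l (mnodes lam)"
proof -
  have D: "diagram l (mnodes lam)" by (rule mnodes_diagram[OF lam])
  have sub: "diagram l {N \<in> mnodes lam. T N \<le> k}" for k
    unfolding diagram_def
  proof (intro conjI ballI)
    show "finite {N \<in> mnodes lam. T N \<le> k}" using mnodes_card(1)[OF lam] by simp
    fix N assume N: "N \<in> {N \<in> mnodes lam. T N \<le> k}"
    obtain s i j where eq: "N = (s, i, j)" by (cases N)
    have m: "(s, i, j) \<in> mnodes lam" "T (s, i, j) \<le> k" using N eq by auto
    note d = diagram_memD[OF D m(1)]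
    have "T (s, i - 1, j) < T (s, i, j)" if "1 < i"
    proof -
      have "(s, i - 1, j) \<in> mnodes lam \<and> (s, Suc (i - 1), j) \<in> mnodes lam \<longrightarrow> T (s, i - 1, j) < T (s, Suc (i - 1), j)"
        using T unfolding std_tableaux_def by blast
      then show ?thesis using d(4)[OF that] m(1) that by simp
    qed
    moreover have "T (s, i, j - 1) < T (s, i, j)" if "1 < j"
    proof -
      have "(s, i, j - 1) \<in> mnodes lam \<and> (s, i, Suc (j - 1)) \<in> mnodes lam \<longrightarrow> T (s, i, j - 1) < T (s, i, Suc (j - 1))"
        using T unfolding std_tableaux_def by blast
      then show ?thesis using d(5)[OF that] m(1) that by simp
    qed
    ultimately show "case N of (s, i, j) \<Rightarrow> s < l \<and> 1 \<le> i \<and> 1 \<le> j \<and>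
      (1 < i \<longrightarrow> (s, i - 1, j) \<in> {N \<in> mnodes lam. T N \<le> k}) \<and> (1 < j \<longrightarrow> (s, i, j - 1) \<in> {N \<in> mnodes lam. T N \<le> k})"
      using d m(2) unfolding eq by force
  qed
  have "path_from l {} (tableau_path T)"
    unfolding path_from_nth
  proof (intro allI impI)
    fix k assume "k < length (tableau_path T)"
    then have k: "k < n" by simp
    let ?N = "node_of lam T (Suc k)"
    have TN: "T ?N = Suc k" and ND: "?N \<in> mnodes lam"
      using T_node_of[OF T, of "Suc k"] bij_betwE[OF node_of_bij[OF T]] k by auto
    have "insert ?N {N \<in> mnodes lam. T N \<le> k} = {N \<in> mnodes lam. T N \<le> Suc k}"
    proof (intro Set.set_eqI iffI)
      fix M assume "M \<in> {N \<in> mnodes lam. T N \<le> Suc k}"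
      then have M: "M \<in> mnodes lam" "T M \<le> k \<or> T M = Suc k" by auto
      show "M \<in> insert ?N {N \<in> mnodes lam. T N \<le> k}"
        using M node_of_T[OF T M(1)] by auto
    qed (use TN ND in auto)
    then have "?N \<in> addable l {N \<in> mnodes lam. T N \<le> k}" using sub[of "Suc k"] TN by (simp add: addable_def)
    then show "tableau_path T ! k \<in> addable l (set (take k (tableau_path T)))"
      using set_take_tableau_path[OF T, of k] nth_tableau_path[OF k] k by simp
  qed
  moreover have "set (tableau_path T) = mnodes lam"
  proof -
    have "set (tableau_path T) = {N \<in> mnodes lam. T N \<le> n}" using set_take_tableau_path[OF T, of n] by simp
    also have "\<dots> = mnodes lam" using bij_betwE[OF std_bij[OF T]] by auto
    finally show ?thesis .
  qed
  ultimately show ?thesis by (simp add: paths_def)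
qed

lemma tableau_path_bij: "bij_betw tableau_path (std_tableaux lam) (paths l (mnodes lam))"
  unfolding bij_betw_def
proof
  show "inj_on tableau_path (std_tableaux lam)"
  proof (rule inj_onI)
    fix T T' assume T: "T \<in> std_tableaux lam" and T': "T' \<in> std_tableaux lam" and eq: "tableau_path T = tableau_path T'"
    have nd: "node_of lam T k = node_of lam T' k" if "k \<in> {1..n}" for k
    proof -
      have "k - 1 < n" "Suc (k - 1) = k" using that by auto
      then show ?thesis using nth_tableau_path[of "k - 1" T] nth_tableau_path[of "k - 1" T'] eq by simp
    qed
    show "T = T'"
    proof
      fix N
      show "T N = T' N"
      proof (cases "N \<in> mnodes lam")
        case True
        have k: "T N \<in> {1..n}" using bij_betwE[OF std_bij[OF T]] True by blast
        have "T' (node_of lam T' (T N)) = T N" using T_node_of[OF T' k] .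
        then show ?thesis using nd[OF k] node_of_T[OF T True] by simp
      next
        case False
        then show ?thesis using std_tableau_zero[OF T] std_tableau_zero[OF T'] by simp
      qed
    qed
  qed
  show "tableau_path ` std_tableaux lam = paths l (mnodes lam)"
  proof
    show "tableau_path ` std_tableaux lam \<subseteq> paths l (mnodes lam)" using tableau_path_in_paths by blast
    show "paths l (mnodes lam) \<subseteq> tableau_path ` std_tableaux lam"
    proof
      fix P assume P: "P \<in> paths l (mnodes lam)"
      have len: "length P = n" using paths_length[OF P] mnodes_card(2)[OF lam] by simp
      have sP: "set P = mnodes lam" and pf: "path_from l {} P" using P by (auto simp: paths_def)
      have dP: "distinct P" using path_from_distinct[OF pf] by simp
      have bij: "bij_betw ((!) P) {..<n} (mnodes lam)"
        using bij_betw_nth[OF dP, of "{..<n}" "mnodes lam"] len sP by simp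
      define ix where "ix = inv_into {..<n} ((!) P)"
      have ixb: "bij_betw ix (mnodes lam) {..<n}" unfolding ix_def by (rule bij_betw_inv_into[OF bij])
      have ix: "P ! ix N = N" "ix N < n" if "N \<in> mnodes lam" for N
        using that bij_betw_inv_into_right[OF bij that] bij_betwE[OF ixb] by (auto simp: ix_def)
      have ix2: "ix (P ! k) = k" if "k < n" for k
        unfolding ix_def using bij_betw_inv_into_left[OF bij] that by simp
      define T where "T N = (if N \<in> mnodes lam then Suc (ix N) else 0)" for N
      have Tb: "bij_betw T (mnodes lam) {1..n}"
      proof -
        have "bij_betw (Suc \<circ> ix) (mnodes lam) {1..n}"
          by (rule bij_betw_trans[OF ixb]) (auto simp: bij_betw_def image_Suc_lessThan)
        then show ?thesis by (rule bij_betw_cong[THEN iffD1, rotated]) (simp add: T_def)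
      qed
      \<comment> \<open>A node that must be present before M can be added occurs earlier in the
        path. With the left and the upper neighbour as N this yields the two conditions of
        standardness.\<close>
      have lt: "ix N < ix M" if "N \<in> mnodes lam" "M \<in> mnodes lam"
          "\<And>D. diagram l D \<Longrightarrow> M \<in> addable l D \<Longrightarrow> N \<in> D" for N M
      proof -
        have "P ! ix M \<in> addable l (set (take (ix M) P))" using pf ix(2)[OF that(2)] len unfolding path_from_nth by simp
        moreover have "diagram l (set (take (ix M) P))"
        proof -
          have "path_from l {} (take (ix M) P)" using pf append_take_drop_id[of "ix M" P] path_from_append by metis
          then show ?thesis using path_from_diagram[OF diagram_empty] by simp
        qed
        ultimately have "N \<in> set (take (ix M) P)" using that(3) ix(1)[OF that(2)] by simp
        then obtain k where "k < ix M" "P ! k = N" "k < length P" by (auto simp: in_set_conv_nth)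
        then show ?thesis using ix2[of k] len by simp
      qed
      have "T \<in> std_tableaux lam"
        unfolding std_tableaux_def mnodes_card(2)[OF lam]
      proof (intro CollectI conjI allI impI Tb)
        fix s i j assume a: "(s, i, j) \<in> mnodes lam \<and> (s, i, Suc j) \<in> mnodes lam"
        have j1: "1 \<le> j" using diagram_memD(3)[OF mnodes_diagram[OF lam]] a by blast
        have "ix (s, i, j) < ix (s, i, Suc j)"
        proof (rule lt)
          fix D assume D: "diagram l D" and ad: "(s, i, Suc j) \<in> addable l D"
          show "(s, i, j) \<in> D" using ad j1 unfolding addable_iff[OF D] by simp
        qed (use a in auto)
        then show "T (s, i, j) < T (s, i, Suc j)" using a by (simp add: T_def)
      next
        fix s i j assume a: "(s, i, j) \<in> mnodes lam \<and> (s, Suc i, j) \<in> mnodes lam"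
        have i1: "1 \<le> i" using diagram_memD(2)[OF mnodes_diagram[OF lam]] a by blast
        have "ix (s, i, j) < ix (s, Suc i, j)"
        proof (rule lt)
          fix D assume D: "diagram l D" and ad: "(s, Suc i, j) \<in> addable l D"
          show "(s, i, j) \<in> D" using ad i1 unfolding addable_iff[OF D] by simp
        qed (use a in auto)
        then show "T (s, i, j) < T (s, Suc i, j)" using a by (simp add: T_def)
      qed (simp add: T_def)
      moreover have "tableau_path T = P"
      proof (rule nth_equalityI)
        fix k assume "k < length (tableau_path T)"
        then have k: "k < n" by simp
        have PD: "P ! k \<in> mnodes lam" using sP k len nth_mem by blast
        have "T (P ! k) = Suc k" using PD ix2[OF k] by (simp add: T_def)
        then have "node_of lam T (Suc k) = P ! k" using node_of_T[OF \<open>T \<in> std_tableaux lam\<close> PD] by simp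
        then show "tableau_path T ! k = P ! k" using nth_tableau_path[OF k] by simp
      qed (use len in simp)
      ultimately show "P \<in> tableau_path ` std_tableaux lam" by blast
    qed
  qed
qed

end

lemma functional_sum:
  assumes "\<And>a. a \<in> A \<Longrightarrow> ak_functional l n x Q (g a)"
  shows "ak_functional l n x Q (\<lambda>w. \<Sum>a\<in>A. c a * g a w)"
  unfolding ak_functional_def
proof (intro allI impI conjI)
  fix u v assume uv: "set u \<subseteq> {..<n}" "set v \<subseteq> {..<n}"
  note d = ak_functionalD[OF assms uv]
  have "(\<Sum>i\<le>l. coeff (\<Prod>j<l. [:- Q j, 1:]) i * (\<Sum>a\<in>A. c a * g a (u @ replicate i 0 @ v))) =
      (\<Sum>a\<in>A. c a * (\<Sum>i\<le>l. coeff (\<Prod>j<l. [:- Q j, 1:]) i * g a (u @ replicate i 0 @ v)))"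
    unfolding sum_distrib_left by (subst sum.swap) (simp add: mult_ac)
  then show "(\<Sum>i\<le>l. coeff (\<Prod>j<l. [:- Q j, 1:]) i * (\<Sum>a\<in>A. c a * g a (u @ replicate i 0 @ v))) = 0"
    using d(1) by simp
  show "(\<Sum>a\<in>A. c a * g a (u @ [i, i] @ v)) =
      (x - 1) * (\<Sum>a\<in>A. c a * g a (u @ [i] @ v)) + x * (\<Sum>a\<in>A. c a * g a (u @ v))" if "1 \<le> i" "i < n" for i
  proof -
    have "(\<Sum>a\<in>A. c a * g a (u @ [i, i] @ v)) =
        (\<Sum>a\<in>A. (x - 1) * (c a * g a (u @ [i] @ v)) + x * (c a * g a (u @ v)))"
      by (rule sum.cong[OF refl]) (simp only: d(2)[OF _ that], simp add: algebra_simps)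
    then show ?thesis by (simp add: sum.distrib sum_distrib_left)
  qed
  show "(\<Sum>a\<in>A. c a * g a (u @ [0, 1, 0, 1] @ v)) = (\<Sum>a\<in>A. c a * g a (u @ [1, 0, 1, 0] @ v))" if "2 \<le> n"
    by (rule sum.cong[OF refl]) (simp only: d(3)[OF _ that])
  show "(\<Sum>a\<in>A. c a * g a (u @ [i, i + 1, i] @ v)) = (\<Sum>a\<in>A. c a * g a (u @ [i + 1, i, i + 1] @ v))"
    if "1 \<le> i" "i + 1 < n" for i
    by (rule sum.cong[OF refl]) (simp only: d(4)[OF _ that])
  show "(\<Sum>a\<in>A. c a * g a (u @ [i, j] @ v)) = (\<Sum>a\<in>A. c a * g a (u @ [j, i] @ v))"
    if "i + 1 < j" "j < n" for i j
    by (rule sum.cong[OF refl]) (simp only: d(5)[OF _ that])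
qed

section \<open>Linear independence of the characters\<close>

lemma separate_one_variable:
  fixes z :: "'p \<Rightarrow> 'a::field"
  assumes fin: "finite S" and h: "\<And>t::nat. (\<Sum>P\<in>S. d P * z P ^ t) = 0"
  shows "(\<Sum>P\<in>{P \<in> S. z P = z0}. d P) = 0"
proof -
  define p where "p = (\<Prod>y\<in>z ` S - {z0}. [:- y, 1:])"
  have "(\<Sum>P\<in>S. d P * poly p (z P)) = (\<Sum>P\<in>S. \<Sum>i\<le>degree p. coeff p i * (d P * z P ^ i))"
    unfolding poly_altdef sum_distrib_left by (simp add: mult_ac)
  also have "\<dots> = (\<Sum>i\<le>degree p. coeff p i * (\<Sum>P\<in>S. d P * z P ^ i))"
    unfolding sum_distrib_left by (rule sum.swap)
  finally have 1: "(\<Sum>P\<in>S. d P * poly p (z P)) = 0" using h by simp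
  have "(\<Sum>P\<in>S. d P * poly p (z P)) = (\<Sum>P\<in>{P \<in> S. z P = z0}. d P * poly p (z P))"
  proof (rule sum.mono_neutral_right[OF fin])
    show "\<forall>P\<in>S - {P \<in> S. z P = z0}. d P * poly p (z P) = 0"
      using fin by (auto simp: p_def poly_prod prod_zero_iff)
  qed auto
  also have "\<dots> = (\<Sum>P\<in>{P \<in> S. z P = z0}. d P) * poly p z0"
    unfolding sum_distrib_right by (rule sum.cong) auto
  finally have "(\<Sum>P\<in>{P \<in> S. z P = z0}. d P) * poly p z0 = 0" using 1 by simp
  moreover have "poly p z0 \<noteq> 0" using fin by (auto simp: p_def poly_prod prod_zero_iff)
  ultimately show ?thesis by simp
qed

text \<open>One variable at a time: a polynomial vanishing at all values other than the wanted one
  isolates a fibre. Since the hypothesis holds for all exponents, it passes to the fibre with one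
  variable less.\<close>

lemma separate_variables:
  fixes y :: "'p \<Rightarrow> nat \<Rightarrow> 'a::field"
  assumes "finite S" "\<And>e. (\<Sum>P\<in>S. d P * (\<Prod>k=1..m. y P k ^ e k)) = 0"
  shows "(\<Sum>P\<in>{P \<in> S. \<forall>k\<in>{1..m}. y P k = y0 k}. d P) = 0"
  using assms
proof (induction m arbitrary: S)
  case 0
  then show ?case by simp
next
  case (Suc m)
  let ?S = "{P \<in> S. y P (Suc m) = y0 (Suc m)}"
  have "(\<Sum>P\<in>?S. d P * (\<Prod>k=1..m. y P k ^ e k)) = 0" for e
  proof (rule separate_one_variable[OF Suc.prems(1)])
    fix t
    have "(\<Sum>P\<in>S. d P * (\<Prod>k=1..Suc m. y P k ^ (e(Suc m := t)) k)) = 0" by (rule Suc.prems(2))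
    moreover have "(\<Prod>k=1..Suc m. y P k ^ (e(Suc m := t)) k) = (\<Prod>k=1..m. y P k ^ e k) * y P (Suc m) ^ t" for P
      by simp
    ultimately show "(\<Sum>P\<in>S. d P * (\<Prod>k=1..m. y P k ^ e k) * y P (Suc m) ^ t) = 0"
      by (simp add: mult.assoc)
  qed
  then have "(\<Sum>P\<in>{P \<in> ?S. \<forall>k\<in>{1..m}. y P k = y0 k}. d P) = 0"
    using Suc.prems(1) by (intro Suc.IH) auto
  moreover have "{P \<in> ?S. \<forall>k\<in>{1..m}. y P k = y0 k} = {P \<in> S. \<forall>k\<in>{1..Suc m}. y P k = y0 k}"
  proof -
    have "{1..Suc m} = insert (Suc m) {1..m}" by auto
    then show ?thesis by auto
  qed
  ultimately show ?case by simp
qed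

context ak_generic
begin

text \<open>Once the nodes before it are known, the next node is an addable one, and addable nodes
  are distinguished by their residues.\<close>

lemma path_residues_inj:
  "P \<in> all_paths l n \<Longrightarrow> P' \<in> all_paths l n \<Longrightarrow> (\<And>k. k < n \<Longrightarrow> res (P ! k) = res (P' ! k)) \<Longrightarrow> P = P'"
proof (induction n arbitrary: P P')
  case 0
  then show ?case by (simp add: all_paths_0)
next
  case (Suc n)
  obtain R A where R: "P = R @ [A]" "R \<in> all_paths l n" "A \<in> addable l (set R)"
    using Suc.prems(1) unfolding all_paths_Suc by auto
  obtain R' A' where R': "P' = R' @ [A']" "R' \<in> all_paths l n" "A' \<in> addable l (set R')"
    using Suc.prems(2) unfolding all_paths_Suc by auto
  have len: "length R = n" "length R' = n" using R(2) R'(2) by (auto simp: all_paths_def)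
  have "R = R'"
  proof (rule Suc.IH[OF R(2) R'(2)])
    fix k assume "k < n"
    then show "res (R ! k) = res (R' ! k)" using Suc.prems(3)[of k] len by (simp add: R(1) R'(1) nth_append)
  qed
  moreover have "res A = res A'" using Suc.prems(3)[of n] len by (simp add: R(1) R'(1) nth_append)
  ultimately show ?case
    using R R' addable_res_inj[OF all_paths_diagram[OF R(2)]] by (auto dest: inj_onD)
qed

text \<open>On \<open>jm_powers e n\<close> a trace is a sum over paths of monomials in the
  eigenvalues. Separating the eigenvalue sequences leaves a single path P0, and with it the
  coefficient of its shape.\<close>

lemma path_trace_independent:
  assumes "\<And>w. set w \<subseteq> {..<n} \<Longrightarrow> (\<Sum>lam\<in>multipartitions l n. d lam * path_trace (mnodes lam) w) = 0"
    and mu: "mu \<in> multipartitions l n"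
  shows "d mu = 0"
proof -
  define sh where "sh P = inv_into (multipartitions l n) mnodes (set P)" for P
  have sh: "sh P = lam" if "lam \<in> multipartitions l n" "P \<in> paths l (mnodes lam)" for P lam
  proof -
    have "set P = mnodes lam" using that(2) by (simp add: paths_def)
    then show ?thesis unfolding sh_def using bij_mnodes that(1) by (metis bij_betw_inv_into_left)
  qed
  have y: "(\<Sum>P\<in>all_paths l n. d (sh P) * (\<Prod>k=1..n. (x ^ (k - 1) * res (P ! (k - 1))) ^ e k)) = 0" for e
  proof -
    have "(\<Sum>P\<in>all_paths l n. d (sh P) * jm_eigen e n P) =
        (\<Sum>lam\<in>multipartitions l n. \<Sum>P\<in>paths l (mnodes lam). d (sh P) * jm_eigen e n P)"
      by (rule sum_paths_by_shape[symmetric])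
    also have "\<dots> = (\<Sum>lam\<in>multipartitions l n. d lam * path_trace (mnodes lam) (jm_powers e n))"
    proof (rule sum.cong[OF refl])
      fix lam assume lam: "lam \<in> multipartitions l n"
      show "(\<Sum>P\<in>paths l (mnodes lam). d (sh P) * jm_eigen e n P) = d lam * path_trace (mnodes lam) (jm_powers e n)"
        unfolding path_trace_def sum_distrib_left
      proof (rule sum.cong[OF refl])
        fix P assume P: "P \<in> paths l (mnodes lam)"
        show "d (sh P) * jm_eigen e n P = d lam * foldr act (jm_powers e n) (delta P) P"
          using sh[OF lam P] foldr_jm_powers[OF P, of n e "delta P"] mnodes_card(2)[OF lam] by (simp add: delta_def)
      qed
    qed
    also have "\<dots> = 0" by (rule assms(1)) (rule jm_powers_letters, simp)
    finally show ?thesis by (simp add: jm_eigen_def)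
  qed
  obtain P0 where P0: "P0 \<in> paths l (mnodes mu)" using diagram_has_path[OF mnodes_diagram[OF mu]] by blast
  have P0a: "P0 \<in> all_paths l n"
    using P0 paths_length[OF P0] mnodes_card(2)[OF mu] by (auto simp: all_paths_def paths_def)
  have "(\<Sum>P\<in>{P \<in> all_paths l n. \<forall>k\<in>{1..n}. x ^ (k - 1) * res (P ! (k - 1)) = x ^ (k - 1) * res (P0 ! (k - 1))}. d (sh P)) = 0"
    by (rule separate_variables[OF all_paths_finite y])
  moreover have "{P \<in> all_paths l n. \<forall>k\<in>{1..n}. x ^ (k - 1) * res (P ! (k - 1)) = x ^ (k - 1) * res (P0 ! (k - 1))} = {P0}"
  proof (intro Set.set_eqI iffI)
    fix P assume P: "P \<in> {P \<in> all_paths l n. \<forall>k\<in>{1..n}. x ^ (k - 1) * res (P ! (k - 1)) = x ^ (k - 1) * res (P0 ! (k - 1))}"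
    have "P = P0"
    proof (rule path_residues_inj[OF _ P0a])
      show "P \<in> all_paths l n" using P by blast
      fix k assume "k < n"
      then have "Suc k \<in> {1..n}" by simp
      then have "x ^ (Suc k - 1) * res (P ! (Suc k - 1)) = x ^ (Suc k - 1) * res (P0 ! (Suc k - 1))" using P by blast
      then show "res (P ! k) = res (P0 ! k)" using x_nz by simp
    qed
    then show "P \<in> {P0}" by simp
  qed (use P0a in auto)
  ultimately show ?thesis using sh[OF mu P0] by simp
qed

section \<open>Comparison with the modules of Ariki and Koike\<close>

context
  fixes n :: nat and lam :: "(nat \<Rightarrow> nat) list"
  assumes lam: "lam \<in> multipartitions l n"
begin

abbreviation "tp \<equiv> tableau_path n lam"

text \<open>The exchanged path is the path of some standard tableau T. Comparing the nodes of all
  entries identifies T with \<open>swap_entries k S\<close>, which is thereby standard.\<close>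

lemma swap_tableau:
  assumes S: "S \<in> std_tableaux lam" and k: "1 \<le> k" "k < n" and nl: "\<not> in_line (tp S ! (k - 1)) (tp S ! k)"
  shows "swap_entries k S \<in> std_tableaux lam" "tp (swap_entries k S) = swap_at k (tp S)"
proof -
  obtain xs N M ys where eq: "tp S = xs @ N # M # ys" "k = Suc (length xs)"
    using list_split2[of k "tp S" thesis] k length_tableau_path[OF lam, of S] by simp
  have PS: "tp S \<in> paths l (mnodes lam)" by (rule tableau_path_in_paths[OF lam S])
  have "\<not> in_line N M" using nl by (simp add: eq nth_append)
  then have "swap_at k (tp S) \<in> paths l (mnodes lam)"
    using path_swap PS unfolding eq swap_at_append by blast
  then obtain T where T: "T \<in> std_tableaux lam" "tp T = swap_at k (tp S)"
    using bij_betw_imp_surj_on[OF tableau_path_bij[OF lam]] by (metis imageE)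
  let ?t = "transpose k (Suc k)"
  have nd: "node_of lam T (Suc m) = node_of lam S (?t (Suc m))" if m: "m < n" for m
  proof -
    have "node_of lam T (Suc m) = swap_at k (tp S) ! m"
      using nth_tableau_path[OF lam m, of T] T(2) by simp
    also have "\<dots> = tp S ! (?t (Suc m) - 1)"
      using k m length_tableau_path[OF lam, of S]
      by (auto simp: swap_at_def nth_list_update transpose_def)
    also have "\<dots> = node_of lam S (?t (Suc m))"
    proof -
      have "?t (Suc m) - 1 < n" "Suc (?t (Suc m) - 1) = ?t (Suc m)" using k m by (auto simp: transpose_def)
      then show ?thesis using nth_tableau_path[OF lam, of "?t (Suc m) - 1" S] by simp
    qed
    finally show ?thesis .
  qed
  have "T = swap_entries k S"
  proof
    fix N
    show "T N = swap_entries k S N"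
    proof (cases "N \<in> mnodes lam")
      case True
      have "T N \<in> {1..n}" using bij_betwE[OF std_bij[OF lam T(1)]] True by blast
      then obtain m where m: "T N = Suc m" "m < n" by (cases "T N") auto
      have "N = node_of lam S (?t (Suc m))" using nd[OF m(2)] node_of_T[OF lam T(1) True] m(1) by simp
      moreover have "?t (Suc m) \<in> {1..n}" using k m(2) by (auto simp: transpose_def)
      ultimately have "S N = ?t (Suc m)" using T_node_of[OF lam S] by simp
      then show ?thesis by (simp add: swap_entries_def m(1))
    next
      case False
      then have "T N = 0" "S N = 0" using std_tableau_zero[OF T(1)] std_tableau_zero[OF S] by auto
      then show ?thesis using k by (simp add: swap_entries_def transpose_def)
    qed
  qed
  then show "swap_entries k S \<in> std_tableaux lam" "tp (swap_entries k S) = swap_at k (tp S)" using T by auto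
qed

lemma std_tableaux_finite: "finite (std_tableaux lam)"
  using bij_betw_finite[OF tableau_path_bij[OF lam]] paths_finite by blast

text \<open>The coefficient at S receives contributions from S and from
  \<open>swap_entries k S\<close> only. The latter has the nodes of k and k + 1 exchanged, whence
  the reversed \<open>alpha\<close> in \<open>act\<close>.\<close>

lemma gen_act_act:
  assumes S: "S \<in> std_tableaux lam" and k: "k < n"
    and v: "\<And>T. T \<in> std_tableaux lam \<Longrightarrow> v T = v' (tp T)"
  shows "gen_act x Q lam k v S = act k v' (tp S)"
proof (cases "k = 0")
  case True
  have "gen_act x Q lam k v S = (\<Sum>T\<in>std_tableaux lam. if T = S then v S * Q (comp_of lam S 1) else 0)"
    unfolding gen_act_def by (intro sum.cong) (auto simp: True gen_image_def basis_vec_def)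
  also have "\<dots> = v S * Q (comp_of lam S 1)" using S std_tableaux_finite by simp
  finally show ?thesis
    using True k v[OF S] nth_tableau_path[OF lam, of 0 S] by (simp add: act_def comp_of_def)
next
  case False
  then have k1: "1 \<le> k" by simp
  let ?a = "\<lambda>T. (x - 1) * Defs.content x Q lam T (k + 1) / (Defs.content x Q lam T (k + 1) - Defs.content x Q lam T k)"
  have nN: "tp T ! (k - 1) = node_of lam T k" and nM: "tp T ! k = node_of lam T (Suc k)" for T
    using nth_tableau_path[OF lam, of "k - 1" T] nth_tableau_path[OF lam, of k T] k k1 by simp_all
  have content: "Defs.content x Q lam T m = res (node_of lam T m)" for T m
    by (simp add: Defs.content_def res_def node_diff_def col_of_def row_of_def comp_of_def)
  have a: "?a T = alpha (tp T ! (k - 1)) (tp T ! k)" for T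
    unfolding content alpha_def nN nM by simp
  have il: "in_line (tp T ! (k - 1)) (tp T ! k) \<longleftrightarrow>
      comp_of lam T k = comp_of lam T (k + 1) \<and> row_of lam T k = row_of lam T (k + 1) \<or>
      comp_of lam T k = comp_of lam T (k + 1) \<and> col_of lam T k = col_of lam T (k + 1)" for T
    unfolding in_line_def nN nM comp_of_def row_of_def col_of_def by auto
  have img: "gen_image x Q lam k T R = alpha (tp T ! (k - 1)) (tp T ! k) * basis_vec T R +
      (if in_line (tp T ! (k - 1)) (tp T ! k) then 0
       else (1 + alpha (tp T ! (k - 1)) (tp T ! k)) * basis_vec (swap_entries k T) R)"
    if T: "T \<in> std_tableaux lam" for T R
  proof -
    obtain xs N M ys where eq: "tp T = xs @ N # M # ys" "k = Suc (length xs)"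
      using list_split2[of k "tp T" thesis] k k1 length_tableau_path[OF lam, of T] by simp
    have PT: "xs @ N # M # ys \<in> paths l (mnodes lam)" using tableau_path_in_paths[OF lam T] eq(1) by simp
    note p2 = path_two(1-3)[OF PT]
    have NM: "tp T ! (k - 1) = N" "tp T ! k = M" by (simp_all add: eq nth_append)
    have nk: "node_of lam T k = N" by (rule trans[OF nN[symmetric] NM(1)])
    have nk1: "node_of lam T (k + 1) = M" using trans[OF nM[symmetric] NM(2)] by simp
    have ilT: "in_line N M \<longleftrightarrow>
        comp_of lam T k = comp_of lam T (k + 1) \<and> row_of lam T k = row_of lam T (k + 1) \<or>
        comp_of lam T k = comp_of lam T (k + 1) \<and> col_of lam T k = col_of lam T (k + 1)"
      using il[of T] unfolding NM .
    show ?thesis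
    proof (cases "in_line N M")
      case True
      note al = alpha_in_line(1,2)[OF p2 True]
      show ?thesis
      proof (cases "row_of lam T k = row_of lam T (k + 1)")
        case r: True
        have "alpha N M = x" using al(1) r unfolding row_of_def nk nk1 by simp
        moreover have "comp_of lam T k = comp_of lam T (k + 1)" using True unfolding ilT by blast
        ultimately show ?thesis unfolding NM using False True r by (simp add: gen_image_def)
      next
        case r: False
        then have c: "comp_of lam T k = comp_of lam T (k + 1)" "col_of lam T k = col_of lam T (k + 1)"
          using True unfolding ilT by blast+
        have "alpha N M = - 1" using al(2) c(2) unfolding col_of_def nk nk1 by simp
        then show ?thesis unfolding NM using False True r c by (simp add: gen_image_def)
      qed
    next
      case nl: False
      have h: "\<not> (comp_of lam T k = comp_of lam T (k + 1) \<and> row_of lam T k = row_of lam T (k + 1))"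
        "\<not> (comp_of lam T k = comp_of lam T (k + 1) \<and> col_of lam T k = col_of lam T (k + 1))"
        using nl unfolding ilT by blast+
      show ?thesis
        unfolding gen_image_def Let_def if_not_P[OF False] if_not_P[OF h(1)] if_not_P[OF h(2)] a NM if_not_P[OF nl] ..
    qed
  qed
  let ?N = "tp S ! (k - 1)" and ?M = "tp S ! k"
  have inv2: "swap_entries k (swap_entries k T) = T" for T
    by (simp add: swap_entries_def fun_eq_iff)
  have ne: "swap_entries k S \<noteq> S"
  proof
    assume "swap_entries k S = S"
    then have "swap_entries k S (node_of lam S k) = S (node_of lam S k)" by simp
    then show False using T_node_of[OF lam S, of k] k k1 by (simp add: swap_entries_def)
  qed
  have "gen_act x Q lam k v S = (\<Sum>T\<in>std_tableaux lam.
      (if T = S then alpha ?N ?M * v S else 0) +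
      (if T = swap_entries k S then (if in_line (tp T ! (k - 1)) (tp T ! k) then 0
         else (1 + alpha (tp T ! (k - 1)) (tp T ! k)) * v T) else 0))"
    unfolding gen_act_def
  proof (rule sum.cong[OF refl])
    fix T assume T: "T \<in> std_tableaux lam"
    have sw: "S = swap_entries k T \<longleftrightarrow> T = swap_entries k S" using inv2 by metis
    show "v T * gen_image x Q lam k T S = (if T = S then alpha ?N ?M * v S else 0) +
      (if T = swap_entries k S then (if in_line (tp T ! (k - 1)) (tp T ! k) then 0
         else (1 + alpha (tp T ! (k - 1)) (tp T ! k)) * v T) else 0)"
      unfolding img[OF T] basis_vec_def sw using ne by (auto simp: mult_ac)
  qed
  also have "\<dots> = alpha ?N ?M * v S + (if swap_entries k S \<in> std_tableaux lam then
      (if in_line (tp (swap_entries k S) ! (k - 1)) (tp (swap_entries k S) ! k) then 0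
         else (1 + alpha (tp (swap_entries k S) ! (k - 1)) (tp (swap_entries k S) ! k)) * v (swap_entries k S)) else 0)"
    using S std_tableaux_finite by (simp add: sum.distrib)
  also have "\<dots> = alpha ?N ?M * v S + (if in_line ?N ?M then 0 else (1 + alpha ?M ?N) * v' (swap_at k (tp S)))"
  proof (cases "in_line ?N ?M")
    case True
    \<comment> \<open>If the exchanged filling were standard with its two nodes not in line,
      exchanging back would show that the nodes of S are not in line either. So its contribution is
      zero in every case.\<close>
    have "in_line (tp (swap_entries k S) ! (k - 1)) (tp (swap_entries k S) ! k)" if "swap_entries k S \<in> std_tableaux lam"
    proof (rule ccontr)
      assume nl: "\<not> in_line (tp (swap_entries k S) ! (k - 1)) (tp (swap_entries k S) ! k)"
      from swap_tableau(2)[OF that k1 k nl] have "tp S = swap_at k (tp (swap_entries k S))" unfolding inv2 .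
      then have "?N = tp (swap_entries k S) ! k" "?M = tp (swap_entries k S) ! (k - 1)"
        using k k1 length_tableau_path[OF lam] by (simp_all add: swap_at_def nth_list_update)
      then show False using True nl in_line_sym by simp
    qed
    then show ?thesis using True by simp
  next
    case nl: False
    note sw = swap_tableau[OF S k1 k nl]
    have e: "tp (swap_entries k S) ! (k - 1) = ?M" "tp (swap_entries k S) ! k = ?N"
      unfolding sw(2) using k k1 length_tableau_path[OF lam] by (simp_all add: swap_at_def nth_list_update)
    show ?thesis using sw v[OF sw(1)] nl e in_line_sym[of ?M ?N] by simp
  qed
  finally show ?thesis using False v[OF S] by (simp add: act_def)
qed

lemma foldr_gen_act:
  assumes "set w \<subseteq> {..<n}" "\<And>T. T \<in> std_tableaux lam \<Longrightarrow> v T = v' (tp T)" "S \<in> std_tableaux lam"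
  shows "foldr (gen_act x Q lam) w v S = foldr act w v' (tp S)"
  using assms(1,3)
proof (induction w arbitrary: S)
  case Nil
  then show ?case using assms(2) by simp
next
  case (Cons k w)
  then show ?case using gen_act_act[of S k "foldr (gen_act x Q lam) w v" "foldr act w v'"] by simp
qed

lemma free_character_ev:
  assumes "\<And>w. f w \<noteq> 0 \<Longrightarrow> set w \<subseteq> {..<n}"
  shows "free_character x Q lam f = ev (path_trace (mnodes lam)) f"
proof -
  have "free_character x Q lam f = (\<Sum>w | f w \<noteq> 0. \<Sum>T\<in>std_tableaux lam. f w * foldr (gen_act x Q lam) w (basis_vec T) T)"
    unfolding free_character_def free_act_def by (rule sum.swap)
  also have "\<dots> = (\<Sum>w | f w \<noteq> 0. f w * path_trace (mnodes lam) w)"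
  proof (rule sum.cong[OF refl])
    fix w assume "w \<in> {w. f w \<noteq> 0}"
    then have w: "set w \<subseteq> {..<n}" using assms by simp
    have inj: "inj_on tp (std_tableaux lam)" using tableau_path_bij[OF lam] by (rule bij_betw_imp_inj_on)
    have "(\<Sum>T\<in>std_tableaux lam. f w * foldr (gen_act x Q lam) w (basis_vec T) T) =
       (\<Sum>T\<in>std_tableaux lam. f w * foldr act w (delta (tp T)) (tp T))"
    proof (rule sum.cong[OF refl])
      fix T assume T: "T \<in> std_tableaux lam"
      have "foldr (gen_act x Q lam) w (basis_vec T) T = foldr act w (delta (tp T)) (tp T)"
        by (rule foldr_gen_act[OF w _ T]) (use inj T in \<open>auto simp: basis_vec_def delta_def dest: inj_onD\<close>)
      then show "f w * foldr (gen_act x Q lam) w (basis_vec T) T = f w * foldr act w (delta (tp T)) (tp T)" by simp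
    qed
    also have "\<dots> = (\<Sum>P\<in>paths l (mnodes lam). f w * foldr act w (delta P) P)"
      by (rule sum.reindex_bij_betw[OF tableau_path_bij[OF lam]])
    finally show "(\<Sum>T\<in>std_tableaux lam. f w * foldr (gen_act x Q lam) w (basis_vec T) T) = f w * path_trace (mnodes lam) w"
      by (simp add: path_trace_def sum_distrib_left)
  qed
  finally show ?thesis by (simp add: ev_def)
qed

end

end

section \<open>The Schur elements\<close>

locale ak_setup = ak_generic l x Q + ak_over F n l x Q
  for l :: nat and x :: "'a::field" and Q :: "nat \<Rightarrow> 'a" and F :: "'a set" and n :: nat
begin

section \<open>Values in the subfield\<close>

lemma Fdiv: "a \<in> F \<Longrightarrow> b \<in> F \<Longrightarrow> a / b \<in> F"
  unfolding divide_inverse by (intro Fmult Finv)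

lemma Fdiff: "a \<in> F \<Longrightarrow> b \<in> F \<Longrightarrow> a - b \<in> F"
  using Fadd[OF _ Fneg, of a b] by simp

lemma res_F: "fst N < l \<Longrightarrow> res N \<in> F"
  unfolding res_def by (intro Fmult Fpowi xF QF)

lemma alpha_F: "fst N < l \<Longrightarrow> fst M < l \<Longrightarrow> alpha N M \<in> F"
  unfolding alpha_def by (intro Fdiv Fmult Fdiff res_F xF F1)

text \<open>Both \<open>ak_linear_form\<close> and \<open>schur_element\<close> ask for values in F,
  while the seminormal coefficients are computed in the ambient field. Membership in F is therefore
  followed through the action.\<close>

lemma act_F:
  assumes "\<And>R. R \<in> paths l D \<Longrightarrow> v R \<in> F" "P \<in> paths l D" "k < card D"
  shows "act k v P \<in> F"
proof -
  have fst: "fst N < l" if "N \<in> set P" for N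
  proof -
    obtain s i j where N: "N = (s, i, j)" by (cases N)
    have "(s, i, j) \<in> D" using that assms(2) unfolding N paths_def by blast
    then show ?thesis using diagram_memD(1)[OF paths_diagram[OF assms(2)]] by (simp add: N)
  qed
  have len: "length P = card D" by (rule paths_length[OF assms(2)])
  show ?thesis
  proof (cases "k = 0")
    case True
    have "P ! 0 \<in> set P" using len assms(3) True by simp
    then show ?thesis using assms(1)[OF assms(2)] by (simp add: act_def True Fmult QF fst)
  next
    case False
    then obtain xs N M ys where eq: "P = xs @ N # M # ys" "k = Suc (length xs)"
      using list_split2[of k P thesis] assms(3) len by simp
    have NM: "fst N < l" "fst M < l" using fst[of N] fst[of M] eq(1) by auto
    have 1: "alpha N M * v (xs @ N # M # ys) \<in> F"
      using assms(1)[OF assms(2)] unfolding eq by (intro Fmult alpha_F NM)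
    have 2: "(if in_line N M then 0 else (1 + alpha M N) * v (xs @ M # N # ys)) \<in> F"
      using assms(1)[OF path_swap[OF assms(2)[unfolded eq(1)]]]
      by (auto intro!: F0 Fmult Fadd F1 alpha_F NM)
    show ?thesis unfolding eq act_append by (rule Fadd[OF 1 2])
  qed
qed

lemma path_trace_F: "set w \<subseteq> {..<card D} \<Longrightarrow> path_trace D w \<in> F"
proof -
  assume w: "set w \<subseteq> {..<card D}"
  have "foldr act w v P \<in> F" if "\<And>R. R \<in> paths l D \<Longrightarrow> v R \<in> F" "P \<in> paths l D" for v P
    using w that(2)
  proof (induction w arbitrary: P)
    case Nil
    then show ?case using that(1) by simp
  next
    case (Cons k w)
    have "act k (foldr act w v) P \<in> F"
    proof (rule act_F)
      show "foldr act w v R \<in> F" if "R \<in> paths l D" for R using Cons.IH[OF _ that] Cons.prems(1) by simp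
    qed (use Cons.prems in auto)
    then show ?case by simp
  qed
  then show ?thesis unfolding path_trace_def by (intro Fsum) (auto simp: delta_def F0 F1)
qed

lemma schur_F:
  assumes D: "diagram l D"
  shows "schur D \<in> F"
proof -
  have "hook_factor D N t \<in> F" if "N \<in> D" "t < l" for N t
  proof -
    obtain s i j where N: "N = (s, i, j)" by (cases N)
    have "s < l" using diagram_memD(1)[OF D] that(1) N by blast
    then show ?thesis unfolding hook_factor_def N prod.case by (intro Fdiff Fdiv Fmult Fpowi xF QF F1 that(2))
  qed
  then have "(\<Prod>N\<in>D. \<Prod>t<l. hook_factor D N t) \<in> F" by (intro Fprod) auto
  then show ?thesis unfolding schur_def by (intro Fmult Fdiv Fpower Fneg F1 Fpowi xF Fdiff)
qed

text \<open>The candidate for \<open>ak_tau\<close>, as a function on words.\<close>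

definition total_trace :: "nat list \<Rightarrow> 'a" where
  "total_trace w = (\<Sum>lam\<in>multipartitions l n. 1 / schur (mnodes lam) * path_trace (mnodes lam) w)"

lemma total_trace_functional: "ak_functional l n x Q total_trace"
  unfolding total_trace_def[abs_def]
  by (rule functional_sum) (rule path_trace_functional[OF mnodes_card(2) n_pos])

lemma total_trace_F: "set w \<subseteq> {..<n} \<Longrightarrow> total_trace w \<in> F"
  unfolding total_trace_def
  by (intro Fsum Fmult Fdiv F1 schur_F mnodes_diagram path_trace_F) (auto simp: mnodes_card)

lemma total_trace_jm: "total_trace (jm_powers c n @ ks) = weighted_trace n c ks"
proof -
  have "total_trace (jm_powers c n @ ks) =
      (\<Sum>lam\<in>multipartitions l n. \<Sum>P\<in>paths l (mnodes lam). 1 / schur (set P) * jm_eigen c n P * foldr act ks (delta P) P)"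
    unfolding total_trace_def path_trace_def sum_distrib_left
  proof (intro sum.cong refl)
    fix lam P assume lam: "lam \<in> multipartitions l n" and P: "P \<in> paths l (mnodes lam)"
    have "foldr act (jm_powers c n @ ks) (delta P) P = jm_eigen c n P * foldr act ks (delta P) P"
      using foldr_jm_powers[OF P, of n c "foldr act ks (delta P)"] mnodes_card(2)[OF lam] by simp
    moreover have "set P = mnodes lam" using P by (simp add: paths_def)
    ultimately show "1 / schur (mnodes lam) * foldr act (jm_powers c n @ ks) (delta P) P =
        1 / schur (set P) * jm_eigen c n P * foldr act ks (delta P) P" by simp
  qed
  then show ?thesis unfolding sum_paths_by_shape weighted_trace_def .
qed

text \<open>The chosen reduced expression is braid equivalent to a canonical word C. If C is empty,
  w is the identity and \<open>weighted_trace_Nil\<close> gives the value; otherwise the largest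
  letter of C occurs once and the trace vanishes.\<close>

lemma total_trace_basis:
  assumes c: "\<And>k. k \<in> {1..n} \<Longrightarrow> c k < l" and w: "w permutes {1..n}"
  shows "total_trace (jm_powers c n @ (SOME ks. reduced_expr n w ks)) = (if (\<forall>k\<in>{1..n}. c k = 0) \<and> w = id then 1 else 0)"
proof -
  define ks where "ks = (SOME ks. reduced_expr n w ks)"
  have red: "reduced_expr n w ks" and ks: "set ks \<subseteq> {..<n}" unfolding ks_def using basis_elt_cls(2,3)[OF w] by auto
  have c': "c k < l" if "1 \<le> k" "k \<le> n" for k using c that by simp
  obtain C where C: "C \<in> canonical (n - 1)" "braid ks C" using reduced_canonical[OF red n_pos] by blast
  have "total_trace (jm_powers c n @ ks) = total_trace (jm_powers c n @ C)"
    using braid_functional[OF total_trace_functional C(2) ks, of "jm_powers c n" "[]"] jm_powers_letters[of n n c] by simp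
  also have "\<dots> = weighted_trace n c C" by (rule total_trace_jm)
  also have "\<dots> = (if (\<forall>k\<in>{1..n}. c k = 0) \<and> w = id then 1 else 0)"
  proof (cases "C = []")
    case True
    then have "ks = []" using braid_length[OF C(2)] by simp
    then have "w = id" using red by (simp add: reduced_expr_def)
    then show ?thesis using weighted_trace_Nil[of n c, OF c'] True by simp
  next
    case False
    then have "ks \<noteq> []" using braid_length[OF C(2)] by auto
    have "w \<noteq> id"
    proof
      assume "w = id"
      then have "length ks \<le> length ([]::nat list)" using red unfolding reduced_expr_def
        by (metis empty_subsetI list.set(1) word_perm_Nil)
      then show False using \<open>ks \<noteq> []\<close> by simp
    qed
    obtain p u v where p: "1 \<le> p" "p \<le> n - 1" "C = u @ [p] @ v" "set u \<subseteq> {1..<p}" "set v \<subseteq> {1..<p}"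
      using canonical_single_top[OF C(1) False] by blast
    have sub: "{1..<p} \<subseteq> {..<p}" by auto
    have "weighted_trace n c C = 0"
      unfolding p(3) by (rule weighted_trace_vanish[OF p(1) _ subset_trans[OF p(4) sub] subset_trans[OF p(5) sub] c'])
        (use p(2) n_pos in auto)
    then show ?thesis using \<open>w \<noteq> id\<close> by simp
  qed
  finally show ?thesis unfolding ks_def .
qed

lemma ak_character_cls:
  assumes lam: "lam \<in> multipartitions l n" and f: "f \<in> carrier R"
  shows "ak_character x Q lam (cls f) = ev (path_trace (mnodes lam)) f"
  unfolding ak_character_def
proof (rule class_value[OF path_trace_functional[OF mnodes_card(2)[OF lam] n_pos] f])
  fix h assume "h \<in> carrier R"
  then show "free_character x Q lam h = ev (path_trace (mnodes lam)) h"
    by (intro free_character_ev[OF lam]) (auto simp: R_simps(1))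
qed

lemma ak_tau_cls:
  assumes f: "f \<in> carrier R"
  shows "ak_tau F l n x Q (cls f) =
    (\<Sum>lam\<in>multipartitions l n. 1 / schur (mnodes lam) * ak_character x Q lam (cls f))"
proof -
  have "ak_tau F l n x Q (cls f) = ev total_trace f"
    by (rule ak_tau_value[OF total_trace_functional total_trace_F total_trace_basis f])
  also have "\<dots> = (\<Sum>lam\<in>multipartitions l n. 1 / schur (mnodes lam) * ev (path_trace (mnodes lam)) f)"
    unfolding ev_def total_trace_def sum_distrib_left by (subst sum.swap) (simp add: mult_ac)
  finally show ?thesis using ak_character_cls[OF _ f] by simp
qed

text \<open>The hook products satisfy the description by \<open>ak_tau_cls\<close>. For any other
  solution the differences of the inverses are coefficients of a vanishing combination of the
  traces, hence zero by independence.\<close>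

theorem schur_element_hook_formula:
  assumes lam: "lam \<in> multipartitions l n"
  shows "schur_element F l n x Q lam = schur (mnodes lam)"
proof -
  define P where "P s \<longleftrightarrow> s \<in> multipartitions l n \<rightarrow>\<^sub>E F - {0} \<and>
     (\<forall>h\<in>carrier H. ak_tau F l n x Q h = (\<Sum>lam\<in>multipartitions l n. 1 / s lam * ak_character x Q lam h))"
    for s :: "(nat \<Rightarrow> nat) list \<Rightarrow> 'a"
  define s0 where "s0 = restrict (\<lambda>lam. schur (mnodes lam)) (multipartitions l n)"
  have "P s0"
    unfolding P_def
  proof (intro conjI ballI)
    show "s0 \<in> multipartitions l n \<rightarrow>\<^sub>E F - {0}"
      unfolding s0_def using schur_F schur_nz mnodes_diagram by auto
    fix h assume "h \<in> carrier H"
    then obtain f where f: "f \<in> carrier R" "h = cls f" by (auto simp: H_carrier)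
    show "ak_tau F l n x Q h = (\<Sum>lam\<in>multipartitions l n. 1 / s0 lam * ak_character x Q lam h)"
      unfolding f(2) ak_tau_cls[OF f(1)] by (rule sum.cong) (auto simp: s0_def)
  qed
  moreover have "s = s0" if "P s" for s
  proof -
    have s: "s \<in> multipartitions l n \<rightarrow>\<^sub>E F - {0}" using that unfolding P_def by blast
    have "s mu = s0 mu" if mu: "mu \<in> multipartitions l n" for mu
    proof -
      have "1 / s mu - 1 / schur (mnodes mu) = 0"
      proof (rule path_trace_independent[OF _ mu, where d = "\<lambda>mu. 1 / s mu - 1 / schur (mnodes mu)"])
        fix w assume w: "set w \<subseteq> {..<n}"
        let ?f = "word_elt w :: nat list \<Rightarrow> 'a"
        have f: "?f \<in> carrier R" using w by (rule word_carrier)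
        have ch: "ak_character x Q lam (cls ?f) = path_trace (mnodes lam) w" if "lam \<in> multipartitions l n" for lam
          using ak_character_cls[OF that f] by (simp add: ev_word)
        have "(\<Sum>lam\<in>multipartitions l n. 1 / s lam * ak_character x Q lam (cls ?f)) =
            (\<Sum>lam\<in>multipartitions l n. 1 / schur (mnodes lam) * ak_character x Q lam (cls ?f))"
          using \<open>P s\<close> cls_closed[OF f] ak_tau_cls[OF f] unfolding P_def by simp
        then have "(\<Sum>lam\<in>multipartitions l n. 1 / s lam * path_trace (mnodes lam) w) =
            (\<Sum>lam\<in>multipartitions l n. 1 / schur (mnodes lam) * path_trace (mnodes lam) w)"
          using ch by simp
        then show "(\<Sum>lam\<in>multipartitions l n. (1 / s lam - 1 / schur (mnodes lam)) * path_trace (mnodes lam) w) = 0"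
          by (simp add: left_diff_distrib sum_subtractf)
      qed
      then have "inverse (s mu) = inverse (schur (mnodes mu))" by (simp add: divide_inverse)
      then have "s mu = schur (mnodes mu)" by (rule inverse_eq_imp_eq)
      then show ?thesis using mu by (simp add: s0_def)
    qed
    moreover have "s \<in> extensional (multipartitions l n)" using s unfolding PiE_def by blast
    moreover have "s0 \<in> extensional (multipartitions l n)" by (simp add: s0_def)
    ultimately show ?thesis by (intro extensionalityI[of _ "multipartitions l n"])
  qed
  ultimately have "(THE s. P s) = s0" by (rule the_equality)
  then have "schur_element F l n x Q = s0" unfolding schur_element_def P_def .
  then show ?thesis using lam by (simp add: s0_def)
qed

end

section \<open>The statistic of the merged partition\<close>

lemma sum_below_choose: "(\<Sum>i<c. i) = c choose 2" for c :: nat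
  by (induction c) (auto simp: numeral_2_eq_2)

lemma sorted_threshold:
  fixes L :: "nat list"
  assumes "sorted (rev L)"
  shows "{i. i < length L \<and> j \<le> L ! i} = {..<length (filter (\<lambda>y. j \<le> y) L)}"
proof -
  let ?U = "{i. i < length L \<and> j \<le> L ! i}"
  have card: "card ?U = length (filter (\<lambda>y. j \<le> y) L)" by (simp add: length_filter_conv_card)
  have down: "i' \<in> ?U" if "i \<in> ?U" "i' \<le> i" for i i'
    using that sorted_rev_nth_mono[OF assms, of i' i] by auto
  have "?U = {..<card ?U}"
  proof (cases "?U = {}")
    case False
    define m where "m = Max ?U"
    have "m \<in> ?U" "\<And>i. i \<in> ?U \<Longrightarrow> i \<le> m"
      using False Max_in[of ?U] Max_ge[of ?U] unfolding m_def by auto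
    then have "?U = {..m}" using down by blast
    then show ?thesis by (simp add: lessThan_Suc_atMost[symmetric])
  next
    case True
    then show ?thesis unfolding True by simp
  qed
  then show ?thesis unfolding card .
qed

text \<open>Double counting: i times L ! i is i summed over the columns of row i. After exchanging
  the sums, column j contributes 0 + 1 + ... + (c - 1) for its length c. J may contain further
  columns, which have length 0.\<close>

lemma n_stat_list:
  fixes L :: "nat list"
  assumes srt: "sorted (rev L)" and J: "finite J" "\<And>i j. i < length L \<Longrightarrow> 1 \<le> j \<Longrightarrow> j \<le> L ! i \<Longrightarrow> j \<in> J" "0 \<notin> J"
  shows "(\<Sum>i<length L. i * L ! i) = (\<Sum>j\<in>J. length (filter (\<lambda>y. j \<le> y) L) choose 2)"
proof -
  have "(\<Sum>i<length L. i * L ! i) = (\<Sum>i<length L. \<Sum>j\<in>J. if j \<le> L ! i then i else 0)"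
  proof (rule sum.cong[OF refl])
    fix i assume "i \<in> {..<length L}"
    then have "{j \<in> J. j \<le> L ! i} = {1..L ! i}" using J by (auto simp: Suc_le_eq intro: gr0I)
    then have "(\<Sum>j\<in>J. if j \<le> L ! i then i else 0) = card {1..L ! i} * i"
      using J(1) by (simp add: sum.inter_filter[symmetric] del: card_atLeastAtMost)
    then show "i * L ! i = (\<Sum>j\<in>J. if j \<le> L ! i then i else 0)" by simp
  qed
  also have "\<dots> = (\<Sum>j\<in>J. \<Sum>i<length L. if j \<le> L ! i then i else 0)" by (rule sum.swap)
  also have "\<dots> = (\<Sum>j\<in>J. length (filter (\<lambda>y. j \<le> y) L) choose 2)"
  proof (rule sum.cong[OF refl])
    fix j
    have "(\<Sum>i<length L. if j \<le> L ! i then i else 0) = (\<Sum>i\<in>{i. i < length L \<and> j \<le> L ! i}. i)"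
      by (subst sum.inter_filter[symmetric]) (auto intro: sum.cong)
    then show "(\<Sum>i<length L. if j \<le> L ! i then i else 0) = length (filter (\<lambda>y. j \<le> y) L) choose 2"
      unfolding sorted_threshold[OF srt] sum_below_choose .
  qed
  finally show ?thesis .
qed

text \<open>The length of column j of the merged partition counts the parts of size at least j in
  all components, and this count does not see the order of the parts.\<close>

lemma n_stat_merged:
  assumes lam: "lam \<in> multipartitions l n"
  shows "n_stat (merged_partition lam) = col_stat l (mnodes lam)"
proof -
  note m = multipartitionsD[OF lam]
  define L where "L = merged_parts lam"
  define A where "A = {(s, i). s < length lam \<and> i \<ge> 1 \<and> (lam ! s) i \<noteq> 0}"
  have "A = (SIGMA s:{..<l}. {i. i \<ge> 1 \<and> (lam ! s) i \<noteq> 0})" unfolding A_def m(1) by auto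
  then have finA: "finite A" using finite_partition_support[OF m(2)] by auto
  have mset: "mset L = image_mset (\<lambda>(s, i). (lam ! s) i) (mset_set A)"
    unfolding L_def merged_parts_def A_def[symmetric] by simp
  have set: "set L = (\<lambda>(s, i). (lam ! s) i) ` A"
    using arg_cong[OF mset, of set_mset] finA by simp
  have srt: "sorted (rev L)" unfolding L_def merged_parts_def by simp
  have nz: "y \<noteq> 0" if "y \<in> set L" for y using that unfolding set A_def by auto
  have mp: "merged_partition lam (Suc i) = L ! i" if "i < length L" for i
    using that by (simp add: merged_partition_def L_def)
  \<comment> \<open>Parts are numbered from 1 and list positions from 0, so the weight i - 1 of a
    part becomes its list index.\<close>
  have supp: "{i. i \<ge> 1 \<and> merged_partition lam i \<noteq> 0} = Suc ` {..<length L}"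
  proof (intro Set.set_eqI iffI)
    fix i assume "i \<in> {i. i \<ge> 1 \<and> merged_partition lam i \<noteq> 0}"
    then have "1 \<le> i" "i \<le> length L" by (auto simp: merged_partition_def L_def split: if_splits)
    then show "i \<in> Suc ` {..<length L}" by (intro image_eqI[of _ _ "i - 1"]) auto
  next
    fix i assume "i \<in> Suc ` {..<length L}"
    then obtain k where "i = Suc k" "k < length L" by auto
    then show "i \<in> {i. i \<ge> 1 \<and> merged_partition lam i \<noteq> 0}" using mp[of k] nz[OF nth_mem] by simp
  qed
  have "n_stat (merged_partition lam) = (\<Sum>i<length L. i * L ! i)"
    unfolding n_stat_def supp by (subst sum.reindex) (auto simp: mp intro!: sum.cong)
  also have "\<dots> = (\<Sum>j\<in>(\<lambda>N. snd (snd N)) ` mnodes lam. length (filter (\<lambda>y. j \<le> y) L) choose 2)"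
  proof (rule n_stat_list[OF srt])
    show "finite ((\<lambda>N. snd (snd N)) ` mnodes lam)" using mnodes_card(1)[OF lam] by simp
    show "0 \<notin> (\<lambda>N. snd (snd N)) ` mnodes lam" by (auto simp: mnodes_def nodes_def)
    fix i j assume i: "i < length L" and j: "1 \<le> j" "j \<le> L ! i"
    have "L ! i \<in> (\<lambda>(s, i). (lam ! s) i) ` A" using set nth_mem[OF i] by simp
    then obtain s k where "(s, k) \<in> A" "L ! i = (lam ! s) k" by auto
    then have "(s, k, j) \<in> mnodes lam" using j unfolding mem_mnodes A_def by auto
    then show "j \<in> (\<lambda>N. snd (snd N)) ` mnodes lam" by force
  qed
  also have "\<dots> = col_stat l (mnodes lam)"
    unfolding col_stat_def
  proof (rule sum.cong[OF refl])
    fix j assume "j \<in> (\<lambda>N. snd (snd N)) ` mnodes lam"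
    then have j: "1 \<le> j" by (auto simp: mnodes_def nodes_def)
    have "length (filter (\<lambda>y. j \<le> y) L) = size (filter_mset (\<lambda>y. j \<le> y) (mset L))"
      by (metis mset_filter size_mset)
    also have "\<dots> = card {p \<in> A. case p of (s, i) \<Rightarrow> j \<le> (lam ! s) i}"
      unfolding mset filter_mset_image_mset size_image_mset using finA
      by (simp add: filter_mset_mset_set case_prod_unfold)
    also have "{p \<in> A. case p of (s, i) \<Rightarrow> j \<le> (lam ! s) i} = (SIGMA s:{..<l}. {i. i \<ge> 1 \<and> (lam ! s) i \<ge> j})"
      unfolding A_def m(1) using j by auto
    also have "card \<dots> = (\<Sum>s<l. conjugate (lam ! s) j)"
      unfolding conjugate_def
    proof (rule card_SigmaI)
      show "\<forall>s\<in>{..<l}. finite {i. i \<ge> 1 \<and> (lam ! s) i \<ge> j}"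
      proof
        fix s assume "s \<in> {..<l}"
        then have "finite {i. i \<ge> 1 \<and> (lam ! s) i \<noteq> 0}" using finite_partition_support[OF m(2)] by simp
        then show "finite {i. i \<ge> 1 \<and> (lam ! s) i \<ge> j}" by (rule rev_finite_subset) (use j in auto)
      qed
    qed simp
    also have "\<dots> = (\<Sum>s<l. col_len (mnodes lam) s j)"
      using col_len_mnodes[OF _ j] m(1) by simp
    finally show "length (filter (\<lambda>y. j \<le> y) L) choose 2 = (\<Sum>s<l. col_len (mnodes lam) s j) choose 2" by simp
  qed
  finally show ?thesis .
qed

section \<open>Valuations of rational functions\<close>

text \<open>Independence of the representation: cross-multiply two fractions and use that the order
  at 0 is additive on products.\<close>

lemma u_valuation_Fract:
  assumes "p \<noteq> 0" "q \<noteq> 0"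
  shows "u_valuation (Fract p q) = int (Polynomial.order 0 p) - int (Polynomial.order 0 q)"
  unfolding u_valuation_def
proof (rule the_equality)
  show "\<exists>p' q'. p' \<noteq> 0 \<and> q' \<noteq> 0 \<and> Fract p q = Fract p' q' \<and>
      int (Polynomial.order 0 p) - int (Polynomial.order 0 q) = int (Polynomial.order 0 p') - int (Polynomial.order 0 q')"
    using assms by blast
  fix v assume "\<exists>p' q'. p' \<noteq> 0 \<and> q' \<noteq> 0 \<and> Fract p q = Fract p' q' \<and>
      v = int (Polynomial.order 0 p') - int (Polynomial.order 0 q')"
  then obtain p' q' where pq: "p' \<noteq> 0" "q' \<noteq> 0" "Fract p q = Fract p' q'"
    "v = int (Polynomial.order 0 p') - int (Polynomial.order 0 q')" by blast
  have "p * q' = p' * q" using pq assms by (simp add: eq_fract)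
  then have "Polynomial.order 0 (p * q') = Polynomial.order 0 (p' * q)" by simp
  moreover have "p * q' \<noteq> 0" "p' * q \<noteq> 0" using assms pq by auto
  ultimately have "Polynomial.order 0 p + Polynomial.order 0 q' = Polynomial.order 0 p' + Polynomial.order 0 q"
    by (simp add: order_mult)
  then show "v = int (Polynomial.order 0 p) - int (Polynomial.order 0 q)" unfolding pq(4) by linarith
qed

lemma fract_nonzero_cases:
  fixes f :: "complex poly fract"
  assumes "f \<noteq> 0"
  obtains p q where "p \<noteq> 0" "q \<noteq> 0" "f = Fract p q"
proof (cases f)
  case (Fract a b)
  then show ?thesis using that[of a b] assms by (auto simp: Zero_fract_def eq_fract)
qed

lemma u_valuation_mult: "f \<noteq> 0 \<Longrightarrow> g \<noteq> 0 \<Longrightarrow> u_valuation (f * g) = u_valuation f + u_valuation g"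
proof -
  assume "f \<noteq> 0" "g \<noteq> 0"
  obtain p q where f: "p \<noteq> 0" "q \<noteq> 0" "f = Fract p q" using fract_nonzero_cases[OF \<open>f \<noteq> 0\<close>] .
  obtain a b where g: "a \<noteq> 0" "b \<noteq> 0" "g = Fract a b" using fract_nonzero_cases[OF \<open>g \<noteq> 0\<close>] .
  have nz: "p * a \<noteq> 0" "q * b \<noteq> 0" using f g by auto
  show ?thesis
    unfolding f(3) g(3) mult_fract u_valuation_Fract[OF nz] u_valuation_Fract[OF f(1,2)] u_valuation_Fract[OF g(1,2)]
      order_mult[OF nz(1)] order_mult[OF nz(2)] by simp
qed

lemma u_valuation_1: "u_valuation 1 = 0"
  unfolding One_fract_def by (subst u_valuation_Fract) auto

lemma u_valuation_inverse: "f \<noteq> 0 \<Longrightarrow> u_valuation (inverse f) = - u_valuation f"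
  using u_valuation_mult[of f "inverse f"] u_valuation_1 by simp

lemma u_valuation_divide: "f \<noteq> 0 \<Longrightarrow> g \<noteq> 0 \<Longrightarrow> u_valuation (f / g) = u_valuation f - u_valuation g"
  unfolding divide_inverse by (subst u_valuation_mult) (auto simp: u_valuation_inverse)

lemma u_valuation_power: "f \<noteq> 0 \<Longrightarrow> u_valuation (f ^ k) = int k * u_valuation f"
  by (induction k) (auto simp: u_valuation_1 u_valuation_mult algebra_simps)

lemma u_valuation_powi: "f \<noteq> 0 \<Longrightarrow> u_valuation (f powi k) = k * u_valuation f"
  by (auto simp: power_int_def u_valuation_power u_valuation_inverse)

lemma u_valuation_prod: "(\<And>a. a \<in> A \<Longrightarrow> f a \<noteq> 0) \<Longrightarrow> u_valuation (\<Prod>a\<in>A. f a) = (\<Sum>a\<in>A. u_valuation (f a))"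
proof (induction A rule: infinite_finite_induct)
  case (insert a A)
  then have "(\<Prod>a\<in>A. f a) \<noteq> 0" by (simp add: prod_zero_iff)
  then show ?case using insert by (simp add: u_valuation_mult)
qed (auto simp: u_valuation_1)

lemma const_fract_mult: "const_fract (c * d) = const_fract c * const_fract d"
  by (simp add: const_fract_def mult.commute)

lemma const_fract_1: "const_fract 1 = 1"
  by (simp add: const_fract_def One_fract_def one_pCons)

lemma const_fract_nz: "c \<noteq> 0 \<Longrightarrow> const_fract c \<noteq> 0"
  by (simp add: const_fract_def Zero_fract_def eq_fract)

lemma u_fract_nz: "u_fract \<noteq> 0"
  by (simp add: u_fract_def Zero_fract_def eq_fract)

lemma u_valuation_const: "c \<noteq> 0 \<Longrightarrow> u_valuation (const_fract c) = 0"
  unfolding const_fract_def by (subst u_valuation_Fract) (auto intro!: order_0I)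

lemma u_valuation_u: "u_valuation u_fract = 1"
proof -
  have "[:0, 1:] = (monom 1 1 :: complex poly)" by (simp add: monom_altdef)
  then show ?thesis unfolding u_fract_def by (subst u_valuation_Fract) auto
qed

lemma u_fract_power: "u_fract ^ m = Fract (monom 1 m) 1"
proof (induction m)
  case (Suc m)
  then show ?case by (simp add: u_fract_def monom_Suc)
qed (simp add: One_fract_def)

lemma u_valuation_monomial: "c \<noteq> 0 \<Longrightarrow> u_valuation (const_fract c * u_fract powi k) = k"
  using u_fract_nz const_fract_nz
  by (subst u_valuation_mult) (auto simp: u_valuation_const u_valuation_powi u_valuation_u)

text \<open>The origin of the minimum with 0. For k > 0 the constant - 1 determines the valuation,
  for k < 0 the monomial does, and for k = 0 the difference is a constant, nonzero by
  assumption.\<close>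

lemma u_valuation_monomial_minus_1:
  assumes c: "c \<noteq> 0" and ne: "const_fract c * u_fract powi k \<noteq> 1"
  shows "u_valuation (const_fract c * u_fract powi k - 1) = min k 0"
proof (cases "0 \<le> k")
  case True
  then obtain m where m: "k = int m" using nonneg_int_cases by blast
  have eq: "const_fract c * u_fract powi k = Fract (monom c m) 1"
    unfolding m power_int_of_nat u_fract_power const_fract_def by (simp add: smult_monom)
  then have eq1: "const_fract c * u_fract powi k - 1 = Fract (monom c m - 1) 1" by (simp add: One_fract_def)
  have "poly (monom c m - 1) 0 \<noteq> 0"
  proof (cases "m = 0")
    case True
    then have "c \<noteq> 1" using ne m const_fract_1 by auto
    then show ?thesis using True by (simp add: poly_monom)
  next
    case False then show ?thesis by (simp add: poly_monom power_0_left)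
  qed
  then have "Polynomial.order 0 (monom c m - 1) = 0" by (rule order_0I)
  moreover have "monom c m - 1 \<noteq> 0" using \<open>poly (monom c m - 1) 0 \<noteq> 0\<close> by (metis poly_0)
  ultimately show ?thesis unfolding eq1 using True by (subst u_valuation_Fract) auto
next
  case False
  define m where "m = nat (- k)"
  have m: "k = - int m" "m > 0" using False by (auto simp: m_def)
  have "const_fract c * u_fract powi k = Fract [:c:] (monom 1 m)"
    unfolding m(1) power_int_minus power_int_of_nat u_fract_power const_fract_def by simp
  then have eq1: "const_fract c * u_fract powi k - 1 = Fract ([:c:] - monom 1 m) (monom 1 m)"
    by (simp add: One_fract_def)
  have "poly ([:c:] - monom 1 m) 0 \<noteq> 0" using c m(2) by (simp add: poly_monom power_0_left)
  then have "Polynomial.order 0 ([:c:] - monom 1 m) = 0" by (rule order_0I)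
  moreover have "[:c:] - monom 1 m \<noteq> 0" using \<open>poly ([:c:] - monom 1 m) 0 \<noteq> 0\<close> by (metis poly_0)
  ultimately show ?thesis unfolding eq1 using m by (subst u_valuation_Fract) auto
qed


section \<open>The cyclotomic specialisation\<close>

text \<open>Translates the closure rules of the carrier-based \<open>generate_field\<close> into
  type-class operations, the form in which \<open>free_over\<close> and \<open>ak_over\<close> ask
  for them.\<close>

lemma generate_field_type_algebra:
  fixes U :: "'a::field set"
  defines "G \<equiv> generate_field ring_of_type_algebra U"
  shows "0 \<in> G" "1 \<in> G" "a \<in> G \<Longrightarrow> b \<in> G \<Longrightarrow> a + b \<in> G" "a \<in> G \<Longrightarrow> b \<in> G \<Longrightarrow> a * b \<in> G"
    "a \<in> G \<Longrightarrow> - a \<in> G" "a \<in> G \<Longrightarrow> inverse a \<in> G" "a \<in> U \<Longrightarrow> a \<in> G"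
proof -
  let ?K = "ring_of_type_algebra :: 'a ring"
  interpret K: field ?K by (rule field_from_type_algebra)
  have ops: "carrier ?K = UNIV" "\<one>\<^bsub>?K\<^esub> = 1" "\<zero>\<^bsub>?K\<^esub> = 0" "\<And>a b. a \<oplus>\<^bsub>?K\<^esub> b = a + b" "\<And>a b. a \<otimes>\<^bsub>?K\<^esub> b = a * b"
    by (auto simp: ring_of_type_algebra_def)
  have neg: "\<ominus>\<^bsub>?K\<^esub> a = - a" for a by (rule K.minus_equality) (auto simp: ops)
  have inv: "inv\<^bsub>?K\<^esub> a = inverse a" if "a \<noteq> 0" for a
    by (rule sym, rule K.inv_unique') (use that in \<open>auto simp: ops\<close>)
  show one: "1 \<in> G" using generate_field.one[of ?K U] by (simp add: G_def ops)
  show add: "a \<in> G \<Longrightarrow> b \<in> G \<Longrightarrow> a + b \<in> G" for a b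
    using generate_field.eng_add[of a ?K U b] by (simp add: G_def ops)
  show "a \<in> G \<Longrightarrow> b \<in> G \<Longrightarrow> a * b \<in> G"
    using generate_field.eng_mult[of a ?K U b] by (simp add: G_def ops)
  show um: "a \<in> G \<Longrightarrow> - a \<in> G" for a
    using generate_field.a_inv[of a ?K U] by (simp add: G_def neg)
  show zero: "0 \<in> G" using add[OF one um[OF one]] by simp
  show "a \<in> G \<Longrightarrow> inverse a \<in> G"
    using generate_field.m_inv[of a ?K U] inv[of a] zero by (cases "a = 0") (auto simp: G_def ops)
  show "a \<in> U \<Longrightarrow> a \<in> G" unfolding G_def by (rule generate_field.incl)
qed

lemma eta_nz: "eta l \<noteq> 0"
  by (simp add: eta_def)

lemma eta_power_inj:
  assumes "s < l" "t < l" "eta l ^ s = eta l ^ t"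
  shows "s = t"
proof -
  have l: "l > 0" using assms by simp
  have "eta l ^ k = cis (2 * pi * real k / real l)" for k
  proof -
    have "eta l = cis (2 * pi / real l)" unfolding eta_def cis_conv_exp by (simp add: mult_ac)
    then show ?thesis by (simp add: DeMoivre mult_ac)
  qed
  then show ?thesis
    using bij_betw_imp_inj_on[OF bij_betw_roots_unity[OF l]] assms by (auto dest!: inj_onD)
qed

lemma monomial_eqD:
  assumes "c \<noteq> 0" "d \<noteq> 0" "const_fract c * u_fract powi a = const_fract d * u_fract powi b"
  shows "c = d" "a = b"
proof -
  show ab: "a = b" using u_valuation_monomial[OF assms(1), of a] u_valuation_monomial[OF assms(2), of b] assms(3) by simp
  have "const_fract c = const_fract d" using assms(3) u_fract_nz unfolding ab by simp
  then show "c = d" by (simp add: const_fract_def eq_fract)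
qed

locale cyclotomic =
  fixes l n :: nat and r :: int and rs :: "nat \<Rightarrow> int"
  assumes l1: "1 \<le> l" and n1: "1 \<le> n" and r_pos: "0 < r"
begin

abbreviation "xu \<equiv> u_fract powi r"
abbreviation "Qu \<equiv> \<lambda>j. const_fract (eta l ^ j) * u_fract powi rs j"

lemma xu_powi_Qu: "xu powi k * Qu s = const_fract (eta l ^ s) * u_fract powi (r * k + rs s)"
proof -
  have "xu powi k = u_fract powi (r * k)" by (rule power_int_mult[symmetric])
  moreover have "u_fract powi (r * k + rs s) = u_fract powi (r * k) * u_fract powi rs s"
    by (rule power_int_add) (simp add: u_fract_nz)
  ultimately show ?thesis by (simp add: mult_ac)
qed

sublocale ak_setup l xu Qu "cyclotomic_rat_funs l" n
proof unfold_locales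
  let ?K = "const_fract ` cyclotomic_field l \<union> {u_fract}"
  note G = generate_field_type_algebra[where U = ?K, folded cyclotomic_rat_funs_def[of l]]
  note C = generate_field_type_algebra[where U = "{eta l}", folded cyclotomic_field_def[of l]]
  show "1 \<le> l" "1 \<le> n" by (fact l1 n1)+
  show "xu \<noteq> 0" using u_fract_nz by simp
  show "Qu s \<noteq> 0" if "s < l" for s using u_fract_nz const_fract_nz[of "eta l ^ s"] eta_nz by simp
  \<comment> \<open>The constants of the two monomials distinguish the parameters through the powers
    of \<open>eta l\<close>; comparing exponents of u then gives r * k = 0, and r is
    positive.\<close>
  show "s = t \<and> k = 0" if "s < l" "t < l" "xu powi k * Qu s = Qu t" for s t k
  proof -
    have "eta l ^ s = eta l ^ t" "r * k + rs s = rs t"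
      using monomial_eqD[OF _ _ that(3)[unfolded xu_powi_Qu]] eta_nz by auto
    then show ?thesis using eta_power_inj[OF that(1,2)] r_pos by auto
  qed
  show "0 \<in> cyclotomic_rat_funs l" by (rule G(1))
  show "1 \<in> cyclotomic_rat_funs l" by (rule G(2))
  show "a + b \<in> cyclotomic_rat_funs l" if "a \<in> cyclotomic_rat_funs l" "b \<in> cyclotomic_rat_funs l" for a b
    using that by (rule G(3))
  show mult: "a * b \<in> cyclotomic_rat_funs l" if "a \<in> cyclotomic_rat_funs l" "b \<in> cyclotomic_rat_funs l" for a b
    using that by (rule G(4))
  show "- a \<in> cyclotomic_rat_funs l" if "a \<in> cyclotomic_rat_funs l" for a using that by (rule G(5))
  show inv: "inverse a \<in> cyclotomic_rat_funs l" if "a \<in> cyclotomic_rat_funs l" for a using that by (rule G(6))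
  have pow: "a ^ k \<in> cyclotomic_rat_funs l" if "a \<in> cyclotomic_rat_funs l" for a k
    by (induction k) (auto intro: G(2) mult that)
  have powi: "u_fract powi k \<in> cyclotomic_rat_funs l" for k
    using pow inv G(7)[of u_fract] by (auto simp: power_int_def)
  then show "xu \<in> cyclotomic_rat_funs l" .
  have "eta l ^ j \<in> cyclotomic_field l" for j by (induction j) (auto intro: C(2,4,7))
  then have "const_fract (eta l ^ j) \<in> cyclotomic_rat_funs l" for j by (intro G(7)) auto
  then show "Qu j \<in> cyclotomic_rat_funs l" if "j < l" for j by (intro mult powi)
qed

lemma hook_factor_valuation:
  assumes D: "diagram l D" and N: "(s, i, j) \<in> D" and t: "t < l"
  shows "u_valuation (hook_factor D (s, i, j) t) =
    min (r * (int (row_len D s i) - int i + int (col_len D t j) - int j + 1) + rs s - rs t) 0"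
proof -
  let ?h = "int (row_len D s i) - int i + int (col_len D t j) - int j + 1"
  let ?c = "eta l ^ s / eta l ^ t" and ?k = "r * ?h + rs s - rs t"
  have cf: "const_fract ?c * const_fract (eta l ^ t) = const_fract (eta l ^ s)"
    unfolding const_fract_mult[symmetric] using eta_nz by simp
  have "const_fract ?c * u_fract powi ?k * Qu t = (const_fract ?c * const_fract (eta l ^ t)) * (u_fract powi ?k * u_fract powi rs t)"
    by (simp add: mult_ac)
  also have "\<dots> = xu powi ?h * Qu s"
    unfolding cf xu_powi_Qu using u_fract_nz power_int_add[of u_fract ?k "rs t"] by (simp add: algebra_simps)
  finally have "const_fract ?c * u_fract powi ?k = xu powi ?h * Qu s / Qu t"
    using Q_nz[OF t] by (simp add: eq_divide_eq)
  then have eq: "hook_factor D (s, i, j) t = const_fract ?c * u_fract powi ?k - 1"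
    unfolding hook_factor_def prod.case by simp
  have "const_fract ?c * u_fract powi ?k \<noteq> 1" using hook_factor_nz[OF D N t] unfolding eq by simp
  then show ?thesis unfolding eq using eta_nz by (intro u_valuation_monomial_minus_1) auto
qed

lemma schur_valuation:
  assumes D: "diagram l D"
  shows "u_valuation (schur D) = - (r * int (col_stat l D)) +
    (\<Sum>(s, i, j)\<in>D. \<Sum>t\<in>{..<l} - {s}.
      min (r * (int (row_len D s i) - int i + int (col_len D t j) - int j + 1) + rs s - rs t) 0)"
proof -
  have x1: "u_valuation (xu - 1) = 0"
    using u_valuation_monomial_minus_1[of 1 r] x_not_1 r_pos by (simp add: const_fract_1)
  have m1: "u_valuation (- 1) = 0"
    using u_valuation_mult[of "- 1" "- 1"] u_valuation_1 by simp
  have nz: "(- 1 :: complex poly fract) ^ ((l - 1) * card D) \<noteq> 0" "xu powi (- int (col_stat l D)) \<noteq> 0"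
    "(xu - 1) ^ card D \<noteq> 0" "(\<Prod>N\<in>D. \<Prod>t<l. hook_factor D N t) \<noteq> 0"
    using x_nz x_not_1 hook_factor_nz[OF D] diagram_finite[OF D] by (auto simp: prod_zero_iff)
  have "u_valuation (schur D) = - (r * int (col_stat l D)) + u_valuation (\<Prod>N\<in>D. \<Prod>t<l. hook_factor D N t)"
  proof -
    have "u_valuation (xu powi (- int (col_stat l D))) = - (r * int (col_stat l D))"
      using u_valuation_powi[OF x_nz, of "- int (col_stat l D)"] u_valuation_powi[OF u_fract_nz, of r] u_valuation_u by simp
    moreover have "u_valuation ((- 1) ^ ((l - 1) * card D)) = 0"
      by (subst u_valuation_power) (auto simp: m1)
    moreover have "u_valuation ((xu - 1) ^ card D) = 0"
      by (subst u_valuation_power) (use x_not_1 in \<open>auto simp: x1\<close>)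
    moreover have "u_valuation (schur D) = u_valuation ((- 1) ^ ((l - 1) * card D)) +
       u_valuation (xu powi (- int (col_stat l D))) - u_valuation ((xu - 1) ^ card D) +
       u_valuation (\<Prod>N\<in>D. \<Prod>t<l. hook_factor D N t)"
    proof -
      have "u_valuation (a * b / c * e) = u_valuation a + u_valuation b - u_valuation c + u_valuation e"
        if "a \<noteq> 0" "b \<noteq> 0" "c \<noteq> 0" "e \<noteq> 0" for a b c e
        using that by (simp add: u_valuation_mult u_valuation_divide)
      from this[OF nz] show ?thesis unfolding schur_def .
    qed
    ultimately show ?thesis by simp
  qed
  also have "u_valuation (\<Prod>N\<in>D. \<Prod>t<l. hook_factor D N t) = (\<Sum>N\<in>D. \<Sum>t<l. u_valuation (hook_factor D N t))"
  proof -
    have "(\<Prod>t<l. hook_factor D N t) \<noteq> 0" if "N \<in> D" for N using hook_factor_nz[OF D that] by (auto simp: prod_zero_iff)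
    then have "u_valuation (\<Prod>N\<in>D. \<Prod>t<l. hook_factor D N t) = (\<Sum>N\<in>D. u_valuation (\<Prod>t<l. hook_factor D N t))"
      by (rule u_valuation_prod)
    also have "\<dots> = (\<Sum>N\<in>D. \<Sum>t<l. u_valuation (hook_factor D N t))"
      using hook_factor_nz[OF D] by (intro sum.cong refl u_valuation_prod) auto
    finally show ?thesis .
  qed
  also have "\<dots> = (\<Sum>(s, i, j)\<in>D. \<Sum>t\<in>{..<l} - {s}.
      min (r * (int (row_len D s i) - int i + int (col_len D t j) - int j + 1) + rs s - rs t) 0)"
  proof (rule sum.cong[OF refl])
    fix N assume N: "N \<in> D"
    obtain s i j where eq: "N = (s, i, j)" by (cases N)
    note ND = N[unfolded eq]
    let ?v = "\<lambda>t. min (r * (int (row_len D s i) - int i + int (col_len D t j) - int j + 1) + rs s - rs t) 0"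
    have s: "s < l" using diagram_memD(1)[OF D ND] .
    have "j \<le> row_len D s i" "i \<le> col_len D s j"
      using ND mem_diagram_row[OF D, of s i j] mem_diagram_col[OF D, of s i j] by auto
    then have "0 \<le> int (row_len D s i) - int i + int (col_len D s j) - int j + 1" by simp
    \<comment> \<open>For t = s the hook length is positive, so the minimum is 0. This is why the
      final sum runs over t different from s.\<close>
    then have v0: "?v s = 0" using r_pos by simp
    have "(\<Sum>t<l. u_valuation (hook_factor D N t)) = (\<Sum>t<l. ?v t)"
      unfolding eq using hook_factor_valuation[OF D ND] by (intro sum.cong) auto
    also have "\<dots> = (\<Sum>t\<in>{..<l} - {s}. ?v t)" using v0 s by (simp add: sum.remove[of "{..<l}" s])
    finally show "(\<Sum>t<l. u_valuation (hook_factor D N t)) = (case N of (s, i, j) \<Rightarrow> \<Sum>t\<in>{..<l} - {s}.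
      min (r * (int (row_len D s i) - int i + int (col_len D t j) - int j + 1) + rs s - rs t) 0)"
      unfolding eq prod.case .
  qed
  finally show ?thesis .
qed

lemma a_value_formula:
  assumes lam: "lam \<in> multipartitions l n"
  shows "a_value l n r rs lam = r * int (n_stat (merged_partition lam)) -
    (\<Sum>s<l. \<Sum>(i, j)\<in>nodes (lam ! s). \<Sum>t\<in>{..<l} - {s}. min (r * gen_hook (lam ! s) (lam ! t) i j + rs s - rs t) 0)"
proof -
  let ?D = "mnodes lam"
  note m = multipartitionsD[OF lam]
  have D: "diagram l ?D" by (rule mnodes_diagram[OF lam])
  have "a_value l n r rs lam = - u_valuation (schur ?D)"
    unfolding a_value_def cyclotomic_schur_element_def schur_element_hook_formula[OF lam] ..
  also have "\<dots> = r * int (col_stat l ?D) - (\<Sum>(s, i, j)\<in>?D. \<Sum>t\<in>{..<l} - {s}.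
      min (r * (int (row_len ?D s i) - int i + int (col_len ?D t j) - int j + 1) + rs s - rs t) 0)"
    unfolding schur_valuation[OF D] by simp
  also have "(\<Sum>(s, i, j)\<in>?D. \<Sum>t\<in>{..<l} - {s}.
      min (r * (int (row_len ?D s i) - int i + int (col_len ?D t j) - int j + 1) + rs s - rs t) 0) =
    (\<Sum>(s, i, j)\<in>?D. \<Sum>t\<in>{..<l} - {s}. min (r * gen_hook (lam ! s) (lam ! t) i j + rs s - rs t) 0)"
  proof (rule sum.cong[OF refl], clarify, rule sum.cong[OF refl])
    fix s i j t assume N: "(s, i, j) \<in> ?D" and t: "t \<in> {..<l} - {s}"
    have "s < length lam" "1 \<le> i" "1 \<le> j" using N unfolding mem_mnodes by auto
    then show "min (r * (int (row_len ?D s i) - int i + int (col_len ?D t j) - int j + 1) + rs s - rs t) 0 =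
      min (r * gen_hook (lam ! s) (lam ! t) i j + rs s - rs t) 0"
      using row_len_mnodes[of s lam i] col_len_mnodes[of t lam j] t m(1) by (simp add: gen_hook_def)
  qed
  also have "\<dots> = (\<Sum>s<l. \<Sum>(i, j)\<in>nodes (lam ! s). \<Sum>t\<in>{..<l} - {s}.
      min (r * gen_hook (lam ! s) (lam ! t) i j + rs s - rs t) 0)"
    unfolding mnodes_Sigma m(1) by (subst sum.Sigma[symmetric]) (auto intro: nodes_finite m(2))
  finally show ?thesis unfolding n_stat_merged[OF lam] .
qed

end

theorem proposition4p5:
  fixes l n :: nat and r :: int and rs :: "nat \<Rightarrow> int" and m :: "nat \<Rightarrow> rat"
    and lam :: "(nat \<Rightarrow> nat) list"
  assumes "l \<ge> 1" and "n \<ge> 1" and "r > 0"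
    and "\<And>i. i < l \<Longrightarrow> m i = of_int (rs i) / of_int r"
    and "lam \<in> multipartitions l n"
  shows "of_int (a_value l n r rs lam) =
    of_int r * (of_nat (n_stat (merged_partition lam)) -
      (\<Sum>s<l. \<Sum>(i, j)\<in>nodes (lam ! s). \<Sum>t\<in>{..<l} - {s}.
         min (of_int (gen_hook (lam ! s) (lam ! t) i j) + m s - m t) 0))"
proof -
  interpret cyclotomic l n r rs
    by unfold_locales (use assms(1-3) in auto)
  \<comment> \<open>Multiplication by r clears the denominators of m s and m t, and it commutes with
    the minimum because r is positive.\<close>
  have key: "of_int (min (r * h + rs s - rs t) 0) = of_int r * min (of_int h + m s - m t) 0"
    if "s < l" "t < l" for h s t
  proof -
    have "(of_int r :: rat) > 0" using assms(3) by simp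
    then have "of_int r * (of_int h + m s - m t) = of_int (r * h + rs s - rs t)"
      using assms(4)[OF that(1)] assms(4)[OF that(2)] by (simp add: field_simps)
    then show ?thesis
      using \<open>(of_int r :: rat) > 0\<close> by (simp add: min_mult_distrib_left of_int_min del: of_int_add of_int_diff of_int_mult)
  qed
  have "of_int (\<Sum>s<l. \<Sum>(i, j)\<in>nodes (lam ! s). \<Sum>t\<in>{..<l} - {s}.
        min (r * gen_hook (lam ! s) (lam ! t) i j + rs s - rs t) 0) =
      of_int r * (\<Sum>s<l. \<Sum>(i, j)\<in>nodes (lam ! s). \<Sum>t\<in>{..<l} - {s}.
        min (of_int (gen_hook (lam ! s) (lam ! t) i j) + m s - m t) 0)"
    unfolding of_int_sum sum_distrib_left
  proof (intro sum.cong refl)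
    fix s p assume s: "s \<in> {..<l}"
    show "of_int (case p of (i, j) \<Rightarrow> \<Sum>t\<in>{..<l} - {s}. min (r * gen_hook (lam ! s) (lam ! t) i j + rs s - rs t) 0) =
        of_int r * (case p of (i, j) \<Rightarrow> \<Sum>t\<in>{..<l} - {s}. min (of_int (gen_hook (lam ! s) (lam ! t) i j) + m s - m t) 0)"
      using key s by (cases p) (auto simp: of_int_sum sum_distrib_left intro!: sum.cong)
  qed
  then show ?thesis
    unfolding a_value_formula[OF assms(5)] by (simp add: right_diff_distrib)
qed

end
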